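(* Let $\theta_0\in\Theta$ be the true regression function, with $k_0$ change-points, and let the prior $\Pi$ on $\Theta$ satisfy assumption (A) (all defined in the context). Then $$\Pi^n(k=k_0)\to 1\quad\text{in } P_0^n\text{-probability as } n\to\infty ,$$ where $\Pi^n(k=k_0)=\Pi^n(\Theta_{k_0})$ is the posterior probability that the number of change-points equals $k_0$.
   Context: Model space. Fix an integer $k_{max}\ge 1$ and $K>0$. For $k\ge1$ let $T_k$ be the set of tuples $t=(t_0,\dots,t_k)$ with $0=t_0<t_1<\dots<t_k=1$ (identified with a subset of $\mathbb{R}^{k-1}$ through $(t_1,\dots,t_{k-1})$). A pair $(a,t)\in[-K,K]^k\times T_k$ is identified with the step function $\theta(x)=\sum_{j=1}^k a_j I(t_{j-1}\le x<t_j)$ on $[0,1)$. $\Theta_k$ is the set of such $\theta=(a,t)$ ("functions with $k$ change-points", i.e. $k$ segments), and $\Theta=\bigcup_{k=1}^{k_{max}}\Theta_k$; $k$ is regarded as part of the parameter. Data. One observes i.i.d. $Z_i=(X_i,Y_i)$, $i=1,\dots,n$, with $X_i$ uniform on $[0,1)$ and $Y_i=\theta_0(X_i)+\varepsilon_i$, where the $\varepsilon_i\sim N(0,1)$ are i.i.d. and independent of the $X_i$. The true function is $\theta_0=\sum_{j=1}^{k_0}a_j^0I(t_{j-1}^0\le x<t_j^0)\in\Theta_{k_0}\subset\Theta$, $k_0\le k_{max}$, with $a_j^0\ne a_{j-1}^0$ for $2\le j\le k_0$. $P_\theta$ is the law of one observation under $\theta$, with density $p_\theta$; $P_0=P_{\theta_0}$,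 and $P_0^n$ is the law of $(Z_1,\dots,Z_n)$ under $\theta_0$. Prior. $\Pi=\sum_{k=1}^{k_{max}}p(k)\Pi_k$ with $p(k)>0$, $\sum_kp(k)=1$, where $\Pi_k$ is a probability measure on $\Theta_k$ with density $\pi_k(a,t)=\pi_k^a(a|t)\pi_k^t(t)$ with respect to Lebesgue measure. Assumption (A): for each $k$, the densities $\pi_k^a(a|t)$ and $\pi_k^t(t)$ are bounded away from zero and infinity on $[-K,K]^k$ and $T_k$ respectively. Posterior. $\Pi^n(A)=\int_A\prod_{i=1}^np_\theta(Z_i)\,d\Pi(\theta)\big/\int\prod_{i=1}^np_\theta(Z_i)\,d\Pi(\theta)$. *)

theory Defs
  imports "HOL-Probability.Probability"
begin

section \<open>Step functions\<close>

(* Tuples are extensional functions on an index set, so that the number of segments k may vary.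
   A tuple 0 = t_0 < t_1 < ... < t_k = 1 is stored through its free coordinates
   t_1, ..., t_{k-1}; knot restores the two fixed end points.  A parameter is a triple
   (k, a, t): the number of segments k belongs to it. *)

type_synonym param = "nat \<times> (nat \<Rightarrow> real) \<times> (nat \<Rightarrow> real)"

definition knot :: "nat \<Rightarrow> (nat \<Rightarrow> real) \<Rightarrow> nat \<Rightarrow> real" where
  "knot k t j = (if j = 0 then 0 else if j = k then 1 else t j)"

definition locations :: "nat \<Rightarrow> (nat \<Rightarrow> real) set" where
  "locations k = {t \<in> extensional {1..<k}. \<forall>j\<in>{1..k}. knot k t (j - 1) < knot k t j}"

definition levels :: "nat \<Rightarrow> real \<Rightarrow> (nat \<Rightarrow> real) set" where
  "levels k K = {1..k} \<rightarrow>\<^sub>E {-K..K}"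

definition Theta :: "nat \<Rightarrow> real \<Rightarrow> param set" where
  "Theta kmax K = (SIGMA k:{1..kmax}. levels k K \<times> locations k)"

definition step_fun :: "param \<Rightarrow> real \<Rightarrow> real" where
  "step_fun = (\<lambda>(k, a, t) x. \<Sum>j=1..k. a j * indicator {knot k t (j - 1)..<knot k t j} x)"

section \<open>Observations\<close>

definition obs_law :: "param \<Rightarrow> (real \<times> real) measure" where
  "obs_law \<theta> = distr (uniform_measure lborel {0..<1} \<Otimes>\<^sub>M density lborel std_normal_density)
     (borel \<Otimes>\<^sub>M borel) (\<lambda>(x, e). (x, step_fun \<theta> x + e))"

definition obs_density :: "param \<Rightarrow> real \<times> real \<Rightarrow> real" where
  "obs_density \<theta> = (\<lambda>(x, y). indicator {0..<1} x * std_normal_density (y - step_fun \<theta> x))"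

definition sample_law :: "param \<Rightarrow> nat \<Rightarrow> (nat \<Rightarrow> real \<times> real) measure" where
  "sample_law \<theta> n = (\<Pi>\<^sub>M i\<in>{1..n}. obs_law \<theta>)"

section \<open>Prior and posterior\<close>

(* Lebesgue measure on [-K,K]^k and on T_k; for k = 1 the latter is the unit mass at the
   only point of T_1. *)

definition level_measure :: "nat \<Rightarrow> real \<Rightarrow> (nat \<Rightarrow> real) measure" where
  "level_measure k K = restrict_space (\<Pi>\<^sub>M j\<in>{1..k}. lborel) (levels k K)"

definition location_measure :: "nat \<Rightarrow> (nat \<Rightarrow> real) measure" where
  "location_measure k = restrict_space (\<Pi>\<^sub>M j\<in>{1..<k}. lborel) (locations k)"

(* \<pi>t is a probability density on T_k and, for each t in T_k, \<pi>a _ t is a (conditional)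
   probability density on [-K,K]^k. *)

definition prior_densities ::
  "nat \<Rightarrow> real \<Rightarrow> ((nat \<Rightarrow> real) \<Rightarrow> (nat \<Rightarrow> real) \<Rightarrow> real) \<Rightarrow> ((nat \<Rightarrow> real) \<Rightarrow> real) \<Rightarrow> bool" where
  "prior_densities k K \<pi>a \<pi>t \<longleftrightarrow>
     (\<lambda>(a, t). \<pi>a a t) \<in> borel_measurable (level_measure k K \<Otimes>\<^sub>M location_measure k) \<and>
     \<pi>t \<in> borel_measurable (location_measure k) \<and>
     (\<forall>a\<in>levels k K. \<forall>t\<in>locations k. 0 \<le> \<pi>a a t) \<and>
     (\<forall>t\<in>locations k. 0 \<le> \<pi>t t) \<and>
     (\<forall>t\<in>locations k. (\<integral>\<^sup>+ a. ennreal (\<pi>a a t) \<partial>level_measure k K) = 1) \<and>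
     (\<integral>\<^sup>+ t. ennreal (\<pi>t t) \<partial>location_measure k) = 1"

definition bounded_away ::
  "nat \<Rightarrow> real \<Rightarrow> ((nat \<Rightarrow> real) \<Rightarrow> (nat \<Rightarrow> real) \<Rightarrow> real) \<Rightarrow> ((nat \<Rightarrow> real) \<Rightarrow> real) \<Rightarrow> bool" where
  "bounded_away k K \<pi>a \<pi>t \<longleftrightarrow>
     (\<exists>c>0. \<exists>C. (\<forall>a\<in>levels k K. \<forall>t\<in>locations k. c \<le> \<pi>a a t \<and> \<pi>a a t \<le> C) \<and>
               (\<forall>t\<in>locations k. c \<le> \<pi>t t \<and> \<pi>t t \<le> C))"

definition prior_k ::
  "nat \<Rightarrow> real \<Rightarrow> ((nat \<Rightarrow> real) \<Rightarrow> (nat \<Rightarrow> real) \<Rightarrow> real) \<Rightarrow> ((nat \<Rightarrow> real) \<Rightarrow> real) \<Rightarrow>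
   ((nat \<Rightarrow> real) \<times> (nat \<Rightarrow> real)) measure" where
  "prior_k k K \<pi>a \<pi>t =
     density (level_measure k K \<Otimes>\<^sub>M location_measure k) (\<lambda>(a, t). ennreal (\<pi>a a t * \<pi>t t))"

(* The mixture of the prior_k on the disjoint union Theta: a set is measurable iff each of its
   sections at k is. *)

definition Theta_sets :: "nat \<Rightarrow> real \<Rightarrow> param set set" where
  "Theta_sets kmax K = {A. A \<subseteq> Theta kmax K \<and>
     (\<forall>k\<in>{1..kmax}. Pair k -` A \<in> sets (level_measure k K \<Otimes>\<^sub>M location_measure k))}"

definition prior ::
  "nat \<Rightarrow> real \<Rightarrow> (nat \<Rightarrow> real) \<Rightarrow> (nat \<Rightarrow> (nat \<Rightarrow> real) \<Rightarrow> (nat \<Rightarrow> real) \<Rightarrow> real) \<Rightarrow>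
   (nat \<Rightarrow> (nat \<Rightarrow> real) \<Rightarrow> real) \<Rightarrow> param measure" where
  "prior kmax K p \<pi>a \<pi>t = measure_of (Theta kmax K) (Theta_sets kmax K)
     (\<lambda>A. \<Sum>k=1..kmax. ennreal (p k) * emeasure (prior_k k K (\<pi>a k) (\<pi>t k)) (Pair k -` A))"

definition posterior ::
  "param measure \<Rightarrow> nat \<Rightarrow> (nat \<Rightarrow> real \<times> real) \<Rightarrow> param set \<Rightarrow> real" where
  "posterior Q n z A =
     (LINT \<theta>:A|Q. (\<Prod>i=1..n. obs_density \<theta> (z i))) / (LINT \<theta>|Q. (\<Prod>i=1..n. obs_density \<theta> (z i)))"

section \<open>Convergence in probability along varying probability spaces\<close>

definition tendsto_in_prob ::
  "(nat \<Rightarrow> 'a measure) \<Rightarrow> (nat \<Rightarrow> 'a \<Rightarrow> real) \<Rightarrow> real \<Rightarrow> bool" where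
  "tendsto_in_prob M X c \<longleftrightarrow>
     (\<forall>n. X n \<in> borel_measurable (M n)) \<and>
     (\<forall>e>0. (\<lambda>n. measure (M n) {\<omega> \<in> space (M n). e < \<bar>X n \<omega> - c\<bar>}) \<longlonglongrightarrow> 0)"

section \<open>Consistency of the definitions\<close>

lemma measurable_step_fun [measurable]: "step_fun \<theta> \<in> borel_measurable borel"
proof -
  obtain k a t where "\<theta> = (k, a, t)" by (cases \<theta>)
  then have "step_fun \<theta> = (\<lambda>x. \<Sum>j=1..k. a j * indicator {knot k t (j - 1)..<knot k t j} x)"
    by (simp add: step_fun_def)
  also have "\<dots> \<in> borel_measurable borel" by measurable
  finally show ?thesis .
qed

lemma measurable_obs_density [measurable]:
  "obs_density \<theta> \<in> borel_measurable (borel \<Otimes>\<^sub>M borel)"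
  unfolding obs_density_def by measurable

lemma uniform_unit: "uniform_measure lborel {0..<1::real} = density lborel (indicator {0..<1})"
  unfolding uniform_measure_def by (rule arg_cong2[where f=density]) (auto simp: divide_ennreal_def)

lemma prob_space_obs_law: "prob_space (obs_law \<theta>)"
proof -
  interpret U: prob_space "uniform_measure lborel {0..<1::real}"
    by (rule prob_space_uniform_measure) auto
  interpret N: prob_space "density lborel std_normal_density"
    by (rule prob_space_normal_density) simp
  interpret UN: pair_prob_space "uniform_measure lborel {0..<1::real}"
    "density lborel std_normal_density" ..
  show ?thesis unfolding obs_law_def
    by (rule UN.prob_space_distr) measurable
qed

lemma obs_law_eq_density:
  "obs_law \<theta> = density (lborel \<Otimes>\<^sub>M lborel) (\<lambda>z. ennreal (obs_density \<theta> z))"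
proof (rule measure_eqI)
  show "sets (obs_law \<theta>) = sets (density (lborel \<Otimes>\<^sub>M lborel) (\<lambda>z. ennreal (obs_density \<theta> z)))"
    unfolding obs_law_def by (simp cong: sets_pair_measure_cong)
next
  fix A assume "A \<in> sets (obs_law \<theta>)"
  then have A [measurable]: "A \<in> sets (borel \<Otimes>\<^sub>M borel)" by (simp add: obs_law_def)
  let ?s = "step_fun \<theta>"
  interpret N: prob_space "density lborel std_normal_density"
    by (rule prob_space_normal_density) simp
  have "emeasure (obs_law \<theta>) A =
      (\<integral>\<^sup>+ w. indicator A (fst w, ?s (fst w) + snd w)
        \<partial>(uniform_measure lborel {0..<1} \<Otimes>\<^sub>M density lborel std_normal_density))"
    unfolding obs_law_def
    by (subst nn_integral_indicator[symmetric], simp)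
       (subst nn_integral_distr, auto simp: case_prod_beta)
  also have "\<dots> = (\<integral>\<^sup>+ x. \<integral>\<^sup>+ e. indicator A (x, ?s x + e) \<partial>density lborel std_normal_density
        \<partial>uniform_measure lborel {0..<1})"
    by (subst N.nn_integral_fst[symmetric]) auto
  also have "\<dots> = (\<integral>\<^sup>+ x. indicator {0..<1} x *
        (\<integral>\<^sup>+ e. ennreal (std_normal_density e) * indicator A (x, ?s x + e) \<partial>lborel) \<partial>lborel)"
    unfolding uniform_unit by (simp add: nn_integral_density)
  also have "\<dots> = (\<integral>\<^sup>+ x. indicator {0..<1} x *
        (\<integral>\<^sup>+ y. ennreal (std_normal_density (y - ?s x)) * indicator A (x, y) \<partial>lborel) \<partial>lborel)"
  proof -
    have "(\<integral>\<^sup>+ e. ennreal (std_normal_density e) * indicator A (x, ?s x + e) \<partial>lborel) =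
          (\<integral>\<^sup>+ y. ennreal (std_normal_density (y - ?s x)) * indicator A (x, y) \<partial>lborel)" for x
      using nn_integral_real_affine[of "\<lambda>e. ennreal (std_normal_density e) * indicator A (x, ?s x + e)"
          1 "- ?s x"] by simp
    then show ?thesis by simp
  qed
  also have "\<dots> = (\<integral>\<^sup>+ x. \<integral>\<^sup>+ y. ennreal (obs_density \<theta> (x, y)) * indicator A (x, y) \<partial>lborel \<partial>lborel)"
  proof (intro nn_integral_cong)
    fix x :: real
    show "indicator {0..<1} x *
        (\<integral>\<^sup>+ y. ennreal (std_normal_density (y - ?s x)) * indicator A (x, y) \<partial>lborel) =
      (\<integral>\<^sup>+ y. ennreal (obs_density \<theta> (x, y)) * indicator A (x, y) \<partial>lborel)"
      by (cases "x \<in> {0..<1}") (simp_all add: obs_density_def)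
  qed
  also have "\<dots> = (\<integral>\<^sup>+ z. ennreal (obs_density \<theta> z) * indicator A z \<partial>(lborel \<Otimes>\<^sub>M lborel))"
    by (subst lborel.nn_integral_fst[symmetric]) auto
  also have "\<dots> = emeasure (density (lborel \<Otimes>\<^sub>M lborel) (\<lambda>z. ennreal (obs_density \<theta> z))) A"
    by (subst emeasure_density) auto
  finally show "emeasure (obs_law \<theta>) A =
    emeasure (density (lborel \<Otimes>\<^sub>M lborel) (\<lambda>z. ennreal (obs_density \<theta> z))) A" .
qed

lemma locations_eq_PiE_Collect:
  "locations k = {t \<in> space (\<Pi>\<^sub>M j\<in>{1..<k}. lborel). \<forall>j\<in>{1..k}. knot k t (j - 1) < knot k t j}"
  by (auto simp: locations_def space_PiM PiE_def)

lemma measurable_knot [measurable]: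
  "j \<le> k \<Longrightarrow> (\<lambda>t. knot k t j) \<in> borel_measurable (\<Pi>\<^sub>M j\<in>{1..<k}. lborel)"
  by (cases "j = 0"; cases "j = k") (auto simp: knot_def)

lemma sets_locations: "locations k \<in> sets (\<Pi>\<^sub>M j\<in>{1..<k}. lborel)"
  unfolding locations_eq_PiE_Collect
  by (intro sets.sets_Collect_finite_All borel_measurable_less measurable_knot) auto

lemma sets_levels: "levels k K \<in> sets (\<Pi>\<^sub>M j\<in>{1..k}. lborel)"
  unfolding levels_def by (rule sets_PiM_I_finite) auto

lemma space_level_measure: "space (level_measure k K) = levels k K"
  by (auto simp: level_measure_def space_restrict_space space_PiM levels_def PiE_def)

lemma space_location_measure: "space (location_measure k) = locations k"
  by (auto simp: location_measure_def space_restrict_space space_PiM locations_def PiE_def)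

lemma sigma_finite_level_measure: "sigma_finite_measure (level_measure k K)"
proof -
  interpret product_sigma_finite "\<lambda>_::nat. lborel :: real measure" ..
  show ?thesis unfolding level_measure_def
    by (intro sigma_finite_measure_restrict_space sigma_finite sets_levels) auto
qed

lemma sigma_finite_location_measure: "sigma_finite_measure (location_measure k)"
proof -
  interpret product_sigma_finite "\<lambda>_::nat. lborel :: real measure" ..
  show ?thesis unfolding location_measure_def
    by (intro sigma_finite_measure_restrict_space sigma_finite sets_locations) auto
qed

lemma prob_space_prior_k:
  assumes "prior_densities k K \<pi>a \<pi>t"
  shows "prob_space (prior_k k K \<pi>a \<pi>t)"
proof
  interpret L: sigma_finite_measure "level_measure k K" by (rule sigma_finite_level_measure)
  interpret T: sigma_finite_measure "location_measure k" by (rule sigma_finite_location_measure)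
  interpret LT: pair_sigma_finite "level_measure k K" "location_measure k" ..
  have [measurable]: "(\<lambda>(a, t). \<pi>a a t) \<in> borel_measurable (level_measure k K \<Otimes>\<^sub>M location_measure k)"
    "\<pi>t \<in> borel_measurable (location_measure k)"
    using assms by (auto simp: prior_densities_def)
  have "emeasure (prior_k k K \<pi>a \<pi>t) (space (prior_k k K \<pi>a \<pi>t)) =
      (\<integral>\<^sup>+ z. (case z of (a, t) \<Rightarrow> ennreal (\<pi>a a t * \<pi>t t))
        \<partial>(level_measure k K \<Otimes>\<^sub>M location_measure k))"
    unfolding prior_k_def
    by (subst emeasure_density) (auto intro!: nn_integral_cong simp: indicator_def)
  also have "\<dots> = (\<integral>\<^sup>+ t. \<integral>\<^sup>+ a. ennreal (\<pi>a a t * \<pi>t t) \<partial>level_measure k K \<partial>location_measure k)"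
    by (subst LT.nn_integral_snd[symmetric]) auto
  also have "\<dots> = (\<integral>\<^sup>+ t. ennreal (\<pi>t t) \<partial>location_measure k)"
  proof (intro nn_integral_cong)
    fix t assume "t \<in> space (location_measure k)"
    then have t: "t \<in> locations k" by (simp add: space_location_measure)
    have [measurable]: "(\<lambda>a. \<pi>a a t) \<in> borel_measurable (level_measure k K)"
      using measurable_compose[OF measurable_Pair2'[of t "location_measure k" "level_measure k K"]
          \<open>(\<lambda>(a, t). \<pi>a a t) \<in> _\<close>] t
      by (simp add: space_location_measure)
    have "(\<integral>\<^sup>+ a. ennreal (\<pi>a a t * \<pi>t t) \<partial>level_measure k K) =
        (\<integral>\<^sup>+ a. ennreal (\<pi>a a t) * ennreal (\<pi>t t) \<partial>level_measure k K)"
      using assms t by (intro nn_integral_cong)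
        (auto simp: prior_densities_def space_level_measure ennreal_mult)
    also have "\<dots> = ennreal (\<pi>t t)"
      using assms t by (subst nn_integral_multc) (auto simp: prior_densities_def)
    finally show "(\<integral>\<^sup>+ a. ennreal (\<pi>a a t * \<pi>t t) \<partial>level_measure k K) = ennreal (\<pi>t t)" .
  qed
  also have "\<dots> = 1" using assms by (simp add: prior_densities_def)
  finally show "emeasure (prior_k k K \<pi>a \<pi>t) (space (prior_k k K \<pi>a \<pi>t)) = 1" .
qed

lemma sections_Theta: "k \<in> {1..kmax} \<Longrightarrow>
  Pair k -` Theta kmax K = space (level_measure k K \<Otimes>\<^sub>M location_measure k)"
  by (auto simp: Theta_def space_pair_measure space_level_measure space_location_measure)

lemma sigma_algebra_Theta_sets: "sigma_algebra (Theta kmax K) (Theta_sets kmax K)"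
proof (unfold sigma_algebra_iff2, intro conjI ballI allI impI)
  show "Theta_sets kmax K \<subseteq> Pow (Theta kmax K)" "{} \<in> Theta_sets kmax K"
    by (auto simp: Theta_sets_def)
next
  fix A assume "A \<in> Theta_sets kmax K"
  then show "Theta kmax K - A \<in> Theta_sets kmax K"
    by (auto simp: Theta_sets_def vimage_Diff sections_Theta)
next
  fix A :: "nat \<Rightarrow> param set" assume "range A \<subseteq> Theta_sets kmax K"
  then show "(\<Union>i. A i) \<in> Theta_sets kmax K"
    by (fastforce simp: Theta_sets_def vimage_UN)
qed

lemma space_prior: "space (prior kmax K p \<pi>a \<pi>t) = Theta kmax K"
  unfolding prior_def by (rule space_measure_of) (auto simp: Theta_sets_def)

lemma sets_prior: "sets (prior kmax K p \<pi>a \<pi>t) = Theta_sets kmax K"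
  unfolding prior_def by (rule sigma_algebra.sets_measure_of_eq[OF sigma_algebra_Theta_sets])

lemma emeasure_prior:
  assumes "A \<in> Theta_sets kmax K"
  shows "emeasure (prior kmax K p \<pi>a \<pi>t) A =
    (\<Sum>k=1..kmax. ennreal (p k) * emeasure (prior_k k K (\<pi>a k) (\<pi>t k)) (Pair k -` A))"
  unfolding prior_def
proof (rule emeasure_measure_of_sigma[OF sigma_algebra_Theta_sets _ _ assms])
  show "positive (Theta_sets kmax K)
    (\<lambda>A. \<Sum>k=1..kmax. ennreal (p k) * emeasure (prior_k k K (\<pi>a k) (\<pi>t k)) (Pair k -` A))"
    by (auto simp: positive_def)
  show "countably_additive (Theta_sets kmax K)
    (\<lambda>A. \<Sum>k=1..kmax. ennreal (p k) * emeasure (prior_k k K (\<pi>a k) (\<pi>t k)) (Pair k -` A))"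
  proof (rule countably_additiveI)
    fix A :: "nat \<Rightarrow> param set"
    assume A: "range A \<subseteq> Theta_sets kmax K" "disjoint_family A"
    have "(\<Sum>i. emeasure (prior_k k K (\<pi>a k) (\<pi>t k)) (Pair k -` A i)) =
        emeasure (prior_k k K (\<pi>a k) (\<pi>t k)) (Pair k -` (\<Union>i. A i))" if "k \<in> {1..kmax}" for k
      unfolding vimage_UN
      using A that by (intro suminf_emeasure)
        (auto simp: prior_k_def Theta_sets_def disjoint_family_on_def, blast)
    then show "(\<Sum>i. \<Sum>k=1..kmax. ennreal (p k) *
          emeasure (prior_k k K (\<pi>a k) (\<pi>t k)) (Pair k -` A i)) =
        (\<Sum>k=1..kmax. ennreal (p k) * emeasure (prior_k k K (\<pi>a k) (\<pi>t k)) (Pair k -` (\<Union>i. A i)))"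
      by (subst suminf_sum) (auto intro!: sum.cong)
  qed
qed

lemma prob_space_prior:
  assumes "\<And>k. k \<in> {1..kmax} \<Longrightarrow> prior_densities k K (\<pi>a k) (\<pi>t k)"
    and "\<And>k. k \<in> {1..kmax} \<Longrightarrow> 0 \<le> p k" and "(\<Sum>k=1..kmax. p k) = 1"
  shows "prob_space (prior kmax K p \<pi>a \<pi>t)"
proof
  have "emeasure (prior_k k K (\<pi>a k) (\<pi>t k)) (Pair k -` Theta kmax K) = 1" if "k \<in> {1..kmax}" for k
    using prob_space.emeasure_space_1[OF prob_space_prior_k[OF assms(1)[OF that]]]
    by (simp add: sections_Theta[OF that] prior_k_def)
  then have "(\<Sum>k=1..kmax. ennreal (p k) *
      emeasure (prior_k k K (\<pi>a k) (\<pi>t k)) (Pair k -` Theta kmax K)) = ennreal (\<Sum>k=1..kmax. p k)"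
    using assms(2) by (subst sum_ennreal[symmetric]) (auto intro!: sum.cong)
  then show "emeasure (prior kmax K p \<pi>a \<pi>t) (space (prior kmax K p \<pi>a \<pi>t)) = 1"
    using sets.top[of "prior kmax K p \<pi>a \<pi>t"] assms(3)
    by (simp add: space_prior sets_prior emeasure_prior)
qed

end

theory Submission
  imports Defs "HOL-Real_Asymp.Real_Asymp"
begin

text \<open>
  Write \<open>L\<close> for the likelihood ratio of \<open>\<theta>\<close> against the truth and \<open>d\<close> for the distance of step functions
  in \<open>L\<^sup>2[0,1]\<close>. Under the truth, \<open>L\<close>, \<open>L\<^bsup>1/2\<^esup>\<close> and \<open>1/L\<close> have expectations \<open>1\<close>, at most \<open>exp (- c n d\<^sup>2)\<close>
  and at most \<open>exp (C n d\<^sup>2)\<close>.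

  The last bound gives a lower bound for the integrated likelihood over the parameters with \<open>k0\<close> segments whose
  levels are within \<open>n\<^bsup>-1/2\<^esup>\<close> and whose change-points are within \<open>1/n\<close> of the true ones: it is, with
  high probability, at least a small constant times their prior mass, which has order \<open>n\<^bsup>-(3 k0 - 2)/2\<^esup>\<close>.

  For \<open>k \<noteq> k0\<close> the parameters with \<open>d\<^sup>2 \<le> \<epsilon>\<^sup>2 = G ln n / n\<close> contribute on average at most their prior mass. This
  mass is at most of order \<open>\<epsilon>\<^bsup>3 k0 - 2\<^esup> \<epsilon>\<^bsup>1/2\<^esup>\<close>: all true levels and change-points have to be matched,
  and one superfluous segment is either short or has a level close to a true one. On the remaining parameters write
  \<open>L = L\<^bsup>1/2\<^esup> L\<^bsup>1/2\<^esup>\<close>. One factor is small on average, and the other is at most polynomial in \<open>n\<close>, uniformly in the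
  parameter, because the noise sums over all intervals of design points are simultaneously of Gaussian size.
\<close>

section \<open>The sample as random design plus Gaussian noise\<close>

text \<open>Put m = 3 k0 - 2. What decides is \<open>\<epsilon>^m * sqrt \<epsilon>\<close> against
  r^m for r = n^(-1/2): the quotient is a power of ln n times n^(-1/4). The exponent m counts each
  level once and each inner change-point twice, because moving a level by r or a change-point by r^2
  changes d^2 by order r^2. The obstacle is overfitting: for k > k0 there are parameters with d = 0,
  which no bound on likelihoods can exclude, so only the surplus factor in the prior mass can. For k
  < k0 no parameter is that close once \<epsilon> is small. The logarithm in \<epsilon> pays for the
  uniform bound: G is so large that exp (- c n \<epsilon>^2) beats this bound and n^(m/2) together.
  The uniform bound is polynomial because the segments of a parameter and of the truth cut the
  sample into at most kmax * k0 blocks, each of which adds at most order ln n to the log likelihood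
  ratio.\<close>

abbreviation unif :: "real measure" where "unif \<equiv> uniform_measure lborel {0..<1}"
abbreviation gauss :: "real measure" where "gauss \<equiv> density lborel std_normal_density"

lemma prob_space_unif: "prob_space unif"
  by (rule prob_space_uniform_measure) auto

lemma prob_space_gauss: "prob_space gauss"
  by (rule prob_space_normal_density) simp

text \<open>Completing the square turns the integrand into a multiple of the normal density with
  mean w.\<close>

lemma gaussian_mgf:
  "(\<integral>\<^sup>+ e. ennreal (exp (w * e)) \<partial>gauss) = ennreal (exp (w\<^sup>2 / 2))"
proof -
  have *: "std_normal_density e * exp (w * e) = exp (w\<^sup>2 / 2) * normal_density w 1 e" for e
    by (simp add: normal_density_def exp_add[symmetric] exp_minus[symmetric] field_simps power2_eq_square)
  have "(\<integral>\<^sup>+ e. ennreal (exp (w * e)) \<partial>gauss)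
      = (\<integral>\<^sup>+ e. ennreal (std_normal_density e * exp (w * e)) \<partial>lborel)"
    by (subst nn_integral_density) (auto simp: ennreal_mult)
  also have "\<dots> = (\<integral>\<^sup>+ e. ennreal (exp (w\<^sup>2 / 2)) * ennreal (normal_density w 1 e) \<partial>lborel)"
    unfolding * by (simp add: ennreal_mult)
  also have "\<dots> = ennreal (exp (w\<^sup>2 / 2)) * (\<integral>\<^sup>+ e. ennreal (normal_density w 1 e) \<partial>lborel)"
    by (subst nn_integral_cmult) auto
  also have "(\<integral>\<^sup>+ e. ennreal (normal_density w 1 e) \<partial>lborel) = 1"
    using prob_space.emeasure_space_1[OF prob_space_normal_density[of 1 w]]
    by (simp add: emeasure_density)
  finally show ?thesis by simp
qed

lemma gaussian_vector_mgf:
  assumes "finite I"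
  shows "(\<integral>\<^sup>+ e. ennreal (exp (\<Sum>i\<in>I. w i * e i)) \<partial>(\<Pi>\<^sub>M i\<in>I. gauss)) = ennreal (exp (\<Sum>i\<in>I. (w i)\<^sup>2 / 2))"
proof -
  interpret prob_space gauss by (rule prob_space_gauss)
  interpret product_sigma_finite "\<lambda>_. gauss" ..
  have "(\<integral>\<^sup>+ e. ennreal (exp (\<Sum>i\<in>I. w i * e i)) \<partial>(\<Pi>\<^sub>M i\<in>I. gauss))
     = (\<integral>\<^sup>+ e. (\<Prod>i\<in>I. ennreal (exp (w i * e i))) \<partial>(\<Pi>\<^sub>M i\<in>I. gauss))"
    by (simp add: exp_sum assms prod_ennreal)
  also have "\<dots> = (\<Prod>i\<in>I. \<integral>\<^sup>+ e. ennreal (exp (w i * e)) \<partial>gauss)"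
    by (rule product_nn_integral_prod) (auto simp: assms)
  also have "\<dots> = ennreal (exp (\<Sum>i\<in>I. (w i)\<^sup>2 / 2))"
    by (simp add: gaussian_mgf exp_sum assms prod_ennreal)
  finally show ?thesis .
qed

text \<open>Design and noise live on two separate product spaces, rather than on a product of pairs,
  so that the noise can be integrated out with the whole design held fixed.\<close>

definition observe :: "(real \<Rightarrow> real) \<Rightarrow> 'i set \<Rightarrow> ('i \<Rightarrow> real) \<times> ('i \<Rightarrow> real) \<Rightarrow> 'i \<Rightarrow> real \<times> real" where
  "observe f I = (\<lambda>(x, e). \<lambda>i\<in>I. (x i, f (x i) + e i))"

lemma measurable_observe [measurable]:
  assumes [measurable]: "f \<in> borel_measurable borel"
  shows "observe f I \<in> (\<Pi>\<^sub>M i\<in>I. unif) \<Otimes>\<^sub>M (\<Pi>\<^sub>M i\<in>I. gauss) \<rightarrow>\<^sub>M (\<Pi>\<^sub>M i\<in>I. borel \<Otimes>\<^sub>M borel)"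
proof -
  have [simp]: "measurable M unif = borel_measurable M" "measurable M gauss = borel_measurable M" for M :: "'c measure"
    by (rule measurable_cong_sets; simp)+
  have [measurable]: "(\<lambda>p. fst p i) \<in> borel_measurable ((\<Pi>\<^sub>M i\<in>I. unif) \<Otimes>\<^sub>M (\<Pi>\<^sub>M i\<in>I. gauss))"
    "(\<lambda>p. snd p i) \<in> borel_measurable ((\<Pi>\<^sub>M i\<in>I. unif) \<Otimes>\<^sub>M (\<Pi>\<^sub>M i\<in>I. gauss))" if "i \<in> I" for i
    using measurable_compose[OF measurable_fst measurable_component_singleton[OF that, of "\<lambda>_. unif"], of "(\<Pi>\<^sub>M i\<in>I. gauss)"]
      measurable_compose[OF measurable_snd measurable_component_singleton[OF that, of "\<lambda>_. gauss"], of "(\<Pi>\<^sub>M i\<in>I. unif)"]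
    by simp_all
  show ?thesis
    unfolding observe_def case_prod_beta
    by (rule measurable_restrict) measurable
qed

lemma sets_obs_law [measurable_cong, simp]: "sets (obs_law \<theta>) = sets (borel \<Otimes>\<^sub>M borel)"
  by (simp add: obs_law_def)

lemma sets_sample_law [measurable_cong, simp]:
  "sets (sample_law \<theta> n) = sets (\<Pi>\<^sub>M i\<in>{1..n}. borel \<Otimes>\<^sub>M borel)"
  unfolding sample_law_def by (rule sets_PiM_cong) auto

lemma space_sample_law:
  "space (sample_law \<theta> n) = space (\<Pi>\<^sub>M i\<in>{1..n}. borel \<Otimes>\<^sub>M borel :: (real \<times> real) measure)"
  by (rule sets_eq_imp_space_eq) simp

lemma prob_space_sample_law: "prob_space (sample_law \<theta> n)"
  unfolding sample_law_def by (rule prob_space_PiM) (rule prob_space_obs_law)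

lemma emeasure_obs_law:
  assumes [measurable]: "A \<in> sets (borel \<Otimes>\<^sub>M borel)"
  shows "emeasure (obs_law \<theta>) A = (\<integral>\<^sup>+ x. \<integral>\<^sup>+ e. indicator A (x, step_fun \<theta> x + e) \<partial>gauss \<partial>unif)"
proof -
  interpret N: prob_space gauss by (rule prob_space_gauss)
  have "emeasure (obs_law \<theta>) A =
      (\<integral>\<^sup>+ w. indicator A (fst w, step_fun \<theta> (fst w) + snd w) \<partial>(unif \<Otimes>\<^sub>M gauss))"
    unfolding obs_law_def
    by (subst nn_integral_indicator[symmetric], simp)
       (subst nn_integral_distr, auto simp: case_prod_beta)
  also have "\<dots> = (\<integral>\<^sup>+ x. \<integral>\<^sup>+ e. indicator A (x, step_fun \<theta> x + e) \<partial>gauss \<partial>unif)"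
    by (subst N.nn_integral_fst[symmetric]) auto
  finally show ?thesis .
qed

text \<open>A product measure is determined by its boxes, and the indicator of a box is a product
  over i. So the noise integral factorises for a fixed design, and afterwards the design integral
  does.\<close>

lemma sample_law_eq_distr:
  "sample_law \<theta> n = distr ((\<Pi>\<^sub>M i\<in>{1..n}. unif) \<Otimes>\<^sub>M (\<Pi>\<^sub>M i\<in>{1..n}. gauss))
     (\<Pi>\<^sub>M i\<in>{1..n}. borel \<Otimes>\<^sub>M borel) (observe (step_fun \<theta>) {1..n})"
proof -
  interpret U: prob_space unif by (rule prob_space_unif)
  interpret N: prob_space gauss by (rule prob_space_gauss)
  interpret PU: product_sigma_finite "\<lambda>_::nat. unif" ..
  interpret PN: product_sigma_finite "\<lambda>_::nat. gauss" ..
  interpret FN: prob_space "\<Pi>\<^sub>M i\<in>{1..n}. gauss" by (rule prob_space_PiM) (rule prob_space_gauss)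
  interpret O: prob_space "obs_law \<theta>" by (rule prob_space_obs_law)
  interpret PO: product_sigma_finite "\<lambda>_::nat. obs_law \<theta>" ..
  show ?thesis unfolding sample_law_def
  proof (rule PO.PiM_eqI[symmetric])
    fix A assume "\<And>i. i \<in> {1..n} \<Longrightarrow> A i \<in> sets (obs_law \<theta>)"
    then have A [measurable]: "A i \<in> sets (borel \<Otimes>\<^sub>M borel)" if "i \<in> {1..n}" for i using that by simp
    let ?D = "distr ((\<Pi>\<^sub>M i\<in>{1..n}. unif) \<Otimes>\<^sub>M (\<Pi>\<^sub>M i\<in>{1..n}. gauss))
     (\<Pi>\<^sub>M i\<in>{1..n}. borel \<Otimes>\<^sub>M borel) (observe (step_fun \<theta>) {1..n})"
    have [measurable]: "Pi\<^sub>E {1..n} A \<in> sets (\<Pi>\<^sub>M i\<in>{1..n}. borel \<Otimes>\<^sub>M borel)"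
      by (rule sets_PiM_I_finite) auto
    have [measurable]: "(\<lambda>e. indicator (A i) (x, step_fun \<theta> x + e)::ennreal) \<in> borel_measurable gauss"
      if "i \<in> {1..n}" for i x
      using A[OF that] by measurable
    have [measurable]: "(\<lambda>x. \<integral>\<^sup>+ e. indicator (A i) (x, step_fun \<theta> x + e) \<partial>gauss) \<in> borel_measurable unif"
      if "i \<in> {1..n}" for i
      using A[OF that] by measurable
    have "emeasure ?D (Pi\<^sub>E {1..n} A) =
       (\<integral>\<^sup>+ w. indicator (Pi\<^sub>E {1..n} A) (observe (step_fun \<theta>) {1..n} w)
          \<partial>((\<Pi>\<^sub>M i\<in>{1..n}. unif) \<Otimes>\<^sub>M (\<Pi>\<^sub>M i\<in>{1..n}. gauss)))"
      by (subst nn_integral_indicator[symmetric], simp) (subst nn_integral_distr, auto)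
    also have "\<dots> = (\<integral>\<^sup>+ x. \<integral>\<^sup>+ e. indicator (Pi\<^sub>E {1..n} A) (observe (step_fun \<theta>) {1..n} (x, e))
          \<partial>(\<Pi>\<^sub>M i\<in>{1..n}. gauss) \<partial>(\<Pi>\<^sub>M i\<in>{1..n}. unif))"
      by (subst FN.nn_integral_fst[symmetric]) auto
    also have "\<dots> = (\<integral>\<^sup>+ x. \<integral>\<^sup>+ e. (\<Prod>i\<in>{1..n}. indicator (A i) (x i, step_fun \<theta> (x i) + e i))
          \<partial>(\<Pi>\<^sub>M i\<in>{1..n}. gauss) \<partial>(\<Pi>\<^sub>M i\<in>{1..n}. unif))"
    proof (intro nn_integral_cong)
      fix x e :: "nat \<Rightarrow> real"
      show "indicator (Pi\<^sub>E {1..n} A) (observe (step_fun \<theta>) {1..n} (x, e)) =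
        (\<Prod>i\<in>{1..n}. indicator (A i) (x i, step_fun \<theta> (x i) + e i) :: ennreal)"
        by (auto simp: observe_def indicator_def PiE_iff intro!: prod.neutral[symmetric] prod_zero[symmetric])
    qed
    also have "\<dots> = (\<integral>\<^sup>+ x. (\<Prod>i\<in>{1..n}. \<integral>\<^sup>+ e. indicator (A i) (x i, step_fun \<theta> (x i) + e) \<partial>gauss)
          \<partial>(\<Pi>\<^sub>M i\<in>{1..n}. unif))"
      by (intro nn_integral_cong PN.product_nn_integral_prod) auto
    also have "\<dots> = (\<Prod>i\<in>{1..n}. \<integral>\<^sup>+ x. \<integral>\<^sup>+ e. indicator (A i) (x, step_fun \<theta> x + e) \<partial>gauss \<partial>unif)"
      by (rule PU.product_nn_integral_prod) auto
    also have "\<dots> = (\<Prod>i\<in>{1..n}. emeasure (obs_law \<theta>) (A i))"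
      by (intro prod.cong refl emeasure_obs_law[symmetric]) auto
    finally show "emeasure ?D (Pi\<^sub>E {1..n} A) = (\<Prod>i\<in>{1..n}. emeasure (obs_law \<theta>) (A i))" .
  qed (auto intro!: sets_PiM_cong)
qed

lemma nn_integral_sample_law:
  assumes [measurable]: "g \<in> borel_measurable (\<Pi>\<^sub>M i\<in>{1..n}. borel \<Otimes>\<^sub>M borel)"
  shows "(\<integral>\<^sup>+ z. g z \<partial>sample_law \<theta> n) =
    (\<integral>\<^sup>+ x. \<integral>\<^sup>+ e. g (observe (step_fun \<theta>) {1..n} (x, e)) \<partial>(\<Pi>\<^sub>M i\<in>{1..n}. gauss) \<partial>(\<Pi>\<^sub>M i\<in>{1..n}. unif))"
proof -
  interpret FN: prob_space "\<Pi>\<^sub>M i\<in>{1..n}. gauss" by (rule prob_space_PiM) (rule prob_space_gauss)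
  show ?thesis
    unfolding sample_law_eq_distr
    by (subst nn_integral_distr, measurable) (subst FN.nn_integral_fst[symmetric], auto simp del: One_nat_def)
qed

definition noise :: "param \<Rightarrow> real \<times> real \<Rightarrow> real" where
  "noise \<theta> = (\<lambda>(x, y). y - step_fun \<theta> x)"

lemma measurable_noise [measurable]: "noise \<theta> \<in> borel_measurable (borel \<Otimes>\<^sub>M borel)"
  unfolding noise_def by measurable

lemma measurable_design [measurable]:
  "(\<lambda>z. \<lambda>i\<in>I. fst (z i)) \<in> (\<Pi>\<^sub>M i\<in>I. borel \<Otimes>\<^sub>M borel) \<rightarrow>\<^sub>M (\<Pi>\<^sub>M i\<in>I. unif)"
proof (rule measurable_restrict)
  fix i assume "i \<in> I"
  then have [measurable]: "(\<lambda>z. z i) \<in> (\<Pi>\<^sub>M i\<in>I. borel \<Otimes>\<^sub>M borel) \<rightarrow>\<^sub>M borel \<Otimes>\<^sub>M borel"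
    by (rule measurable_component_singleton)
  show "(\<lambda>z. fst (z i)) \<in> (\<Pi>\<^sub>M i\<in>I. borel \<Otimes>\<^sub>M borel) \<rightarrow>\<^sub>M unif"
    by measurable
qed

text \<open>The weights may depend on all design points, as conditionally on these the noise is standard Gaussian.\<close>

lemma nn_integral_exp_noise:
  assumes [measurable]: "\<And>i. i \<in> {1..n} \<Longrightarrow> w i \<in> borel_measurable (\<Pi>\<^sub>M i\<in>{1..n}. unif)"
    and [measurable]: "G \<in> borel_measurable (\<Pi>\<^sub>M i\<in>{1..n}. unif)"
  shows "(\<integral>\<^sup>+ z. ennreal (exp (G (\<lambda>i\<in>{1..n}. fst (z i)) + (\<Sum>i=1..n. w i (\<lambda>i\<in>{1..n}. fst (z i)) * noise \<theta> (z i)))) \<partial>sample_law \<theta> n)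
    = (\<integral>\<^sup>+ x. ennreal (exp (G x + (\<Sum>i=1..n. (w i x)\<^sup>2 / 2))) \<partial>(\<Pi>\<^sub>M i\<in>{1..n}. unif))"
proof -
  have [measurable]: "(\<lambda>z. w i (\<lambda>i\<in>{1..n}. fst (z i))) \<in> borel_measurable (\<Pi>\<^sub>M i\<in>{1..n}. borel \<Otimes>\<^sub>M borel)"
    if "i \<in> {1..n}" for i
    by (rule measurable_compose[OF measurable_design]) (use that in measurable)
  have [measurable]: "(\<lambda>z. G (\<lambda>i\<in>{1..n}. fst (z i))) \<in> borel_measurable (\<Pi>\<^sub>M i\<in>{1..n}. borel \<Otimes>\<^sub>M borel)"
    by (rule measurable_compose[OF measurable_design]) measurable
  have "(\<integral>\<^sup>+ z. ennreal (exp (G (\<lambda>i\<in>{1..n}. fst (z i)) + (\<Sum>i=1..n. w i (\<lambda>i\<in>{1..n}. fst (z i)) * noise \<theta> (z i)))) \<partial>sample_law \<theta> n)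
    = (\<integral>\<^sup>+ x. \<integral>\<^sup>+ e. ennreal (exp (G x)) * ennreal (exp (\<Sum>i=1..n. w i x * e i)) \<partial>(\<Pi>\<^sub>M i\<in>{1..n}. gauss) \<partial>(\<Pi>\<^sub>M i\<in>{1..n}. unif))"
  proof (subst nn_integral_sample_law)
    show "(\<lambda>z. ennreal (exp (G (\<lambda>i\<in>{1..n}. fst (z i)) + (\<Sum>i=1..n. w i (\<lambda>i\<in>{1..n}. fst (z i)) * noise \<theta> (z i)))))
       \<in> borel_measurable (\<Pi>\<^sub>M i\<in>{1..n}. borel \<Otimes>\<^sub>M borel)"
      by measurable
  next
    \<comment> \<open>Points of the product space are extensional, so restricting the recorded
      design points to \<open>{1..n}\<close> gives back x itself.\<close>
    have *: "(\<lambda>i\<in>{1..n}. fst (observe (step_fun \<theta>) {1..n} (x, e) i)) = x"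
      if "x \<in> space (\<Pi>\<^sub>M i\<in>{1..n}. unif)" for x e
      using that by (auto simp: observe_def space_PiM PiE_iff extensional_def fun_eq_iff)
    show "(\<integral>\<^sup>+ x. \<integral>\<^sup>+ e. ennreal (exp (G (\<lambda>i\<in>{1..n}. fst (observe (step_fun \<theta>) {1..n} (x, e) i)) +
        (\<Sum>i=1..n. w i (\<lambda>i\<in>{1..n}. fst (observe (step_fun \<theta>) {1..n} (x, e) i)) *
          noise \<theta> (observe (step_fun \<theta>) {1..n} (x, e) i)))) \<partial>(\<Pi>\<^sub>M i\<in>{1..n}. gauss) \<partial>(\<Pi>\<^sub>M i\<in>{1..n}. unif))
      = (\<integral>\<^sup>+ x. \<integral>\<^sup>+ e. ennreal (exp (G x)) * ennreal (exp (\<Sum>i=1..n. w i x * e i)) \<partial>(\<Pi>\<^sub>M i\<in>{1..n}. gauss) \<partial>(\<Pi>\<^sub>M i\<in>{1..n}. unif))"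
    proof (intro nn_integral_cong)
      fix x e assume "x \<in> space (\<Pi>\<^sub>M i\<in>{1..n}. unif)"
      from *[OF this, of e] show "ennreal (exp (G (\<lambda>i\<in>{1..n}. fst (observe (step_fun \<theta>) {1..n} (x, e) i)) +
        (\<Sum>i=1..n. w i (\<lambda>i\<in>{1..n}. fst (observe (step_fun \<theta>) {1..n} (x, e) i)) *
          noise \<theta> (observe (step_fun \<theta>) {1..n} (x, e) i)))) = ennreal (exp (G x)) * ennreal (exp (\<Sum>i=1..n. w i x * e i))"
        by (simp add: exp_add ennreal_mult del: One_nat_def) (simp add: observe_def noise_def)
    qed
  qed
  also have "\<dots> = (\<integral>\<^sup>+ x. ennreal (exp (G x + (\<Sum>i=1..n. (w i x)\<^sup>2 / 2))) \<partial>(\<Pi>\<^sub>M i\<in>{1..n}. unif))"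
    by (intro nn_integral_cong, subst nn_integral_cmult)
       (auto simp: gaussian_vector_mgf exp_add ennreal_mult)
  finally show ?thesis .
qed

section \<open>Knots and segments of a step function\<close>

lemma knot_0 [simp]: "knot k t 0 = 0"
  by (simp add: knot_def)

lemma knot_end [simp]: "1 \<le> k \<Longrightarrow> knot k t k = 1"
  by (simp add: knot_def)

lemma knot_strict_mono:
  assumes "t \<in> locations k" "i < j" "j \<le> k"
  shows "knot k t i < knot k t j"
  using assms(2,3)
proof (induction j)
  case (Suc j)
  have "knot k t j < knot k t (Suc j)"
    using assms(1) Suc.prems(2) by (auto simp: locations_def dest!: bspec[of _ _ "Suc j"])
  then show ?case using Suc by (cases "i = j") auto
qed simp

lemma knot_mono:
  assumes "t \<in> locations k" "i \<le> j" "j \<le> k"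
  shows "knot k t i \<le> knot k t j"
  using knot_strict_mono[OF assms(1), of i j] assms(2,3) by (cases "i = j") auto

lemma knot_unit_interval:
  assumes "t \<in> locations k" "1 \<le> k" "j \<le> k"
  shows "0 \<le> knot k t j" "knot k t j \<le> 1"
  using knot_mono[OF assms(1), of 0 j] knot_mono[OF assms(1), of j k] assms(2,3) by auto

text \<open>The segment is closed by the first knot beyond x; there is one because the last knot is
  1.\<close>

lemma segment_exists:
  assumes "1 \<le> k" "0 \<le> x" "x < 1"
  shows "\<exists>j\<in>{1..k}. knot k t (j - 1) \<le> x \<and> x < knot k t j"
proof -
  define j where "j = (LEAST j. x < knot k t j)"
  have k: "x < knot k t k" using assms by simp
  then have j: "x < knot k t j" "j \<le> k"
    unfolding j_def by (rule LeastI, rule Least_le)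
  have "j \<noteq> 0" using j assms by (metis knot_0 not_le)
  then have "\<not> x < knot k t (j - 1)"
    unfolding j_def by (metis not_less_Least One_nat_def diff_less zero_less_Suc not_gr0)
  then show ?thesis using j \<open>j \<noteq> 0\<close> by (intro bexI[of _ j]) auto
qed

lemma segment_unique:
  assumes "t \<in> locations k" "i \<in> {1..k}" "j \<in> {1..k}"
    and "knot k t (i - 1) \<le> x" "x < knot k t i" "knot k t (j - 1) \<le> x" "x < knot k t j"
  shows "i = j"
proof (rule ccontr)
  assume "i \<noteq> j"
  then consider "i \<le> j - 1" | "j \<le> i - 1" by linarith
  then show False
  proof cases
    case 1
    have "j - 1 \<le> k" using assms(3) by auto
    with 1 knot_mono[OF assms(1), of i "j - 1"] assms show False by auto
  next
    case 2
    have "i - 1 \<le> k" using assms(2) by auto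
    with 2 knot_mono[OF assms(1), of j "i - 1"] assms show False by auto
  qed
qed

lemma step_fun_segment:
  assumes "t \<in> locations k" "j \<in> {1..k}" "knot k t (j - 1) \<le> x" "x < knot k t j"
  shows "step_fun (k, a, t) x = a j"
proof -
  have "step_fun (k, a, t) x = (\<Sum>i=1..k. if i = j then a j else 0)"
    unfolding step_fun_def split
  proof (intro sum.cong refl)
    fix i assume i: "i \<in> {1..k}"
    have "x \<in> {knot k t (i - 1)..<knot k t i} \<longleftrightarrow> i = j"
      using segment_unique[OF assms(1) i assms(2) _ _ assms(3,4)] assms(3,4) by auto
    then show "a i * indicator {knot k t (i - 1)..<knot k t i} x = (if i = j then a j else 0)"
      by (simp add: indicator_def)
  qed
  then show ?thesis using assms(2) by simp
qed

lemma step_fun_outside: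
  assumes "t \<in> locations k" "1 \<le> k" "x < 0 \<or> 1 \<le> x"
  shows "step_fun (k, a, t) x = 0"
proof -
  have "\<not> (knot k t (j - 1) \<le> x \<and> x < knot k t j)" if "j \<in> {1..k}" for j
  proof -
    have "j - 1 \<le> k" "j \<le> k" using that by auto
    then show ?thesis
      using knot_unit_interval[OF assms(1,2), of "j - 1"] knot_unit_interval[OF assms(1,2), of j] assms(3)
      by linarith
  qed
  then have "indicator {knot k t (j - 1)..<knot k t j} x = (0::real)" if "j \<in> {1..k}" for j
    using that by (simp add: indicator_def)
  then show ?thesis unfolding step_fun_def split by (intro sum.neutral ballI) simp
qed

lemma abs_step_fun_le:
  assumes "(k, a, t) \<in> Theta kmax K" "0 \<le> K"
  shows "\<bar>step_fun (k, a, t) x\<bar> \<le> K"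
proof (cases "0 \<le> x \<and> x < 1")
  case True
  have *: "1 \<le> k" "t \<in> locations k" "a \<in> levels k K" using assms by (auto simp: Theta_def)
  obtain j where j: "j \<in> {1..k}" "knot k t (j - 1) \<le> x" "x < knot k t j"
    using segment_exists[of k x t] True * by auto
  have "a j \<in> {-K..K}" using * j by (auto simp: levels_def)
  then show ?thesis using step_fun_segment[OF *(2) j] by auto
next
  case False
  then show ?thesis using assms by (subst step_fun_outside) (auto simp: Theta_def)
qed

section \<open>The likelihood ratio and its moments under the truth\<close>

definition gap :: "param \<Rightarrow> param \<Rightarrow> real \<Rightarrow> real" where
  "gap \<theta>0 \<theta> x = step_fun \<theta> x - step_fun \<theta>0 x"

lemma measurable_gap [measurable]: "gap \<theta>0 \<theta> \<in> borel_measurable borel"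
  unfolding gap_def by measurable

lemma abs_gap_le:
  assumes "\<theta>0 \<in> Theta kmax K" "\<theta> \<in> Theta kmax K" "0 \<le> K"
  shows "\<bar>gap \<theta>0 \<theta> x\<bar> \<le> 2 * K"
proof -
  have "\<bar>step_fun \<theta> x\<bar> \<le> K" if "\<theta> \<in> Theta kmax K" for \<theta>
    using abs_step_fun_le[of "fst \<theta>" "fst (snd \<theta>)" "snd (snd \<theta>)"] that assms(3) by simp
  from this[OF assms(2)] this[OF assms(1)] have "\<bar>step_fun \<theta> x\<bar> \<le> K" "\<bar>step_fun \<theta>0 x\<bar> \<le> K" .
  then show ?thesis unfolding gap_def by linarith
qed

text \<open>Logarithm of the likelihood ratio: with noise e and gap v, the exponents differ by - (e
  - v)^2 / 2 + e^2 / 2 = v e - v^2 / 2. Given the design this is affine in the noise.\<close>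

definition log_ratio :: "param \<Rightarrow> nat \<Rightarrow> param \<Rightarrow> (nat \<Rightarrow> real \<times> real) \<Rightarrow> real" where
  "log_ratio \<theta>0 n \<theta> z =
     (\<Sum>i=1..n. gap \<theta>0 \<theta> (fst (z i)) * noise \<theta>0 (z i) - (gap \<theta>0 \<theta> (fst (z i)))\<^sup>2 / 2)"

lemma measurable_log_ratio [measurable]:
  "log_ratio \<theta>0 n \<theta> \<in> borel_measurable (\<Pi>\<^sub>M i\<in>{1..n}. borel \<Otimes>\<^sub>M borel)"
  unfolding log_ratio_def by measurable

text \<open>A product instead of a quotient, so that design points outside [0,1), where both
  densities vanish, are covered.\<close>

lemma obs_density_ratio:
  "obs_density \<theta> z = obs_density \<theta>0 z * exp (gap \<theta>0 \<theta> (fst z) * noise \<theta>0 z - (gap \<theta>0 \<theta> (fst z))\<^sup>2 / 2)"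
proof (cases z)
  case (Pair x y)
  have "- (y - step_fun \<theta> x)\<^sup>2 / 2 =
      - (y - step_fun \<theta>0 x)\<^sup>2 / 2 + (gap \<theta>0 \<theta> x * noise \<theta>0 (x, y) - (gap \<theta>0 \<theta> x)\<^sup>2 / 2)"
    by (simp add: gap_def noise_def power2_eq_square field_simps)
  then show ?thesis
    unfolding Pair by (simp add: obs_density_def std_normal_density_def exp_add[symmetric])
qed

lemma prod_obs_density_ratio:
  "(\<Prod>i=1..n. obs_density \<theta> (z i)) = (\<Prod>i=1..n. obs_density \<theta>0 (z i)) * exp (log_ratio \<theta>0 n \<theta> z)"
  unfolding log_ratio_def exp_sum[OF finite_atLeastAtMost] prod.distrib[symmetric]
  by (intro prod.cong refl obs_density_ratio)

text \<open>Given the design, integrating exp (s v e) over the noise gives exp (s^2 v^2 / 2), which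
  meets the factor exp (- s v^2 / 2). What remains is a product of functions of one design point
  each. The values s = 1, 1/2 and -1 are used.\<close>

lemma nn_integral_likelihood_power:
  "(\<integral>\<^sup>+ z. ennreal (exp (s * log_ratio \<theta>0 n \<theta> z)) \<partial>sample_law \<theta>0 n) =
   (\<integral>\<^sup>+ x. ennreal (exp ((s\<^sup>2 - s) / 2 * (gap \<theta>0 \<theta> x)\<^sup>2)) \<partial>unif) ^ n"
proof -
  interpret U: prob_space unif by (rule prob_space_unif)
  interpret PU: product_sigma_finite "\<lambda>_::nat. unif" ..
  let ?v = "gap \<theta>0 \<theta>"
  have [measurable]: "(\<lambda>x. ?v (x i)) \<in> borel_measurable (\<Pi>\<^sub>M i\<in>{1..n}. unif)" if "i \<in> {1..n}" for i
    by (rule measurable_compose[OF measurable_component_singleton[OF that]]) measurable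
  have "s * log_ratio \<theta>0 n \<theta> z = (\<lambda>x. \<Sum>i=1..n. - s * (?v (x i))\<^sup>2 / 2) (\<lambda>i\<in>{1..n}. fst (z i)) +
      (\<Sum>i=1..n. (\<lambda>x. s * ?v (x i)) (\<lambda>i\<in>{1..n}. fst (z i)) * noise \<theta>0 (z i))" for z
    unfolding log_ratio_def sum_distrib_left sum.distrib[symmetric]
    by (intro sum.cong refl) (simp add: algebra_simps)
  then have "(\<integral>\<^sup>+ z. ennreal (exp (s * log_ratio \<theta>0 n \<theta> z)) \<partial>sample_law \<theta>0 n) =
     (\<integral>\<^sup>+ x. ennreal (exp ((\<Sum>i=1..n. - s * (?v (x i))\<^sup>2 / 2) + (\<Sum>i=1..n. (s * ?v (x i))\<^sup>2 / 2))) \<partial>(\<Pi>\<^sub>M i\<in>{1..n}. unif))"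
    using nn_integral_exp_noise[of n "\<lambda>i x. s * ?v (x i)" "\<lambda>x. \<Sum>i=1..n. - s * (?v (x i))\<^sup>2 / 2" \<theta>0]
    by simp
  also have "\<dots> = (\<integral>\<^sup>+ x. (\<Prod>i=1..n. ennreal (exp ((s\<^sup>2 - s) / 2 * (?v (x i))\<^sup>2))) \<partial>(\<Pi>\<^sub>M i\<in>{1..n}. unif))"
  proof (intro nn_integral_cong)
    fix x :: "nat \<Rightarrow> real"
    have "(\<Sum>i=1..n. - s * (?v (x i))\<^sup>2 / 2) + (\<Sum>i=1..n. (s * ?v (x i))\<^sup>2 / 2) = (\<Sum>i=1..n. (s\<^sup>2 - s) / 2 * (?v (x i))\<^sup>2)"
      unfolding sum.distrib[symmetric] by (intro sum.cong refl) (simp add: power_mult_distrib field_simps)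
    then show "ennreal (exp ((\<Sum>i=1..n. - s * (?v (x i))\<^sup>2 / 2) + (\<Sum>i=1..n. (s * ?v (x i))\<^sup>2 / 2)))
       = (\<Prod>i=1..n. ennreal (exp ((s\<^sup>2 - s) / 2 * (?v (x i))\<^sup>2)))"
      by (simp add: exp_sum prod_ennreal)
  qed
  also have "\<dots> = (\<Prod>i=1..n. (\<integral>\<^sup>+ x. ennreal (exp ((s\<^sup>2 - s) / 2 * (?v x)\<^sup>2)) \<partial>unif))"
    by (rule PU.product_nn_integral_prod) auto
  finally show ?thesis by simp
qed

definition sqdist :: "param \<Rightarrow> param \<Rightarrow> real" where
  "sqdist \<theta>0 \<theta> = (LINT x|unif. (gap \<theta>0 \<theta> x)\<^sup>2)"

lemma integrable_gap_square:
  assumes "\<And>x. \<bar>gap \<theta>0 \<theta> x\<bar> \<le> B"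
  shows "integrable unif (\<lambda>x. (gap \<theta>0 \<theta> x)\<^sup>2)"
proof -
  interpret U: prob_space unif by (rule prob_space_unif)
  show ?thesis
    by (rule U.integrable_const_bound[of _ "B\<^sup>2"])
       (use power_mono[OF assms abs_ge_zero, of _ 2] in auto)
qed

text \<open>Through this, a pointwise bound of an exponential by an affine function of v^2 becomes a
  bound in \<open>sqdist\<close>. The sign condition keeps \<open>ennreal\<close> from
  truncating.\<close>

lemma nn_integral_affine_gap_square:
  assumes "\<And>x. \<bar>gap \<theta>0 \<theta> x\<bar> \<le> B" "\<And>x. 0 \<le> 1 + c * (gap \<theta>0 \<theta> x)\<^sup>2"
  shows "(\<integral>\<^sup>+ x. ennreal (1 + c * (gap \<theta>0 \<theta> x)\<^sup>2) \<partial>unif) = ennreal (1 + c * sqdist \<theta>0 \<theta>)"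
proof -
  interpret U: prob_space unif by (rule prob_space_unif)
  have "integrable unif (\<lambda>x. 1 + c * (gap \<theta>0 \<theta> x)\<^sup>2)"
    using integrable_gap_square[OF assms(1)] by auto
  then show ?thesis
    using integrable_gap_square[OF assms(1)] assms(2)
    by (subst nn_integral_eq_integral) (auto simp: sqdist_def U.prob_space[simplified])
qed

lemma nn_integral_likelihood:
  "(\<integral>\<^sup>+ z. ennreal (exp (log_ratio \<theta>0 n \<theta> z)) \<partial>sample_law \<theta>0 n) = 1"
proof -
  interpret U: prob_space unif by (rule prob_space_unif)
  show ?thesis using nn_integral_likelihood_power[where s=1, of \<theta>0 n \<theta>] by (simp add: U.emeasure_space_1[simplified])
qed

text \<open>For s = 1/2 the remaining factor is exp (- v^2 / 8), at most 1 / (1 + v^2 / 8) = 1 - v^2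
  / (8 + v^2) and so at most 1 - v^2 / (8 + B^2), which is affine in v^2. After integration, 1 + x
  <= exp x leads back to an exponential.\<close>

lemma nn_integral_sqrt_likelihood_le:
  assumes "\<And>x. \<bar>gap \<theta>0 \<theta> x\<bar> \<le> B"
  shows "(\<integral>\<^sup>+ z. ennreal (exp (log_ratio \<theta>0 n \<theta> z / 2)) \<partial>sample_law \<theta>0 n)
     \<le> ennreal (exp (- real n * sqdist \<theta>0 \<theta> / (8 + B\<^sup>2)))"
proof -
  let ?v = "gap \<theta>0 \<theta>"
  define c where "c = - 1 / (8 + B\<^sup>2)"
  have sq: "(?v x)\<^sup>2 \<le> B\<^sup>2" for x using power_mono[OF assms abs_ge_zero, of x 2] by simp
  have pos: "8 + B\<^sup>2 > 0" by (simp add: add_pos_nonneg)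
  have le: "exp (- ((?v x)\<^sup>2 / 8)) \<le> 1 + c * (?v x)\<^sup>2" for x
  proof -
    have "exp (- ((?v x)\<^sup>2 / 8)) \<le> 1 / (1 + (?v x)\<^sup>2 / 8)"
      unfolding exp_minus inverse_eq_divide
      by (intro divide_left_mono exp_ge_add_one_self mult_pos_pos) (auto simp: add_pos_nonneg)
    also have "\<dots> = 1 - (?v x)\<^sup>2 / (8 + (?v x)\<^sup>2)"
      using add_pos_nonneg[of 8 "(?v x)\<^sup>2"] by (simp add: divide_simps)
    also have "\<dots> \<le> 1 - (?v x)\<^sup>2 / (8 + B\<^sup>2)"
      using sq[of x] by (intro diff_left_mono divide_left_mono mult_pos_pos) (auto simp: add_pos_nonneg)
    finally show ?thesis by (simp add: c_def)
  qed
  have nn: "0 \<le> 1 + c * (?v x)\<^sup>2" for x using le[of x] exp_ge_zero order_trans by blast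
  have "(\<integral>\<^sup>+ x. ennreal (exp (((1/2)\<^sup>2 - 1/2) / 2 * (?v x)\<^sup>2)) \<partial>unif) \<le> (\<integral>\<^sup>+ x. ennreal (1 + c * (?v x)\<^sup>2) \<partial>unif)"
    using le by (intro nn_integral_mono ennreal_leI) (simp add: power2_eq_square)
  also have "\<dots> = ennreal (1 + c * sqdist \<theta>0 \<theta>)" by (rule nn_integral_affine_gap_square[OF assms nn])
  also have "\<dots> \<le> ennreal (exp (c * sqdist \<theta>0 \<theta>))" by (intro ennreal_leI exp_ge_add_one_self)
  finally have "(\<integral>\<^sup>+ x. ennreal (exp (((1/2)\<^sup>2 - 1/2) / 2 * (?v x)\<^sup>2)) \<partial>unif) ^ n \<le> ennreal (exp (c * sqdist \<theta>0 \<theta>)) ^ n"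
    by (rule power_mono) simp
  also have "\<dots> = ennreal (exp (- real n * sqdist \<theta>0 \<theta> / (8 + B\<^sup>2)))"
    by (simp add: ennreal_power exp_of_nat_mult[symmetric] c_def)
  finally show ?thesis using nn_integral_likelihood_power[where s="1/2", of \<theta>0 n \<theta>] by simp
qed

text \<open>For s = -1 the remaining factor is exp (v^2). From 1 - w <= exp (- w) follows exp w <= 1
  + w exp w, which for w = v^2 <= B^2 is at most 1 + exp (B^2) v^2.\<close>

lemma nn_integral_inverse_likelihood_le:
  assumes "\<And>x. \<bar>gap \<theta>0 \<theta> x\<bar> \<le> B"
  shows "(\<integral>\<^sup>+ z. ennreal (exp (- log_ratio \<theta>0 n \<theta> z)) \<partial>sample_law \<theta>0 n)
     \<le> ennreal (exp (n * (exp (B\<^sup>2) * sqdist \<theta>0 \<theta>)))"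
proof -
  let ?v = "gap \<theta>0 \<theta>"
  define c where "c = exp (B\<^sup>2)"
  have sq: "(?v x)\<^sup>2 \<le> B\<^sup>2" for x using power_mono[OF assms abs_ge_zero, of x 2] by simp
  have le: "exp ((?v x)\<^sup>2) \<le> 1 + c * (?v x)\<^sup>2" for x
  proof -
    have "1 - (?v x)\<^sup>2 \<le> exp (- (?v x)\<^sup>2)" using exp_ge_add_one_self[of "- (?v x)\<^sup>2"] by simp
    then have "exp ((?v x)\<^sup>2) * (1 - (?v x)\<^sup>2) \<le> exp ((?v x)\<^sup>2) * exp (- (?v x)\<^sup>2)"
      by (rule mult_left_mono) simp
    then have "exp ((?v x)\<^sup>2) \<le> 1 + exp ((?v x)\<^sup>2) * (?v x)\<^sup>2"
      by (simp add: exp_add[symmetric] algebra_simps)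
    also have "exp ((?v x)\<^sup>2) * (?v x)\<^sup>2 \<le> c * (?v x)\<^sup>2" unfolding c_def
      using sq[of x] by (intro mult_right_mono) auto
    finally show ?thesis by simp
  qed
  have nn: "0 \<le> 1 + c * (?v x)\<^sup>2" for x using le[of x] exp_ge_zero order_trans by blast
  have "(\<integral>\<^sup>+ x. ennreal (exp (((-1)\<^sup>2 - (-1)) / 2 * (?v x)\<^sup>2)) \<partial>unif) \<le> (\<integral>\<^sup>+ x. ennreal (1 + c * (?v x)\<^sup>2) \<partial>unif)"
    using le by (intro nn_integral_mono ennreal_leI) simp
  also have "\<dots> = ennreal (1 + c * sqdist \<theta>0 \<theta>)" by (rule nn_integral_affine_gap_square[OF assms nn])
  also have "\<dots> \<le> ennreal (exp (c * sqdist \<theta>0 \<theta>))" by (intro ennreal_leI exp_ge_add_one_self)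
  finally have "(\<integral>\<^sup>+ x. ennreal (exp (((-1)\<^sup>2 - (-1)) / 2 * (?v x)\<^sup>2)) \<partial>unif) ^ n \<le> ennreal (exp (c * sqdist \<theta>0 \<theta>)) ^ n"
    by (rule power_mono) simp
  also have "\<dots> = ennreal (exp (n * (exp (B\<^sup>2) * sqdist \<theta>0 \<theta>)))"
    by (simp add: ennreal_power exp_of_nat_mult[symmetric] c_def)
  finally show ?thesis using nn_integral_likelihood_power[where s="-1", of \<theta>0 n \<theta>] by simp
qed

section \<open>A uniform bound on the likelihood\<close>

text \<open>The intervals end at observations, so there are only n^2 of them and a union bound is
  affordable. They depend on the design alone.\<close>

definition run :: "nat \<Rightarrow> (nat \<Rightarrow> real) \<Rightarrow> nat \<Rightarrow> nat \<Rightarrow> nat set" where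
  "run n x r s = {i \<in> {1..n}. x r \<le> x i \<and> x i \<le> x s}"

text \<open>The scaling by the cardinality makes the bound on a block in
  \<open>block_quadratic_le\<close> independent of the size of the block.\<close>

definition regular :: "param \<Rightarrow> nat \<Rightarrow> real \<Rightarrow> (nat \<Rightarrow> real \<times> real) \<Rightarrow> bool" where
  "regular \<theta>0 n u z \<longleftrightarrow> (\<forall>r\<in>{1..n}. \<forall>s\<in>{1..n}.
     (\<Sum>i\<in>run n (fst \<circ> z) r s. noise \<theta>0 (z i))\<^sup>2 \<le> u * card (run n (fst \<circ> z) r s))"

lemma finite_run [simp]: "finite (run n x r s)"
  by (simp add: run_def)

lemma sum_run: "(\<Sum>i\<in>run n x r s. f i) = (\<Sum>i=1..n. if x r \<le> x i \<and> x i \<le> x s then f i else (0::real))"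
  unfolding run_def by (rule sum.inter_filter) simp

text \<open>The index set varies with the sample point; as a sum over the fixed set
  \<open>{1..n}\<close> with a case distinction, every summand is measurable.\<close>

lemma measurable_run_sum:
  fixes x f :: "'a \<Rightarrow> nat \<Rightarrow> real"
  assumes x: "\<And>i. i \<in> {1..n} \<Longrightarrow> (\<lambda>\<omega>. x \<omega> i) \<in> borel_measurable M"
    and f: "\<And>i. i \<in> {1..n} \<Longrightarrow> (\<lambda>\<omega>. f \<omega> i) \<in> borel_measurable M"
    and "r \<in> {1..n}" "s \<in> {1..n}"
  shows "(\<lambda>\<omega>. \<Sum>i\<in>run n (x \<omega>) r s. f \<omega> i) \<in> borel_measurable M"
  unfolding sum_run
proof (rule borel_measurable_sum)
  fix i assume i: "i \<in> {1..n}"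
  have [measurable]: "(\<lambda>\<omega>. x \<omega> i) \<in> borel_measurable M" "(\<lambda>\<omega>. x \<omega> r) \<in> borel_measurable M"
    "(\<lambda>\<omega>. x \<omega> s) \<in> borel_measurable M" "(\<lambda>\<omega>. f \<omega> i) \<in> borel_measurable M"
    using x f i assms(3,4) by auto
  show "(\<lambda>\<omega>. if x \<omega> r \<le> x \<omega> i \<and> x \<omega> i \<le> x \<omega> s then f \<omega> i else 0) \<in> borel_measurable M"
    by measurable
qed

lemma measurable_run_card:
  assumes "\<And>i. i \<in> {1..n} \<Longrightarrow> (\<lambda>\<omega>. x \<omega> i) \<in> borel_measurable M" "r \<in> {1..n}" "s \<in> {1..n}"
  shows "(\<lambda>\<omega>. real (card (run n (x \<omega>) r s))) \<in> borel_measurable M"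
  using measurable_run_sum[OF assms(1) _ assms(2,3), where f="\<lambda>_ _. 1"] by simp

lemma measurable_sample_run:
  assumes "r \<in> {1..n}" "s \<in> {1..n}"
  shows "(\<lambda>z. \<Sum>i\<in>run n (fst \<circ> z) r s. noise \<theta>0 (z i)) \<in> borel_measurable (\<Pi>\<^sub>M i\<in>{1..n}. borel \<Otimes>\<^sub>M borel)"
    and "(\<lambda>z. real (card (run n (fst \<circ> z) r s))) \<in> borel_measurable (\<Pi>\<^sub>M i\<in>{1..n}. borel \<Otimes>\<^sub>M borel)"
proof -
  have x: "(\<lambda>z. (fst \<circ> z) i) \<in> borel_measurable (\<Pi>\<^sub>M i\<in>{1..n}. borel \<Otimes>\<^sub>M borel)" if "i \<in> {1..n}" for i
    unfolding o_def by (rule measurable_compose[OF measurable_component_singleton[OF that]]) measurable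
  have f: "(\<lambda>z. noise \<theta>0 (z i)) \<in> borel_measurable (\<Pi>\<^sub>M i\<in>{1..n}. borel \<Otimes>\<^sub>M borel)" if "i \<in> {1..n}" for i
    by (rule measurable_compose[OF measurable_component_singleton[OF that]]) measurable
  show "(\<lambda>z. \<Sum>i\<in>run n (fst \<circ> z) r s. noise \<theta>0 (z i)) \<in> borel_measurable (\<Pi>\<^sub>M i\<in>{1..n}. borel \<Otimes>\<^sub>M borel)"
    by (rule measurable_run_sum[OF x f assms])
  show "(\<lambda>z. real (card (run n (fst \<circ> z) r s))) \<in> borel_measurable (\<Pi>\<^sub>M i\<in>{1..n}. borel \<Otimes>\<^sub>M borel)"
    by (rule measurable_run_card[OF x assms])
qed

lemma measurable_regular [measurable]:
  "Measurable.pred (\<Pi>\<^sub>M i\<in>{1..n}. borel \<Otimes>\<^sub>M borel) (regular \<theta>0 n u)"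
  unfolding regular_def
proof (intro pred_intros_finite(3) finite_atLeastAtMost)
  fix r s assume "r \<in> {1..n}" "s \<in> {1..n}"
  note m = measurable_sample_run[OF this]
  show "Measurable.pred (\<Pi>\<^sub>M i\<in>{1..n}. borel \<Otimes>\<^sub>M borel) (\<lambda>z.
    (\<Sum>i\<in>run n (fst \<circ> z) r s. noise \<theta>0 (z i))\<^sup>2 \<le> u * real (card (run n (fst \<circ> z) r s)))"
    unfolding pred_def
    by (intro borel_measurable_le borel_measurable_power borel_measurable_times borel_measurable_const m)
qed

text \<open>A block of m observations with noise sum S and constant gap d adds d S - d^2 m / 2 to
  \<open>log_ratio\<close>. The maximum over d, at d = S / m, is S^2 / (2 m), as completing the
  square shows. For m = 0 the first hypothesis forces S = 0.\<close>

lemma block_quadratic_le: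
  fixes d S m u :: real
  assumes "S\<^sup>2 \<le> u * m" "0 \<le> m" "0 \<le> u"
  shows "d * S - d\<^sup>2 / 2 * m \<le> u / 2"
proof (cases "m = 0")
  case True
  then show ?thesis using assms by simp
next
  case False
  then have m: "0 < m" using assms by simp
  have "2 * m * (d * S - d\<^sup>2 / 2 * m) = S\<^sup>2 - (S - d * m)\<^sup>2"
    by (simp add: power2_eq_square field_simps)
  also have "\<dots> \<le> 2 * m * (u / 2)" using order_trans[OF assms(1), of "u * m + (S - d * m)\<^sup>2"] by (simp add: algebra_simps)
  finally show ?thesis using m by (simp only: mult_le_cancel_left_pos[of "2 * m"])
qed

text \<open>The observations in any interval form a run, so regularity bounds the noise on all segments.\<close>

lemma regular_interval:
  fixes \<alpha> \<beta> :: real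
  assumes "regular \<theta>0 n u z" "0 \<le> u"
  defines "b \<equiv> {i \<in> {1..n}. \<alpha> \<le> fst (z i) \<and> fst (z i) < \<beta>}"
  shows "(\<Sum>i\<in>b. noise \<theta>0 (z i))\<^sup>2 \<le> u * card b"
proof (cases "b = {}")
  case False
  have fin: "finite b" by (simp add: b_def)
  obtain r where r: "r \<in> b" "\<And>i. i \<in> b \<Longrightarrow> fst (z r) \<le> fst (z i)"
    using arg_min_if_finite[OF fin False, of "\<lambda>i. fst (z i)"] by (metis not_le)
  obtain s where s: "s \<in> b" "\<And>i. i \<in> b \<Longrightarrow> fst (z i) \<le> fst (z s)"
    using arg_min_if_finite[OF fin False, of "\<lambda>i. - fst (z i)"] by (metis not_le neg_less_iff_less)
  have "b = run n (fst \<circ> z) r s"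
    using r s by (auto simp: run_def b_def) 
  moreover have "r \<in> {1..n}" "s \<in> {1..n}" using r s by (auto simp: b_def)
  ultimately show ?thesis using assms(1) by (simp add: regular_def)
qed simp

text \<open>The common refinement of both partitions has at most k * k0 nonempty cells. The gap is
  constant on each of them, so \<open>block_quadratic_le\<close> bounds the contribution of each
  cell by u / 2.\<close>

lemma log_ratio_le_of_regular:
  assumes reg: "regular \<theta>0 n u z" and "0 \<le> u" and \<theta>: "\<theta> = (k, a, t)" "\<theta>0 = (k0, a0, t0)"
    and t: "t \<in> locations k" "1 \<le> k" and t0: "t0 \<in> locations k0" "1 \<le> k0"
  shows "log_ratio \<theta>0 n \<theta> z \<le> k * k0 * (u / 2)"
proof -
  define b where "b j l = {i \<in> {1..n}. max (knot k t (j - 1)) (knot k0 t0 (l - 1)) \<le> fst (z i) \<and>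
     fst (z i) < min (knot k t j) (knot k0 t0 l)}" for j l
  define h where "h j l i = (a j - a0 l) * noise \<theta>0 (z i) - (a j - a0 l)\<^sup>2 / 2" for j l i
  have "gap \<theta>0 \<theta> (fst (z i)) * noise \<theta>0 (z i) - (gap \<theta>0 \<theta> (fst (z i)))\<^sup>2 / 2
      = (\<Sum>j=1..k. \<Sum>l=1..k0. if i \<in> b j l then h j l i else 0)" if i: "i \<in> {1..n}" for i
  proof (cases "0 \<le> fst (z i) \<and> fst (z i) < 1")
    case True
    obtain j where j: "j \<in> {1..k}" "knot k t (j - 1) \<le> fst (z i)" "fst (z i) < knot k t j"
      using segment_exists[of k "fst (z i)" t] t True by blast
    obtain l where l: "l \<in> {1..k0}" "knot k0 t0 (l - 1) \<le> fst (z i)" "fst (z i) < knot k0 t0 l"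
      using segment_exists[of k0 "fst (z i)" t0] t0 True by blast
    have iff: "i \<in> b j' l' \<longleftrightarrow> j' = j \<and> l' = l" if "j' \<in> {1..k}" "l' \<in> {1..k0}" for j' l'
      using segment_unique[OF t(1) that(1) j(1) _ _ j(2,3)] segment_unique[OF t0(1) that(2) l(1) _ _ l(2,3)] i j l
      by (auto simp: b_def)
    have "(\<Sum>j'=1..k. \<Sum>l'=1..k0. if i \<in> b j' l' then h j' l' i else 0)
       = (\<Sum>j'=1..k. if j' = j then (\<Sum>l'=1..k0. if l' = l then h j l i else 0) else 0)"
      by (intro sum.cong refl) (auto simp: iff)
    also have "\<dots> = h j l i" using j(1) l(1) by simp
    also have "\<dots> = gap \<theta>0 \<theta> (fst (z i)) * noise \<theta>0 (z i) - (gap \<theta>0 \<theta> (fst (z i)))\<^sup>2 / 2"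
      unfolding h_def gap_def \<theta> step_fun_segment[OF t(1) j] step_fun_segment[OF t0(1) l] by simp
    finally show ?thesis by simp
  next
    \<comment> \<open>Outside [0,1) both step functions vanish and no cell contains the point, so
      both sides are 0.\<close>
    case False
    then have "gap \<theta>0 \<theta> (fst (z i)) = 0"
      unfolding gap_def \<theta> using step_fun_outside[OF t, of "fst (z i)"] step_fun_outside[OF t0, of "fst (z i)"] by auto
    moreover have "i \<notin> b j l" if "j \<in> {1..k}" "l \<in> {1..k0}" for j l
    proof -
      have "j - 1 \<le> k" "j \<le> k" using that by auto
      then show ?thesis
        using knot_unit_interval[OF t, of "j - 1"] knot_unit_interval[OF t, of j] False
        unfolding b_def by auto
    qed
    ultimately show ?thesis by (simp add: sum.neutral)
  qed
  then have "log_ratio \<theta>0 n \<theta> z = (\<Sum>i=1..n. \<Sum>j=1..k. \<Sum>l=1..k0. if i \<in> b j l then h j l i else 0)"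
    unfolding log_ratio_def by (intro sum.cong refl) blast
  also have "\<dots> = (\<Sum>j=1..k. \<Sum>i=1..n. \<Sum>l=1..k0. if i \<in> b j l then h j l i else 0)"
    by (rule sum.swap)
  also have "\<dots> = (\<Sum>j=1..k. \<Sum>l=1..k0. \<Sum>i=1..n. if i \<in> b j l then h j l i else 0)"
    by (rule sum.cong[OF refl], rule sum.swap)
  also have "\<dots> \<le> (\<Sum>j=1..k. \<Sum>l=1..k0. u / 2)"
  proof (intro sum_mono)
    fix j l
    have sub: "b j l \<subseteq> {1..n}" and fin: "finite (b j l)" by (auto simp: b_def)
    have "(\<Sum>i=1..n. if i \<in> b j l then h j l i else 0) = (\<Sum>i\<in>b j l. h j l i)"
      using sub by (simp add: sum.If_cases Int_absorb1)
    also have "\<dots> = (a j - a0 l) * (\<Sum>i\<in>b j l. noise \<theta>0 (z i)) - (a j - a0 l)\<^sup>2 / 2 * card (b j l)"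
      unfolding h_def by (simp add: sum_subtractf sum_distrib_left)
    also have "\<dots> \<le> u / 2"
      using regular_interval[OF reg \<open>0 \<le> u\<close>, of "max (knot k t (j - 1)) (knot k0 t0 (l - 1))" "min (knot k t j) (knot k0 t0 l)"]
        \<open>0 \<le> u\<close>
      by (intro block_quadratic_le) (simp_all add: b_def)
    finally show "(\<Sum>i=1..n. if i \<in> b j l then h j l i else 0) \<le> u / 2" .
  qed
  also have "\<dots> = real k * real k0 * (u / 2)" by simp
  finally show ?thesis .
qed

text \<open>Chernoff's bound with the optimal parameter sqrt (u / card R) for a run R. This
  parameter is random, but it depends on the design only and may therefore enter the weights of
  \<open>nn_integral_exp_noise\<close>. The sign \<sigma> serves both tails.\<close>

lemma prob_run_sum_large:
  fixes u :: real
  assumes r: "r \<in> {1..n}" and s: "s \<in> {1..n}" and "0 \<le> u" and \<sigma>: "\<sigma> = 1 \<or> \<sigma> = -1"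
  shows "emeasure (sample_law \<theta>0 n) {z \<in> space (sample_law \<theta>0 n).
      let R = run n (fst \<circ> z) r s in R \<noteq> {} \<and> sqrt (u * card R) < \<sigma> * (\<Sum>i\<in>R. noise \<theta>0 (z i))}
    \<le> ennreal (exp (- u / 2))"
proof -
  interpret U: prob_space "\<Pi>\<^sub>M i\<in>{1..n}. unif" by (rule prob_space_PiM) (rule prob_space_unif)
  have [simp]: "measurable M unif = borel_measurable M" for M :: "'c measure"
    by (rule measurable_cong_sets; simp)
  define w where "w i x = (if x r \<le> x i \<and> x i \<le> x s then \<sigma> * sqrt (u / card (run n x r s)) else 0)" for i and x :: "nat \<Rightarrow> real"
  have [measurable]: "w i \<in> borel_measurable (\<Pi>\<^sub>M i\<in>{1..n}. unif)" if "i \<in> {1..n}" for i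
  proof -
    have x: "(\<lambda>x. x j) \<in> borel_measurable (\<Pi>\<^sub>M i\<in>{1..n}. unif)" if "j \<in> {1..n}" for j
      using measurable_component_singleton[OF that, of "\<lambda>_. unif"] by simp
    define c where "c = (\<lambda>x. real (card (run n x r s)))"
    have [measurable]: "c \<in> borel_measurable (\<Pi>\<^sub>M i\<in>{1..n}. unif)"
      unfolding c_def by (rule measurable_run_card[of n "\<lambda>x. x", OF x r s])
    show ?thesis unfolding w_def c_def[symmetric, THEN fun_cong]
      by (intro measurable_If sets.sets_Collect_conj borel_measurable_le x r s that) measurable
  qed
  have rd: "run n (\<lambda>i\<in>{1..n}. fst (z i)) r s = run n (fst \<circ> z) r s" for z :: "nat \<Rightarrow> real \<times> real"
    using r s by (auto simp: run_def)
  \<comment> \<open>On the event the weighted noise is at least u, so exp T is at least 1 there,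
    while the expectation of exp T is at most exp (- u + u / 2).\<close>
  define T where "T z = - u + (\<Sum>i=1..n. w i (\<lambda>i\<in>{1..n}. fst (z i)) * noise \<theta>0 (z i))" for z
  have [measurable]: "(\<lambda>z. w i (\<lambda>i\<in>{1..n}. fst (z i))) \<in> borel_measurable (\<Pi>\<^sub>M i\<in>{1..n}. borel \<Otimes>\<^sub>M borel)"
    if "i \<in> {1..n}" for i
    by (rule measurable_compose[OF measurable_design]) (use that in measurable)
  have [measurable]: "T \<in> borel_measurable (sample_law \<theta>0 n)"
    unfolding T_def by measurable
  have T: "1 \<le> exp (T z)"
    if "run n (fst \<circ> z) r s \<noteq> {}"
      and "sqrt (u * card (run n (fst \<circ> z) r s)) < \<sigma> * (\<Sum>i\<in>run n (fst \<circ> z) r s. noise \<theta>0 (z i))" for z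
  proof -
    let ?R = "run n (fst \<circ> z) r s"
    have m: "0 < real (card ?R)" using that(1) by (simp add: card_gt_0_iff)
    have "u = sqrt (u / card ?R) * sqrt (u * card ?R)"
      using m \<open>0 \<le> u\<close> that(1) unfolding real_sqrt_mult[symmetric]
      by (simp add: power2_eq_square[symmetric])
    also have "\<dots> \<le> sqrt (u / card ?R) * (\<sigma> * (\<Sum>i\<in>?R. noise \<theta>0 (z i)))"
      using that(2) \<open>0 \<le> u\<close> by (intro mult_left_mono) auto
    also have "\<dots> = (\<Sum>i\<in>?R. \<sigma> * sqrt (u / card ?R) * noise \<theta>0 (z i))"
      by (simp add: sum_distrib_left mult_ac)
    also have "\<dots> = (\<Sum>i=1..n. w i (\<lambda>i\<in>{1..n}. fst (z i)) * noise \<theta>0 (z i))"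
      unfolding sum_run w_def rd using r s by (intro sum.cong refl) auto
    finally show ?thesis by (simp add: T_def)
  qed
  have "emeasure (sample_law \<theta>0 n) {z \<in> space (sample_law \<theta>0 n).
      let R = run n (fst \<circ> z) r s in R \<noteq> {} \<and> sqrt (u * card R) < \<sigma> * (\<Sum>i\<in>R. noise \<theta>0 (z i))}
    \<le> emeasure (sample_law \<theta>0 n) {z \<in> space (sample_law \<theta>0 n). 1 \<le> 1 * ennreal (exp (T z))}"
  proof (rule emeasure_mono)
    show "{z \<in> space (sample_law \<theta>0 n). 1 \<le> 1 * ennreal (exp (T z))} \<in> sets (sample_law \<theta>0 n)"
      by measurable
  qed (use T in \<open>auto simp: Let_def simp del: one_le_exp_iff\<close>)
  also have "\<dots> \<le> 1 * (\<integral>\<^sup>+ z. ennreal (exp (T z)) * indicator (space (sample_law \<theta>0 n)) z \<partial>sample_law \<theta>0 n)"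
    by (rule nn_integral_Markov_inequality[OF _ sets.top]) measurable
  also have "\<dots> = (\<integral>\<^sup>+ z. ennreal (exp (T z)) \<partial>sample_law \<theta>0 n)"
    by (simp cong: nn_integral_cong_simp)
  also have "\<dots> = (\<integral>\<^sup>+ x. ennreal (exp (- u + (\<Sum>i=1..n. (w i x)\<^sup>2 / 2))) \<partial>(\<Pi>\<^sub>M i\<in>{1..n}. unif))"
    unfolding T_def by (rule nn_integral_exp_noise[of n w "\<lambda>_. - u"]) measurable
  also have "\<dots> \<le> (\<integral>\<^sup>+ x. ennreal (exp (- u / 2)) \<partial>(\<Pi>\<^sub>M i\<in>{1..n}. unif))"
  proof (intro nn_integral_mono ennreal_leI)
    fix x :: "nat \<Rightarrow> real"
    have "(\<Sum>i=1..n. (w i x)\<^sup>2 / 2) = (\<Sum>i\<in>run n x r s. u / card (run n x r s) / 2)"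
      unfolding sum_run w_def using \<sigma> \<open>0 \<le> u\<close> by (intro sum.cong refl) (auto simp: power_mult_distrib)
    \<comment> \<open>Equality unless the run is empty, when the sum is 0.\<close>
    also have "\<dots> \<le> u / 2" using \<open>0 \<le> u\<close> by simp
    finally show "exp (- u + (\<Sum>i=1..n. (w i x)\<^sup>2 / 2)) \<le> exp (- u / 2)" by simp
  qed
  also have "\<dots> = ennreal (exp (- u / 2))" by (simp add: U.emeasure_space_1 del: One_nat_def)
  finally show ?thesis .
qed

text \<open>Union bound over n^2 runs and two signs.\<close>

lemma prob_not_regular:
  fixes u :: real
  assumes "0 \<le> u"
  shows "measure (sample_law \<theta>0 n) {z \<in> space (sample_law \<theta>0 n). \<not> regular \<theta>0 n u z} \<le> 2 * n\<^sup>2 * exp (- u / 2)"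
proof -
  interpret S: prob_space "sample_law \<theta>0 n" by (rule prob_space_sample_law)
  define E where "E p = {z \<in> space (sample_law \<theta>0 n). case p of (r, s, \<sigma>::real) \<Rightarrow>
      let R = run n (fst \<circ> z) r s in R \<noteq> {} \<and> sqrt (u * card R) < \<sigma> * (\<Sum>i\<in>R. noise \<theta>0 (z i))}" for p
  define I where "I = {1..n} \<times> {1..n} \<times> {1, -1::real}"
  have E: "E p \<in> sets (sample_law \<theta>0 n)" if "p \<in> I" for p
  proof -
    obtain r s \<sigma> where "p = (r, s, \<sigma>)" by (rule prod_cases3)
    with that have p: "p = (r, s, \<sigma>)" "r \<in> {1..n}" "s \<in> {1..n}" by (simp_all add: I_def)
    have *: "run n (fst \<circ> z) r s \<noteq> {} \<longleftrightarrow> 0 < real (card (run n (fst \<circ> z) r s))" for z :: "nat \<Rightarrow> real \<times> real"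
      by (simp add: card_gt_0_iff)
    note m = measurable_sample_run[OF p(2,3)]
    have "E p \<in> sets (\<Pi>\<^sub>M i\<in>{1..n}. borel \<Otimes>\<^sub>M borel)"
      unfolding E_def p(1) Let_def split * space_sample_law
      by (intro sets.sets_Collect_conj borel_measurable_less measurable_compose[OF _ borel_measurable_sqrt] borel_measurable_times borel_measurable_const m)
    then show ?thesis by simp
  qed
  have "{z \<in> space (sample_law \<theta>0 n). \<not> regular \<theta>0 n u z} \<subseteq> (\<Union>p\<in>I. E p)"
  proof
    fix z assume "z \<in> {z \<in> space (sample_law \<theta>0 n). \<not> regular \<theta>0 n u z}"
    then have z: "z \<in> space (sample_law \<theta>0 n)" "\<not> regular \<theta>0 n u z" by auto
    then obtain r s where rs: "r \<in> {1..n}" "s \<in> {1..n}"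
      and big: "u * card (run n (fst \<circ> z) r s) < (\<Sum>i\<in>run n (fst \<circ> z) r s. noise \<theta>0 (z i))\<^sup>2"
      by (auto simp: regular_def not_le)
    define S where "S = (\<Sum>i\<in>run n (fst \<circ> z) r s. noise \<theta>0 (z i))"
    have ne: "run n (fst \<circ> z) r s \<noteq> {}" using big by auto
    have "sqrt (u * card (run n (fst \<circ> z) r s)) < \<bar>S\<bar>"
      using real_sqrt_less_mono[OF big] by (simp add: S_def)
    moreover define \<sigma> :: real where "\<sigma> = (if 0 \<le> S then 1 else -1)"
    ultimately have "sqrt (u * card (run n (fst \<circ> z) r s)) < \<sigma> * S" by (auto simp: \<sigma>_def)
    then have "z \<in> E (r, s, \<sigma>)" using z(1) ne by (simp add: E_def S_def)
    moreover have "(r, s, \<sigma>) \<in> I" using rs by (auto simp: I_def \<sigma>_def)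
    ultimately show "z \<in> (\<Union>p\<in>I. E p)" by blast
  qed
  then have "measure (sample_law \<theta>0 n) {z \<in> space (sample_law \<theta>0 n). \<not> regular \<theta>0 n u z} \<le> measure (sample_law \<theta>0 n) (\<Union>p\<in>I. E p)"
    using E by (intro S.finite_measure_mono sets.finite_UN) (auto simp: I_def)
  also have "\<dots> \<le> (\<Sum>p\<in>I. measure (sample_law \<theta>0 n) (E p))"
    using E by (intro S.finite_measure_subadditive_finite) (auto simp: I_def)
  also have "\<dots> \<le> (\<Sum>p\<in>I. exp (- u / 2))"
  proof (intro sum_mono)
    fix p assume "p \<in> I"
    then obtain r s \<sigma> where "p = (r, s, \<sigma>)" "r \<in> {1..n}" "s \<in> {1..n}" "\<sigma> = 1 \<or> \<sigma> = -1"
      by (cases p) (simp add: I_def)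
    then have "emeasure (sample_law \<theta>0 n) (E p) \<le> ennreal (exp (- u / 2))"
      using prob_run_sum_large[of r n s u \<sigma> \<theta>0] assms by (simp add: E_def)
    then show "measure (sample_law \<theta>0 n) (E p) \<le> exp (- u / 2)"
      by (simp add: S.emeasure_eq_measure)
  qed
  also have "\<dots> = 2 * (real n)\<^sup>2 * exp (- u / 2)"
    by (simp add: I_def card_cartesian_product power2_eq_square)
  finally show ?thesis .
qed

section \<open>Parameters close to the truth\<close>

text \<open>Pigeonhole: among the k + 1 points u + p (v - u) / (k + 1) with p = 0, ..., k, two lie
  in the same one of the k segments.\<close>

lemma segment_subinterval:
  assumes t: "t \<in> locations k" "1 \<le> k" and uv: "0 \<le> u" "u < v" "v \<le> 1"
  obtains j u' v' where "j \<in> {1..k}" "u \<le> u'" "v' < v" "(v - u) / (k + 1) \<le> v' - u'"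
    "knot k t (j - 1) \<le> u'" "v' < knot k t j"
proof -
  define x where "x p = u + real p * ((v - u) / (k + 1))" for p :: nat
  have x: "u \<le> x p" "x p < v" if "p \<le> k" for p
  proof -
    show "u \<le> x p" using uv by (simp add: x_def)
    have "real p * ((v - u) / (k + 1)) < real (k + 1) * ((v - u) / (k + 1))"
      using that uv by (intro mult_strict_right_mono) auto
    then show "x p < v" by (simp add: x_def)
  qed
  have "\<forall>p\<in>{0..k}. \<exists>j. j \<in> {1..k} \<and> knot k t (j - 1) \<le> x p \<and> x p < knot k t j"
  proof
    fix p assume "p \<in> {0..k}"
    then have "0 \<le> x p" "x p < 1" using x[of p] uv by auto
    from segment_exists[OF t(2) this]
    show "\<exists>j. j \<in> {1..k} \<and> knot k t (j - 1) \<le> x p \<and> x p < knot k t j" by blast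
  qed
  from bchoice[OF this] obtain f where "\<forall>p\<in>{0..k}. f p \<in> {1..k} \<and> knot k t (f p - 1) \<le> x p \<and> x p < knot k t (f p)"
    ..
  then have f: "f p \<in> {1..k}" "knot k t (f p - 1) \<le> x p" "x p < knot k t (f p)" if "p \<in> {0..k}" for p
    using that by blast+
  have "f ` {0..k} \<subseteq> {1..k}" using f(1) by blast
  then have "card (f ` {0..k}) \<le> card {1..k}" by (rule card_mono[OF finite_atLeastAtMost])
  then have "\<not> inj_on f {0..k}" by (intro pigeonhole) simp
  then obtain p q where pq: "p \<in> {0..k}" "q \<in> {0..k}" "f p = f q" "p < q"
    unfolding inj_on_def by (metis linorder_neqE_nat)
  have "1 * ((v - u) / (k + 1)) \<le> real (q - p) * ((v - u) / (k + 1))"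
    using pq uv by (intro mult_right_mono) auto
  then have "(v - u) / (k + 1) \<le> x q - x p"
    using pq(4) by (simp add: x_def of_nat_diff left_diff_distrib diff_divide_distrib)
  moreover have "p \<le> k" "q \<le> k" using pq by auto
  ultimately show ?thesis
    using f[OF pq(1)] f[OF pq(2), folded pq(3)] x(1)[of p] x(2)[of q] that by metis
qed

lemma measure_unif_interval:
  assumes "0 \<le> u" "u \<le> v" "v \<le> 1"
  shows "measure unif {u..<v} = v - u"
proof -
  have "{0..<1} \<inter> {u..<v} = {u..<v}" using assms by auto
  then show ?thesis using assms by (simp add: measure_uniform_measure)
qed

lemma sqdist_ge_of_constant_gap:
  assumes "\<And>x. \<bar>gap \<theta>0 \<theta> x\<bar> \<le> B" "0 \<le> u" "u \<le> v" "v \<le> 1"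
    and c: "\<And>x. u \<le> x \<Longrightarrow> x < v \<Longrightarrow> gap \<theta>0 \<theta> x = c"
  shows "c\<^sup>2 * (v - u) \<le> sqdist \<theta>0 \<theta>"
proof -
  interpret U: prob_space unif by (rule prob_space_unif)
  have "c\<^sup>2 * (v - u) = (LINT x|unif. c\<^sup>2 * indicator {u..<v} x)"
    using measure_unif_interval[OF assms(2-4)] by simp
  also have "\<dots> \<le> sqdist \<theta>0 \<theta>" unfolding sqdist_def
  proof (rule integral_mono)
    show "integrable unif (\<lambda>x. c\<^sup>2 * indicator {u..<v} x)"
      by (rule U.integrable_const_bound[of _ "c\<^sup>2"]) (auto simp: indicator_def)
    show "integrable unif (\<lambda>x. (gap \<theta>0 \<theta> x)\<^sup>2)"
      by (rule integrable_gap_square[OF assms(1)])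
    show "c\<^sup>2 * indicator {u..<v} x \<le> (gap \<theta>0 \<theta> x)\<^sup>2" for x
      using c[of x] by (auto simp: indicator_def)
  qed
  finally show ?thesis .
qed

text \<open>The source of all lower bounds on the distance below: on a stretch inside one segment of
  each function the gap is constant.\<close>

lemma sqdist_ge_of_common_segment:
  assumes "\<And>x. \<bar>gap (k0, a0, t0) (k, a, t) x\<bar> \<le> B"
    and t: "t \<in> locations k" "1 \<le> k" "i \<in> {1..k}" "knot k t (i - 1) \<le> u" "v \<le> knot k t i"
    and t0: "t0 \<in> locations k0" "l \<in> {1..k0}" "knot k0 t0 (l - 1) \<le> u" "v \<le> knot k0 t0 l"
    and "u \<le> v"
  shows "(a i - a0 l)\<^sup>2 * (v - u) \<le> sqdist (k0, a0, t0) (k, a, t)"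
proof (rule sqdist_ge_of_constant_gap[OF assms(1)])
  have "i - 1 \<le> k" "i \<le> k" using t(3) by auto
  then show "0 \<le> u" "v \<le> 1"
    using knot_unit_interval[OF t(1,2), of "i - 1"] knot_unit_interval[OF t(1,2), of i] t by auto
  fix x assume "u \<le> x" "x < v"
  then show "gap (k0, a0, t0) (k, a, t) x = a i - a0 l"
    unfolding gap_def using t t0 by (subst step_fun_segment[OF t(1,3)] step_fun_segment[OF t0(1,2)]; simp)+
qed (rule assms)

lemma abs_le_sqrt_of_sq_mult_le:
  fixes d :: real
  assumes "d\<^sup>2 * s \<le> r" "0 < s"
  shows "\<bar>d\<bar> \<le> sqrt (r / s)"
  using assms by (intro real_le_rsqrt) (simp add: field_simps)

context
  fixes k0 :: nat and a0 t0 :: "nat \<Rightarrow> real" and K \<Delta> J :: real and kmax :: nat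
  assumes \<theta>0: "(k0, a0, t0) \<in> Theta kmax K" and K: "0 < K" and \<Delta>: "0 < \<Delta>" and J: "0 < J"
    and sep: "\<And>l. l \<in> {1..k0} \<Longrightarrow> \<Delta> \<le> knot k0 t0 l - knot k0 t0 (l - 1)"
    and jump: "\<And>l. l \<in> {2..k0} \<Longrightarrow> J \<le> \<bar>a0 l - a0 (l - 1)\<bar>"
begin

private lemma t0: "t0 \<in> locations k0" and k0: "1 \<le> k0" "k0 \<le> kmax"
  using \<theta>0 by (auto simp: Theta_def)

lemma knots_separated:
  assumes "l < l'" "l' \<le> k0"
  shows "knot k0 t0 l + \<Delta> \<le> knot k0 t0 l'"
  using sep[of "Suc l"] knot_mono[OF t0, of "Suc l" l'] assms by simp

text \<open>\<eta> is the accuracy of change-points, later of order \<epsilon>^2. Its lower bound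
  forces a knot near every true one; \<epsilon> + 2 \<eta> < \<Delta> keeps the approximations of
  two true knots more than \<epsilon> apart; the last condition makes the overlaps in
  \<open>level_approximated\<close> longer than \<eta>.\<close>

context
  fixes k :: nat and a t :: "nat \<Rightarrow> real" and \<epsilon> \<eta> :: real
  assumes \<theta>: "(k, a, t) \<in> Theta kmax K" and close: "sqdist (k0, a0, t0) (k, a, t) \<le> \<epsilon>\<^sup>2"
    and \<epsilon>: "0 < \<epsilon>" and \<eta>: "4 * \<epsilon>\<^sup>2 < J\<^sup>2 * \<eta>" and small: "\<epsilon> + 2 * \<eta> < \<Delta>" "\<eta> < \<Delta> / (kmax + 1)"
begin

private lemma t: "t \<in> locations k" and k: "1 \<le> k" "k \<le> kmax"
  using \<theta> by (auto simp: Theta_def)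

private lemma \<eta>_pos: "0 < \<eta>"
proof -
  have "0 < J\<^sup>2 * \<eta>" using \<eta> by (meson le_less_trans mult_nonneg_nonneg zero_le_numeral zero_le_power2)
  then show ?thesis using J by (simp add: zero_less_mult_iff)
qed

private lemma gap_bound: "\<bar>gap (k0, a0, t0) (k, a, t) x\<bar> \<le> 2 * K"
  using abs_gap_le[OF \<theta>0 \<theta>] K by simp

text \<open>Otherwise the function is constant within \<eta> on both sides of a true change-point,
  where the truth jumps by at least J. The gaps b and c on the two sides satisfy J^2 <= 2 b^2 + 2
  c^2, and b^2 \<eta> and c^2 \<eta> are at most \<epsilon>^2; this contradicts 4 \<epsilon>^2 < J^2
  \<eta>. The end points 0 and 1 are matched by themselves.\<close>

lemma knot_approximated:
  assumes "l \<le> k0"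
  shows "\<exists>j\<le>k. \<bar>knot k t j - knot k0 t0 l\<bar> < \<eta>"
proof (rule ccontr)
  assume "\<not> ?thesis"
  then have far: "\<And>j. j \<le> k \<Longrightarrow> \<eta> \<le> \<bar>knot k t j - knot k0 t0 l\<bar>" by (auto simp: not_less)
  let ?\<tau> = "knot k0 t0 l"
  have "l \<noteq> 0" using far[of 0] \<eta>_pos by (intro notI) simp
  moreover have "l \<noteq> k0" using far[of k] \<eta>_pos k k0 by (intro notI) simp
  ultimately have l: "l \<in> {1..k0}" "Suc l \<in> {1..k0}" using assms by auto
  have "?\<tau> < 1" using knot_strict_mono[OF t0, of l k0] l k0 by simp
  moreover have "0 \<le> ?\<tau>" using knot_unit_interval[OF t0 k0(1)] l by simp
  ultimately obtain i where i: "i \<in> {1..k}" "knot k t (i - 1) \<le> ?\<tau>" "?\<tau> < knot k t i"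
    using segment_exists[of k ?\<tau> t] k by auto
  have i': "knot k t (i - 1) \<le> ?\<tau> - \<eta>" "?\<tau> + \<eta> \<le> knot k t i"
  proof -
    have "i - 1 \<le> k" "i \<le> k" using i(1) by auto
    from far[OF this(1)] far[OF this(2)] i(2,3)
    show "knot k t (i - 1) \<le> ?\<tau> - \<eta>" "?\<tau> + \<eta> \<le> knot k t i" by linarith+
  qed
  have \<eta>\<Delta>: "\<eta> \<le> \<Delta>" using small(1) \<epsilon> \<eta>_pos by linarith
  have b: "(a i - a0 l)\<^sup>2 * (?\<tau> - (?\<tau> - \<eta>)) \<le> sqdist (k0, a0, t0) (k, a, t)"
    using sep[OF l(1)] \<eta>\<Delta> \<eta>_pos i'
    by (intro sqdist_ge_of_common_segment[OF gap_bound t k(1) i(1) _ _ t0 l(1)]) auto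
  have c: "(a i - a0 (Suc l))\<^sup>2 * (?\<tau> + \<eta> - ?\<tau>) \<le> sqdist (k0, a0, t0) (k, a, t)"
    using sep[OF l(2)] \<eta>\<Delta> \<eta>_pos i'
    by (intro sqdist_ge_of_common_segment[OF gap_bound t k(1) i(1) _ _ t0 l(2)]) auto
  have "J \<le> \<bar>a0 (Suc l) - a0 l\<bar>" using jump[of "Suc l"] l by simp
  then have "J\<^sup>2 \<le> (a0 (Suc l) - a0 l)\<^sup>2" using J by (metis power2_abs power_mono less_imp_le)
  also have "\<dots> \<le> 2 * (a i - a0 l)\<^sup>2 + 2 * (a i - a0 (Suc l))\<^sup>2"
  proof -
    have "2 * (a i - a0 l)\<^sup>2 + 2 * (a i - a0 (Suc l))\<^sup>2 - (a0 (Suc l) - a0 l)\<^sup>2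
        = ((a i - a0 l) + (a i - a0 (Suc l)))\<^sup>2"
      by (simp add: power2_eq_square algebra_simps)
    then show ?thesis by (metis diff_ge_0_iff_ge zero_le_power2)
  qed
  finally have "J\<^sup>2 * \<eta> \<le> (2 * (a i - a0 l)\<^sup>2 + 2 * (a i - a0 (Suc l))\<^sup>2) * \<eta>"
    using \<eta>_pos by (intro mult_right_mono) auto
  also have "\<dots> = 2 * ((a i - a0 l)\<^sup>2 * (?\<tau> - (?\<tau> - \<eta>))) + 2 * ((a i - a0 (Suc l))\<^sup>2 * (?\<tau> + \<eta> - ?\<tau>))"
    by (simp add: algebra_simps)
  also have "\<dots> \<le> 4 * \<epsilon>\<^sup>2" using b c close by linarith
  finally show False using \<eta> by linarith
qed

text \<open>A true segment is at least \<Delta> long, so it shares a stretch of length at least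
  \<Delta> / (kmax + 1) with one segment of t, and the squared level error times this length is at
  most \<epsilon>^2. The overlap is recorded as well because the injectivity of the matching is read
  off from it.\<close>

lemma level_approximated:
  assumes l: "l \<in> {1..k0}"
  shows "\<exists>i\<in>{1..k}. \<bar>a i - a0 l\<bar> \<le> sqrt ((kmax + 1) / \<Delta>) * \<epsilon> \<and>
    (\<exists>u v. knot k0 t0 (l - 1) \<le> u \<and> v < knot k0 t0 l \<and> \<eta> < v - u \<and> knot k t (i - 1) \<le> u \<and> v < knot k t i)"
proof -
  have "l \<le> k0" "l - 1 \<le> k0" "l - 1 < l" using l by auto
  then have bounds: "0 \<le> knot k0 t0 (l - 1)" "knot k0 t0 (l - 1) < knot k0 t0 l" "knot k0 t0 l \<le> 1"
    using knot_unit_interval[OF t0 k0(1)] knot_strict_mono[OF t0, of "l - 1" l] by auto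
  obtain i u v where i: "i \<in> {1..k}" and uv: "knot k0 t0 (l - 1) \<le> u" "v < knot k0 t0 l"
      "(knot k0 t0 l - knot k0 t0 (l - 1)) / (k + 1) \<le> v - u" "knot k t (i - 1) \<le> u" "v < knot k t i"
    by (rule segment_subinterval[OF t k(1) bounds])
  have "\<Delta> / (kmax + 1) \<le> (knot k0 t0 l - knot k0 t0 (l - 1)) / (k + 1)"
    using sep[OF l] \<Delta> k by (intro frac_le) auto
  then have len: "\<Delta> / (kmax + 1) \<le> v - u" using uv by linarith
  moreover have pos: "0 < \<Delta> / (kmax + 1)" using \<Delta> by simp
  ultimately have "u \<le> v" by linarith
  then have "(a i - a0 l)\<^sup>2 * (v - u) \<le> sqdist (k0, a0, t0) (k, a, t)"
    using uv by (intro sqdist_ge_of_common_segment[OF gap_bound t k(1) i _ _ t0 l]) auto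
  with close mult_left_mono[OF len, of "(a i - a0 l)\<^sup>2"]
  have "(a i - a0 l)\<^sup>2 * (\<Delta> / (kmax + 1)) \<le> \<epsilon>\<^sup>2" by simp
  from abs_le_sqrt_of_sq_mult_le[OF this pos]
  have "\<bar>a i - a0 l\<bar> \<le> sqrt ((kmax + 1) / \<Delta> * \<epsilon>\<^sup>2)" by (simp add: mult.commute)
  also have "\<dots> = sqrt ((kmax + 1) / \<Delta>) * \<epsilon>" using \<epsilon> by (simp only: real_sqrt_mult real_sqrt_abs abs_of_pos)
  finally have "\<bar>a i - a0 l\<bar> \<le> sqrt ((kmax + 1) / \<Delta>) * \<epsilon>" .
  moreover have "\<eta> < v - u" using len small(2) by linarith
  ultimately show ?thesis using i uv by blast
qed

text \<open>The same argument with the roles exchanged. Now the segment is only known to be longer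
  than \<epsilon>, so the shared stretch has length of order \<epsilon>, and the level error is of
  order sqrt \<epsilon> instead of \<epsilon>.\<close>

lemma extra_level_or_short_segment:
  assumes e: "e \<in> {1..k}" and long: "\<epsilon> < knot k t e - knot k t (e - 1)"
  shows "\<exists>l\<in>{1..k0}. \<bar>a e - a0 l\<bar> \<le> sqrt ((kmax + 1) * \<epsilon>)"
proof -
  have "e \<le> k" "e - 1 \<le> k" using e by auto
  then have bounds: "0 \<le> knot k t (e - 1)" "knot k t (e - 1) < knot k t e" "knot k t e \<le> 1"
    using knot_unit_interval[OF t k(1)] long \<epsilon> by auto
  obtain l u v where l: "l \<in> {1..k0}" and uv: "knot k t (e - 1) \<le> u" "v < knot k t e"
      "(knot k t e - knot k t (e - 1)) / (k0 + 1) \<le> v - u" "knot k0 t0 (l - 1) \<le> u" "v < knot k0 t0 l"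
    by (rule segment_subinterval[OF t0 k0(1) bounds])
  have "\<epsilon> / (kmax + 1) \<le> (knot k t e - knot k t (e - 1)) / (k0 + 1)"
    using long \<epsilon> k0 by (intro frac_le) auto
  then have len: "\<epsilon> / (kmax + 1) \<le> v - u" using uv by linarith
  moreover have pos: "0 < \<epsilon> / (kmax + 1)" using \<epsilon> by simp
  ultimately have "u \<le> v" by linarith
  then have "(a e - a0 l)\<^sup>2 * (v - u) \<le> sqdist (k0, a0, t0) (k, a, t)"
    using uv by (intro sqdist_ge_of_common_segment[OF gap_bound t k(1) e _ _ t0 l]) auto
  with close mult_left_mono[OF len, of "(a e - a0 l)\<^sup>2"]
  have "(a e - a0 l)\<^sup>2 * (\<epsilon> / (kmax + 1)) \<le> \<epsilon>\<^sup>2" by simp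
  from abs_le_sqrt_of_sq_mult_le[OF this pos]
  have "\<bar>a e - a0 l\<bar> \<le> sqrt ((kmax + 1) * \<epsilon>)" using \<epsilon> by (simp add: power2_eq_square mult.commute)
  then show ?thesis using l by blast
qed

text \<open>Here i matches true levels with segments, and j true inner knots with inner knots of t.
  Injectivity of i gives k0 < k and an unmatched segment e. If e is long, its level is close to a
  true one. If it is short, its ends are not both matched, as matched knots are more than \<epsilon>
  apart, so an unmatched knot is within \<epsilon> of another knot. Either way a coordinate is
  restricted that the matchings leave free.\<close>

lemma close_parameter_structure:
  assumes "k \<noteq> k0"
  obtains i j where "inj_on i {1..k0}" "i \<in> {1..k0} \<rightarrow> {1..k}"
    "\<forall>l\<in>{1..k0}. \<bar>a (i l) - a0 l\<bar> \<le> sqrt ((kmax + 1) / \<Delta>) * \<epsilon>"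
    "inj_on j {1..<k0}" "j \<in> {1..<k0} \<rightarrow> {1..<k}"
    "\<forall>l\<in>{1..<k0}. \<bar>t (j l) - t0 l\<bar> \<le> \<eta>"
    "(\<exists>e\<in>{1..k} - i ` {1..k0}. \<exists>l\<in>{1..k0}. \<bar>a e - a0 l\<bar> \<le> sqrt ((kmax + 1) * \<epsilon>)) \<or>
     (\<exists>f\<in>{1..<k} - j ` {1..<k0}. \<exists>g\<in>{0..k} - {f}. \<bar>t f - knot k t g\<bar> \<le> \<epsilon>)"
proof -
  obtain i where i: "\<And>l. l \<in> {1..k0} \<Longrightarrow> i l \<in> {1..k}"
    "\<And>l. l \<in> {1..k0} \<Longrightarrow> \<bar>a (i l) - a0 l\<bar> \<le> sqrt ((kmax + 1) / \<Delta>) * \<epsilon>"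
    "\<And>l. l \<in> {1..k0} \<Longrightarrow> \<exists>u v. knot k0 t0 (l - 1) \<le> u \<and> v < knot k0 t0 l \<and> \<eta> < v - u \<and>
        knot k t (i l - 1) \<le> u \<and> v < knot k t (i l)"
    using level_approximated by metis
  \<comment> \<open>A segment matched with two true levels would extend by more than \<eta> to both
    sides of the true change-point \<open>knot k0 t0 l\<close>, and so the knot m approximating this
    point would lie in its interior.\<close>
  have neq: "i l \<noteq> i l'" if ll: "l \<in> {1..k0}" "l' \<in> {1..k0}" "l < l'" for l l'
  proof
    assume eq: "i l = i l'"
    obtain u where u: "knot k t (i l - 1) \<le> u" "u + \<eta> < knot k0 t0 l" using i(3)[OF ll(1)] by force
    obtain v where v: "knot k0 t0 (l' - 1) + \<eta> < v" "v < knot k t (i l)" using i(3)[OF ll(2)] eq by force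
    obtain m where m: "m \<le> k" "\<bar>knot k t m - knot k0 t0 l\<bar> < \<eta>"
      using knot_approximated[of l] ll by auto
    have "knot k0 t0 l \<le> knot k0 t0 (l' - 1)" using ll by (intro knot_mono[OF t0]) auto
    then have "knot k t (i l - 1) < knot k t m" "knot k t m < knot k t (i l)" using u v m by linarith+
    moreover have "i l - 1 \<le> k" "i l \<le> k" using i(1)[OF ll(1)] by auto
    ultimately have "\<not> m \<le> i l - 1" "\<not> i l \<le> m"
      using knot_mono[OF t, of m "i l - 1"] knot_mono[OF t, of "i l" m] m(1) by linarith+
    then show False by linarith
  qed
  have inj_i: "inj_on i {1..k0}"
    by (rule linorder_inj_onI') (rule neq)
  have "card (i ` {1..k0}) \<le> card {1..k}" using i(1) by (intro card_mono) auto
  then have "k0 < k" using card_image[OF inj_i] assms by simp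
  then have "\<not> {1..k} \<subseteq> i ` {1..k0}"
    using card_image[OF inj_i] card_mono[of "i ` {1..k0}" "{1..k}"] by auto
  then obtain e where e: "e \<in> {1..k} - i ` {1..k0}" by blast
  obtain j' where j': "\<And>l. l \<le> k0 \<Longrightarrow> j' l \<le> k \<and> \<bar>knot k t (j' l) - knot k0 t0 l\<bar> < \<eta>"
    using knot_approximated by metis
  \<comment> \<open>Matching the end points exactly ensures that an unmatched knot is an inner one,
    hence a free coordinate.\<close>
  define j where "j = j'(0 := 0, k0 := k)"
  have j: "j l \<le> k" "\<bar>knot k t (j l) - knot k0 t0 l\<bar> < \<eta>" if "l \<le> k0" for l
    using j'[OF that] \<eta>_pos k k0 by (auto simp: j_def)
  have dist: "\<epsilon> < \<bar>knot k t (j l) - knot k t (j l')\<bar>" if "l < l'" "l' \<le> k0" for l l'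
    using knots_separated[OF that] j[of l] j[of l'] that small by linarith
  have inj_j: "l = l'" if "j l = j l'" "l \<le> k0" "l' \<le> k0" for l l'
  proof (rule ccontr)
    assume "l \<noteq> l'"
    then consider "l < l'" | "l' < l" by linarith
    then show False using dist[of l l'] dist[of l' l] that \<epsilon> by cases auto
  qed
  have j0: "j 0 = 0" "j k0 = k" using k0 by (auto simp: j_def)
  have j_range: "j l \<in> {1..<k}" if "l \<in> {1..<k0}" for l
  proof -
    have "j l \<noteq> 0" "j l \<noteq> k" "j l \<le> k" using inj_j[of l 0] inj_j[of l k0] j(1)[of l] that j0 by auto
    then show ?thesis by auto
  qed
  have knot_t: "knot k t m = t m" if "m \<in> {1..<k}" for m using that by (auto simp: knot_def)
  have knot_t0: "knot k0 t0 m = t0 m" if "m \<in> {1..<k0}" for m using that by (auto simp: knot_def)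
  show ?thesis
  proof (rule that[of i j])
    show "inj_on i {1..k0}" by (rule inj_i)
    show "i \<in> {1..k0} \<rightarrow> {1..k}" using i(1) by auto
    show "\<forall>l\<in>{1..k0}. \<bar>a (i l) - a0 l\<bar> \<le> sqrt ((kmax + 1) / \<Delta>) * \<epsilon>" by (intro ballI i(2))
    show "inj_on j {1..<k0}" using inj_j by (auto simp: inj_on_def)
    show "j \<in> {1..<k0} \<rightarrow> {1..<k}" using j_range by auto
    show "\<forall>l\<in>{1..<k0}. \<bar>t (j l) - t0 l\<bar> \<le> \<eta>"
    proof
      fix l assume l: "l \<in> {1..<k0}"
      then show "\<bar>t (j l) - t0 l\<bar> \<le> \<eta>"
        using j(2)[of l] knot_t[OF j_range[OF l]] knot_t0[OF l] by auto
    qed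
    show "(\<exists>e\<in>{1..k} - i ` {1..k0}. \<exists>l\<in>{1..k0}. \<bar>a e - a0 l\<bar> \<le> sqrt ((kmax + 1) * \<epsilon>)) \<or>
     (\<exists>f\<in>{1..<k} - j ` {1..<k0}. \<exists>g\<in>{0..k} - {f}. \<bar>t f - knot k t g\<bar> \<le> \<epsilon>)"
    proof (cases "\<epsilon> < knot k t e - knot k t (e - 1)")
      case True
      then show ?thesis using extra_level_or_short_segment[of e] e by blast
    next
      case False
      have ek: "e \<in> {1..k}" "e - 1 \<noteq> e" "e - 1 \<le> k" "e \<le> k" using e by auto
      have short: "\<bar>knot k t e - knot k t (e - 1)\<bar> \<le> \<epsilon>"
        using False knot_mono[OF t, of "e - 1" e] ek by auto
      have "\<not> (e - 1 \<in> j ` {0..k0} \<and> e \<in> j ` {0..k0})"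
      proof
        assume "e - 1 \<in> j ` {0..k0} \<and> e \<in> j ` {0..k0}"
        then obtain l l' where l: "e - 1 = j l" "e = j l'" "l \<le> k0" "l' \<le> k0" by auto
        have "l \<noteq> l'" using l ek by auto
        then consider "l < l'" | "l' < l" by linarith
        moreover have "\<bar>knot k t (j l') - knot k t (j l)\<bar> \<le> \<epsilon>" using short l(1,2) by simp
        ultimately show False using dist[of l l'] dist[of l' l] l(3,4) by cases linarith+
      qed
      then obtain f g where fg: "f \<notin> j ` {0..k0}" "f \<le> k" "g \<le> k" "f \<noteq> g"
        "\<bar>knot k t f - knot k t g\<bar> \<le> \<epsilon>"
        using short ek that[of e "e - 1"] that[of "e - 1" e] by (auto simp: abs_minus_commute)
      have "0 \<in> j ` {0..k0}" "k \<in> j ` {0..k0}" using j0 by force+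
      then have "f \<noteq> 0" "f \<noteq> k" using fg(1) by auto
      then have f: "f \<in> {1..<k}" using fg by auto
      moreover have "f \<notin> j ` {1..<k0}" using fg(1) by auto
      moreover have "g \<in> {0..k} - {f}" using fg by auto
      ultimately show ?thesis using fg(5) knot_t[OF f] by auto
    qed
  qed
qed

end

end

section \<open>Prior masses\<close>

text \<open>S will be the set of matched indices and c the true values carried over to them. The
  other coordinates only obey the bound D, which is K for levels and 1 for change-points.\<close>

definition pinned :: "nat set \<Rightarrow> real \<Rightarrow> nat set \<Rightarrow> (nat \<Rightarrow> real) \<Rightarrow> real \<Rightarrow> (nat \<Rightarrow> real) set" where
  "pinned I D S c r = {x \<in> I \<rightarrow>\<^sub>E {-D..D}. \<forall>i\<in>S. \<bar>x i - c i\<bar> \<le> r}"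

lemma pinned_eq_PiE:
  assumes "S \<subseteq> I"
  shows "pinned I D S c r = Pi\<^sub>E I (\<lambda>i. {-D..D} \<inter> (if i \<in> S then {c i - r..c i + r} else UNIV))"
proof (rule set_eqI)
  fix x
  have "\<bar>x i - c i\<bar> \<le> r \<longleftrightarrow> x i \<in> {c i - r..c i + r}" for i by (auto simp: abs_le_iff)
  then have "x \<in> pinned I D S c r \<longleftrightarrow>
      x \<in> extensional I \<and> (\<forall>i\<in>I. x i \<in> {-D..D}) \<and> (\<forall>i\<in>S. x i \<in> {c i - r..c i + r})"
    by (auto simp: pinned_def PiE_iff)
  also have "\<dots> \<longleftrightarrow> x \<in> extensional I \<and>
      (\<forall>i\<in>I. x i \<in> {-D..D} \<inter> (if i \<in> S then {c i - r..c i + r} else UNIV))"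
    using assms by (auto split: if_splits)
  finally show "x \<in> pinned I D S c r \<longleftrightarrow>
      x \<in> Pi\<^sub>E I (\<lambda>i. {-D..D} \<inter> (if i \<in> S then {c i - r..c i + r} else UNIV))"
    by (auto simp: PiE_iff)
qed

lemma sets_pinned:
  assumes "finite I" "S \<subseteq> I"
  shows "pinned I D S c r \<in> sets (\<Pi>\<^sub>M i\<in>I. lborel)"
  unfolding pinned_eq_PiE[OF assms(2)] by (intro sets_PiM_I_finite assms) auto

text \<open>A free coordinate is charged 1 + 2 D instead of 2 D. This is at least 1, so the exponent
  can be raised to a bound m that does not depend on S.\<close>

lemma emeasure_pinned_le:
  assumes "finite I" "S \<subseteq> I" "0 \<le> r" "0 \<le> D" "card I \<le> m"
  shows "emeasure (\<Pi>\<^sub>M i\<in>I. lborel) (pinned I D S c r) \<le> ennreal ((1 + 2 * D) ^ m * (2 * r) ^ card S)"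
proof -
  interpret product_sigma_finite "\<lambda>_::nat. lborel :: real measure" ..
  let ?B = "\<lambda>i. {-D..D} \<inter> (if i \<in> S then {c i - r..c i + r} else UNIV)"
  have "emeasure (\<Pi>\<^sub>M i\<in>I. lborel) (pinned I D S c r) = (\<Prod>i\<in>I. emeasure lborel (?B i))"
    unfolding pinned_eq_PiE[OF assms(2)] by (intro emeasure_PiM assms) auto
  also have "\<dots> \<le> (\<Prod>i\<in>I. if i \<in> S then ennreal (2 * r) else ennreal (1 + 2 * D))"
  proof (rule prod_mono_ennreal)
    fix i
    show "emeasure lborel (?B i) \<le> (if i \<in> S then ennreal (2 * r) else ennreal (1 + 2 * D))"
    proof (cases "i \<in> S")
      case True
      then have "emeasure lborel (?B i) \<le> emeasure lborel {c i - r..c i + r}" by (intro emeasure_mono) auto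
      then show ?thesis using True assms by simp
    next
      case False
      then have "emeasure lborel (?B i) \<le> emeasure lborel {-D..D}" by (intro emeasure_mono) auto
      also have "\<dots> \<le> ennreal (1 + 2 * D)" using assms by (simp add: ennreal_leI)
      finally show ?thesis using False by simp
    qed
  qed
  also have "\<dots> = ennreal (2 * r) ^ card S * ennreal (1 + 2 * D) ^ card (I - S)"
    using assms by (simp add: prod.If_cases Int_absorb1 Diff_eq)
  also have "\<dots> = ennreal ((1 + 2 * D) ^ card (I - S) * (2 * r) ^ card S)"
  proof -
    have e: "ennreal (2 * r) ^ card S = ennreal ((2 * r) ^ card S)"
      "ennreal (1 + 2 * D) ^ card (I - S) = ennreal ((1 + 2 * D) ^ card (I - S))"
      using assms by (intro ennreal_power; simp)+
    show ?thesis unfolding e using assms by (subst ennreal_mult[symmetric]) (auto simp: mult.commute)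
  qed
  also have "\<dots> \<le> ennreal ((1 + 2 * D) ^ m * (2 * r) ^ card S)"
  proof (intro ennreal_leI mult_right_mono power_increasing)
    have "card (I - S) \<le> card I" using assms by (intro card_mono) auto
    then show "card (I - S) \<le> m" using assms(5) by simp
  qed (use assms in auto)
  finally show ?thesis .
qed

text \<open>Integrating over coordinate f first gives at most 2 \<delta> whatever the other
  coordinates are, since h ignores f. For levels h is a true level, for change-points it is another
  knot.\<close>

lemma emeasure_pinned_tied_le:
  fixes h :: "(nat \<Rightarrow> real) \<Rightarrow> real"
  assumes "finite I" "S \<subseteq> I" "f \<in> I - S" "0 \<le> r" "0 \<le> D" "0 \<le> \<delta>" "card I \<le> m"
    and h [measurable]: "h \<in> borel_measurable (\<Pi>\<^sub>M i\<in>I. lborel)" and h_indep: "\<And>x y. h (x(f := y)) = h x"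
  shows "{x \<in> pinned I D S c r. \<bar>x f - h x\<bar> \<le> \<delta>} \<in> sets (\<Pi>\<^sub>M i\<in>I. lborel)" (is ?sets)
    and "emeasure (\<Pi>\<^sub>M i\<in>I. lborel) {x \<in> pinned I D S c r. \<bar>x f - h x\<bar> \<le> \<delta>}
      \<le> ennreal ((1 + 2 * D) ^ m * (2 * r) ^ card S * (2 * \<delta>))" (is ?le)
proof -
  interpret product_sigma_finite "\<lambda>_::nat. lborel :: real measure" ..
  have f: "f \<in> I" "f \<notin> S" using assms(3) by auto
  have [measurable]: "(\<lambda>x. x f) \<in> borel_measurable (\<Pi>\<^sub>M i\<in>I. lborel)"
    using measurable_component_singleton[OF f(1), of "\<lambda>_. lborel"] by simp
  have [measurable]: "pinned I D S c r \<in> sets (\<Pi>\<^sub>M i\<in>I. lborel)"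
    by (rule sets_pinned[OF assms(1,2)])
  have sub: "pinned I D S c r \<subseteq> space (\<Pi>\<^sub>M i\<in>I. lborel)"
    using sets.sets_into_space[OF sets_pinned[OF assms(1,2)]] .
  have "{x \<in> pinned I D S c r. \<bar>x f - h x\<bar> \<le> \<delta>}
      = {x \<in> space (\<Pi>\<^sub>M i\<in>I. lborel). x \<in> pinned I D S c r \<and> \<bar>x f - h x\<bar> \<le> \<delta>}"
    using sub by auto
  also have "\<dots> \<in> sets (\<Pi>\<^sub>M i\<in>I. lborel)" by measurable
  finally show s: ?sets .
  define I' where "I' = I - {f}"
  have I: "I = insert f I'" "f \<notin> I'" "finite I'" "S \<subseteq> I'" "card I' \<le> m"
    using f assms by (auto simp: I'_def card_Diff_singleton_if)
  have [measurable]: "pinned I' D S c r \<in> sets (\<Pi>\<^sub>M i\<in>I'. lborel)"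
    by (rule sets_pinned[OF I(3,4)])
  let ?A = "{x \<in> pinned I D S c r. \<bar>x f - h x\<bar> \<le> \<delta>}"
  have "emeasure (\<Pi>\<^sub>M i\<in>I. lborel) ?A = (\<integral>\<^sup>+ x. indicator ?A x \<partial>(\<Pi>\<^sub>M i\<in>insert f I'. lborel))"
    using s I(1) by simp
  also have "\<dots> = (\<integral>\<^sup>+ x. \<integral>\<^sup>+ y. indicator ?A (x(f := y)) \<partial>lborel \<partial>(\<Pi>\<^sub>M i\<in>I'. lborel))"
    using s I by (intro product_nn_integral_insert) auto
  also have "\<dots> \<le> (\<integral>\<^sup>+ x. ennreal (2 * \<delta>) * indicator (pinned I' D S c r) x \<partial>(\<Pi>\<^sub>M i\<in>I'. lborel))"
  proof (intro nn_integral_mono)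
    fix x assume "x \<in> space (\<Pi>\<^sub>M i\<in>I'. lborel :: real measure)"
    then have x: "x \<in> extensional I'" by (simp add: space_PiM PiE_iff)
    have "indicator ?A (x(f := y)) \<le> (indicator (pinned I' D S c r) x * indicator {h x - \<delta>..h x + \<delta>} y :: ennreal)" for y
    proof (cases "x(f := y) \<in> ?A")
      case True
      then have y: "y \<in> {h x - \<delta>..h x + \<delta>}" by (auto simp: h_indep)
      have *: "x(f := y) \<in> pinned I D S c r" using True by simp
      have "x i \<in> {-D..D}" if "i \<in> I'" for i
      proof -
        have "(x(f := y)) i \<in> {-D..D}" "i \<noteq> f" using * that I unfolding pinned_def by auto
        then show ?thesis by simp
      qed
      moreover have "\<bar>x i - c i\<bar> \<le> r" if "i \<in> S" for i
      proof -
        have "\<bar>(x(f := y)) i - c i\<bar> \<le> r" "i \<noteq> f" using * that f unfolding pinned_def by blast+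
        then show ?thesis by simp
      qed
      ultimately have "x \<in> pinned I' D S c r" using x unfolding pinned_def by (auto simp: PiE_iff)
      then show ?thesis unfolding indicator_simps(1)[OF True] using y by simp
    qed simp
    then have "(\<integral>\<^sup>+ y. indicator ?A (x(f := y)) \<partial>lborel)
        \<le> (\<integral>\<^sup>+ y. indicator (pinned I' D S c r) x * indicator {h x - \<delta>..h x + \<delta>} y \<partial>lborel)"
      by (intro nn_integral_mono) auto
    also have "\<dots> = ennreal (2 * \<delta>) * indicator (pinned I' D S c r) x"
      using assms by (subst nn_integral_cmult) (auto simp: mult.commute)
    finally show "(\<integral>\<^sup>+ y. indicator ?A (x(f := y)) \<partial>lborel) \<le> ennreal (2 * \<delta>) * indicator (pinned I' D S c r) x" .
  qed
  also have "\<dots> = ennreal (2 * \<delta>) * emeasure (\<Pi>\<^sub>M i\<in>I'. lborel) (pinned I' D S c r)"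
    by (subst nn_integral_cmult_indicator) auto
  also have "\<dots> \<le> ennreal (2 * \<delta>) * ennreal ((1 + 2 * D) ^ m * (2 * r) ^ card S)"
    using I assms by (intro mult_left_mono emeasure_pinned_le) auto
  also have "\<dots> = ennreal ((1 + 2 * D) ^ m * (2 * r) ^ card S * (2 * \<delta>))"
    using assms by (subst ennreal_mult[symmetric]) (auto simp: mult_ac)
  finally show ?le .
qed

lemma emeasure_level_measure:
  assumes "A \<in> sets (\<Pi>\<^sub>M j\<in>{1..k}. lborel)" "A \<subseteq> levels k K"
  shows "A \<in> sets (level_measure k K)" "emeasure (level_measure k K) A = emeasure (\<Pi>\<^sub>M j\<in>{1..k}. lborel) A"
proof -
  have "levels k K \<inter> space (\<Pi>\<^sub>M j\<in>{1..k}. lborel) \<in> sets (\<Pi>\<^sub>M j\<in>{1..k}. lborel)"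
    using sets_levels by (intro sets.Int) auto
  then show "A \<in> sets (level_measure k K)" "emeasure (level_measure k K) A = emeasure (\<Pi>\<^sub>M j\<in>{1..k}. lborel) A"
    unfolding level_measure_def using assms by (simp_all add: sets_restrict_space_iff emeasure_restrict_space)
qed

lemma emeasure_location_measure:
  assumes "A \<in> sets (\<Pi>\<^sub>M j\<in>{1..<k}. lborel)" "A \<subseteq> locations k"
  shows "A \<in> sets (location_measure k)" "emeasure (location_measure k) A = emeasure (\<Pi>\<^sub>M j\<in>{1..<k}. lborel) A"
proof -
  have "locations k \<inter> space (\<Pi>\<^sub>M j\<in>{1..<k}. lborel) \<in> sets (\<Pi>\<^sub>M j\<in>{1..<k}. lborel)"
    using sets_locations by (intro sets.Int) auto
  then show "A \<in> sets (location_measure k)" "emeasure (location_measure k) A = emeasure (\<Pi>\<^sub>M j\<in>{1..<k}. lborel) A"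
    unfolding location_measure_def using assms by (simp_all add: sets_restrict_space_iff emeasure_restrict_space)
qed

text \<open>A symmetric box is the form that \<open>pinned\<close> expects.\<close>

lemma locations_bounded:
  assumes "t \<in> locations k" "1 \<le> k"
  shows "t \<in> {1..<k} \<rightarrow>\<^sub>E {-1..1}"
proof -
  have "t j \<in> {-1..1}" if "j \<in> {1..<k}" for j
    using knot_unit_interval[OF assms, of j] that by (auto simp: knot_def)
  then show ?thesis using assms by (auto simp: locations_def PiE_iff)
qed

lemma
  assumes bd: "prior_densities k K \<pi>a \<pi>t"
    and A: "A \<in> sets (level_measure k K)" and B: "B \<in> sets (location_measure k)"
  shows emeasure_prior_k_rectangle_le:
      "\<lbrakk>\<And>a t. a \<in> levels k K \<Longrightarrow> t \<in> locations k \<Longrightarrow> \<pi>a a t \<le> C \<and> \<pi>t t \<le> C\<rbrakk> \<Longrightarrow>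
      emeasure (prior_k k K \<pi>a \<pi>t) (A \<times> B) \<le> ennreal (C\<^sup>2) * (emeasure (level_measure k K) A * emeasure (location_measure k) B)"
    and emeasure_prior_k_rectangle_ge:
      "\<lbrakk>0 \<le> c; \<And>a t. a \<in> levels k K \<Longrightarrow> t \<in> locations k \<Longrightarrow> c \<le> \<pi>a a t \<and> c \<le> \<pi>t t\<rbrakk> \<Longrightarrow>
      ennreal (c\<^sup>2) * (emeasure (level_measure k K) A * emeasure (location_measure k) B) \<le> emeasure (prior_k k K \<pi>a \<pi>t) (A \<times> B)"
proof -
  interpret L: sigma_finite_measure "level_measure k K" by (rule sigma_finite_level_measure)
  interpret T: sigma_finite_measure "location_measure k" by (rule sigma_finite_location_measure)
  interpret LT: pair_sigma_finite "level_measure k K" "location_measure k" ..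
  let ?M = "level_measure k K \<Otimes>\<^sub>M location_measure k"
  have [measurable]: "(\<lambda>(a, t). \<pi>a a t) \<in> borel_measurable ?M" "\<pi>t \<in> borel_measurable (location_measure k)"
    using bd by (auto simp: prior_densities_def)
  have [measurable]: "A \<times> B \<in> sets ?M" using A B by auto
  have eq: "emeasure (prior_k k K \<pi>a \<pi>t) (A \<times> B) =
      (\<integral>\<^sup>+ z. (case z of (a, t) \<Rightarrow> ennreal (\<pi>a a t * \<pi>t t)) * indicator (A \<times> B) z \<partial>?M)"
    unfolding prior_k_def by (subst emeasure_density) auto
  have rect: "(\<integral>\<^sup>+ z. ennreal (d\<^sup>2) * indicator (A \<times> B) z \<partial>?M)
      = ennreal (d\<^sup>2) * (emeasure (level_measure k K) A * emeasure (location_measure k) B)" for d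
    using A B by (subst nn_integral_cmult_indicator) (auto simp: T.emeasure_pair_measure_Times)
  have sp: "a \<in> levels k K \<and> t \<in> locations k" if "(a, t) \<in> space ?M" for a t
    using that by (auto simp: space_pair_measure space_level_measure space_location_measure)
  have nn: "0 \<le> \<pi>a a t" "0 \<le> \<pi>t t" if "a \<in> levels k K" "t \<in> locations k" for a t
    using bd that by (auto simp: prior_densities_def)
  show "emeasure (prior_k k K \<pi>a \<pi>t) (A \<times> B) \<le> ennreal (C\<^sup>2) * (emeasure (level_measure k K) A * emeasure (location_measure k) B)"
    if C: "\<And>a t. a \<in> levels k K \<Longrightarrow> t \<in> locations k \<Longrightarrow> \<pi>a a t \<le> C \<and> \<pi>t t \<le> C"
    unfolding eq rect[symmetric]
  proof (intro nn_integral_mono mult_right_mono)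
    fix z assume "z \<in> space ?M"
    then obtain a t where z: "z = (a, t)" "a \<in> levels k K" "t \<in> locations k" using sp by (cases z) auto
    then have "\<pi>a a t * \<pi>t t \<le> C * C"
      using C[OF z(2,3)] nn[OF z(2,3)] by (intro mult_mono) auto
    then show "(case z of (a, t) \<Rightarrow> ennreal (\<pi>a a t * \<pi>t t)) \<le> ennreal (C\<^sup>2)"
      using z by (auto simp: power2_eq_square intro: ennreal_leI)
  qed simp
  show "ennreal (c\<^sup>2) * (emeasure (level_measure k K) A * emeasure (location_measure k) B) \<le> emeasure (prior_k k K \<pi>a \<pi>t) (A \<times> B)"
    if "0 \<le> c" and c: "\<And>a t. a \<in> levels k K \<Longrightarrow> t \<in> locations k \<Longrightarrow> c \<le> \<pi>a a t \<and> c \<le> \<pi>t t"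
    unfolding eq rect[symmetric]
  proof (intro nn_integral_mono mult_right_mono)
    fix z assume "z \<in> space ?M"
    then obtain a t where z: "z = (a, t)" "a \<in> levels k K" "t \<in> locations k" using sp by (cases z) auto
    then have "c * c \<le> \<pi>a a t * \<pi>t t"
      using c[OF z(2,3)] nn[OF z(2,3)] \<open>0 \<le> c\<close> by (intro mult_mono) auto
    then show "ennreal (c\<^sup>2) \<le> (case z of (a, t) \<Rightarrow> ennreal (\<pi>a a t * \<pi>t t))"
      using z by (auto simp: power2_eq_square intro: ennreal_leI)
  qed simp
qed

text \<open>Measurability is asked of the covering sets, as \<open>emeasure\<close> is monotone
  below a measurable set.\<close>

lemma emeasure_covered_le:
  assumes "finite \<R>" "\<R> \<subseteq> sets M" "N \<subseteq> \<Union>\<R>" "\<And>R. R \<in> \<R> \<Longrightarrow> emeasure M R \<le> ennreal T" "card \<R> \<le> m" "0 \<le> T"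
  shows "emeasure M N \<le> ennreal (m * T)"
proof -
  have "\<Union>\<R> \<in> sets M" using assms(1,2) by (intro sets.finite_Union) auto
  then have "emeasure M N \<le> emeasure M (\<Union>R\<in>\<R>. R)" using assms(3) by (intro emeasure_mono) auto
  also have "\<dots> \<le> (\<Sum>R\<in>\<R>. emeasure M R)"
    using assms(1,2) by (intro emeasure_subadditive_finite) auto
  also have "\<dots> \<le> (\<Sum>R\<in>\<R>. ennreal T)" using assms(4) by (intro sum_mono)
  also have "\<dots> = ennreal (card \<R> * T)" using assms(6) by (simp add: ennreal_mult ennreal_of_nat_eq_real_of_nat)
  also have "\<dots> \<le> ennreal (m * T)" using assms(5,6) by (intro ennreal_leI mult_right_mono) auto
  finally show ?thesis .
qed

text \<open>Restricting the matching to its domain puts it into a finite set of extensional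
  functions; the centres are carried over by its inverse.\<close>

lemma pinned_by_injection:
  assumes "inj_on i L" "a \<in> I \<rightarrow>\<^sub>E {-D..D}" "\<And>l. l \<in> L \<Longrightarrow> \<bar>a (i l) - b l\<bar> \<le> r"
  shows "a \<in> pinned I D (restrict i L ` L) (b \<circ> inv_into L (restrict i L)) r"
proof -
  have inj: "inj_on (restrict i L) L" using assms(1) by (simp add: inj_on_restrict_eq)
  have "inv_into L (restrict i L) (i l) = l" if "l \<in> L" for l
    using inv_into_f_f[OF inj that] that by simp
  then show ?thesis using assms(2,3) by (auto simp: pinned_def)
qed

lemma prior_k_rectangle_bound:
  assumes pd: "prior_densities k K \<pi>a \<pi>t"
    and C: "\<And>a t. a \<in> levels k K \<Longrightarrow> t \<in> locations k \<Longrightarrow> \<pi>a a t \<le> C \<and> \<pi>t t \<le> C"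
    and A: "A \<in> sets (\<Pi>\<^sub>M j\<in>{1..k}. lborel)" "A \<subseteq> levels k K" "emeasure (\<Pi>\<^sub>M j\<in>{1..k}. lborel) A \<le> ennreal x"
    and B: "B \<in> sets (\<Pi>\<^sub>M j\<in>{1..<k}. lborel)" "emeasure (\<Pi>\<^sub>M j\<in>{1..<k}. lborel) B \<le> ennreal y"
    and "0 \<le> x" "0 \<le> y"
  shows "A \<times> (B \<inter> locations k) \<in> sets (prior_k k K \<pi>a \<pi>t)"
    and "emeasure (prior_k k K \<pi>a \<pi>t) (A \<times> (B \<inter> locations k)) \<le> ennreal (C\<^sup>2 * (x * y))"
proof -
  have BL: "B \<inter> locations k \<in> sets (\<Pi>\<^sub>M j\<in>{1..<k}. lborel)"
    using B(1) sets_locations by (rule sets.Int)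
  note s = emeasure_level_measure[OF A(1,2)] emeasure_location_measure[OF BL Int_lower2]
  show "A \<times> (B \<inter> locations k) \<in> sets (prior_k k K \<pi>a \<pi>t)"
    using s by (auto simp: prior_k_def)
  have "emeasure (\<Pi>\<^sub>M j\<in>{1..<k}. lborel) (B \<inter> locations k) \<le> ennreal y"
    by (rule order_trans[OF emeasure_mono[OF Int_lower1 B(1)] B(2)])
  then have "emeasure (level_measure k K) A * emeasure (location_measure k) (B \<inter> locations k) \<le> ennreal x * ennreal y"
    using A(3) unfolding s by (intro mult_mono) auto
  then have "emeasure (prior_k k K \<pi>a \<pi>t) (A \<times> (B \<inter> locations k)) \<le> ennreal (C\<^sup>2) * (ennreal x * ennreal y)"
    using emeasure_prior_k_rectangle_le[OF pd s(1,3) C] by (meson mult_left_mono order_trans zero_le)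
  then show "emeasure (prior_k k K \<pi>a \<pi>t) (A \<times> (B \<inter> locations k)) \<le> ennreal (C\<^sup>2 * (x * y))"
    using assms by (simp add: ennreal_mult)
qed

text \<open>The close parameters are covered by rectangles whose number does not depend on
  \<epsilon>, one family for each alternative of \<open>close_parameter_structure\<close>. A
  rectangle fixes k0 levels up to order \<epsilon>, k0 - 1 change-points up to order \<epsilon>^2,
  and one further coordinate up to order sqrt \<epsilon>. The exponent is k0 + 2 (k0 - 1) = 3 k0 -
  2.\<close>

lemma prior_k_close_le:
  fixes K \<Delta> J :: real
  assumes \<theta>0: "(k0, a0, t0) \<in> Theta kmax K" and K: "0 < K" and \<Delta>: "0 < \<Delta>" and J: "0 < J"
    and sep: "\<And>l. l \<in> {1..k0} \<Longrightarrow> \<Delta> \<le> knot k0 t0 l - knot k0 t0 (l - 1)"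
    and jump: "\<And>l. l \<in> {2..k0} \<Longrightarrow> J \<le> \<bar>a0 l - a0 (l - 1)\<bar>"
    and k: "k \<in> {1..kmax}" "k \<noteq> k0"
    and pd: "prior_densities k K \<pi>a \<pi>t" and ba: "bounded_away k K \<pi>a \<pi>t"
  shows "\<exists>M\<ge>0. \<forall>\<^sub>F \<epsilon> in at_right 0. emeasure (prior_k k K \<pi>a \<pi>t)
      {(a, t). a \<in> levels k K \<and> t \<in> locations k \<and> sqdist (k0, a0, t0) (k, a, t) \<le> \<epsilon>\<^sup>2}
    \<le> ennreal (M * (\<epsilon> ^ (3 * k0 - 2) * sqrt \<epsilon>))"
proof -
  have k0: "1 \<le> k0" using \<theta>0 by (auto simp: Theta_def)
  obtain C where C: "\<And>a t. a \<in> levels k K \<Longrightarrow> t \<in> locations k \<Longrightarrow> \<pi>a a t \<le> C \<and> \<pi>t t \<le> C"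
    using ba unfolding bounded_away_def by blast
  define C1 where "C1 = sqrt ((kmax + 1) / \<Delta>)"
  define II where "II = {1..k0} \<rightarrow>\<^sub>E {1..k}"
  define JJ where "JJ = {1..<k0} \<rightarrow>\<^sub>E {1..<k}"
  define P1 where "P1 = II \<times> JJ \<times> {1..k} \<times> {1..k0}"
  define P2 where "P2 = II \<times> JJ \<times> {1..<k} \<times> {0..k}"
  have fin: "finite P1" "finite P2" unfolding P1_def P2_def II_def JJ_def by (auto intro!: finite_PiE)
  define M where "M = (card P1 + card P2) * (C\<^sup>2 * ((1 + 2 * K) ^ kmax * (2 * C1) ^ k0 * (3 ^ kmax * (10 / J\<^sup>2) ^ (k0 - 1)) * (2 * sqrt (kmax + 1))))"
  have "M \<ge> 0" unfolding M_def C1_def using K \<Delta> by (intro mult_nonneg_nonneg) auto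
  have "((\<lambda>\<epsilon>. \<epsilon> + 2 * (5 * \<epsilon>\<^sup>2 / J\<^sup>2)) \<longlongrightarrow> 0 + 2 * (5 * 0\<^sup>2 / J\<^sup>2)) (at_right 0)"
    using J by (intro tendsto_intros) auto
  then have ev1: "\<forall>\<^sub>F \<epsilon> in at_right 0. \<epsilon> + 2 * (5 * \<epsilon>\<^sup>2 / J\<^sup>2) < \<Delta>"
    using \<Delta> by (intro order_tendstoD(2)[where y=0]) auto
  have "((\<lambda>\<epsilon>. 5 * \<epsilon>\<^sup>2 / J\<^sup>2) \<longlongrightarrow> 5 * 0\<^sup>2 / J\<^sup>2) (at_right 0)"
    using J by (intro tendsto_intros) auto
  then have ev2: "\<forall>\<^sub>F \<epsilon> in at_right 0. 5 * \<epsilon>\<^sup>2 / J\<^sup>2 < \<Delta> / (kmax + 1)"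
    using \<Delta> by (intro order_tendstoD(2)[where y=0]) auto
  have ev3: "\<forall>\<^sub>F \<epsilon>::real in at_right 0. \<epsilon> \<in> {0<..<1}"
    by (rule eventually_at_right_real) simp
  have "\<forall>\<^sub>F \<epsilon> in at_right 0. emeasure (prior_k k K \<pi>a \<pi>t)
      {(a, t). a \<in> levels k K \<and> t \<in> locations k \<and> sqdist (k0, a0, t0) (k, a, t) \<le> \<epsilon>\<^sup>2}
    \<le> ennreal (M * (\<epsilon> ^ (3 * k0 - 2) * sqrt \<epsilon>))"
    using ev1 ev2 ev3
  proof eventually_elim
    case (elim \<epsilon>)
    \<comment> \<open>Any factor above 4 gives 4 \<epsilon>^2 < J^2 \<eta>.\<close>
    define \<eta> where "\<eta> = 5 * \<epsilon>\<^sup>2 / J\<^sup>2"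
    define \<delta> where "\<delta> = sqrt ((kmax + 1) * \<epsilon>)"
    have \<epsilon>: "0 < \<epsilon>" "\<epsilon> < 1" using elim by auto
    have \<eta>: "4 * \<epsilon>\<^sup>2 < J\<^sup>2 * \<eta>" "\<epsilon> + 2 * \<eta> < \<Delta>" "\<eta> < \<Delta> / (kmax + 1)" "0 \<le> \<eta>"
      using elim \<epsilon> J by (auto simp: \<eta>_def)
    \<comment> \<open>The alternatives have tolerances \<delta> and \<epsilon>. By this inequality
      both families of rectangles can share the bound with \<delta>.\<close>
    have \<delta>: "\<epsilon> \<le> \<delta>" "0 \<le> \<delta>"
    proof -
      have "\<epsilon>\<^sup>2 \<le> 1 * \<epsilon>" using \<epsilon> by (simp add: power2_eq_square)
      also have "\<dots> \<le> (kmax + 1) * \<epsilon>" using \<epsilon> by (intro mult_right_mono) auto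
      finally show "\<epsilon> \<le> \<delta>" unfolding \<delta>_def by (rule real_le_rsqrt)
      then show "0 \<le> \<delta>" using \<epsilon> by simp
    qed
    define LA where "LA i = pinned {1..k} K (i ` {1..k0}) (a0 \<circ> inv_into {1..k0} i) (C1 * \<epsilon>)" for i
    define TB where "TB j = pinned {1..<k} 1 (j ` {1..<k0}) (t0 \<circ> inv_into {1..<k0} j) \<eta>" for j
    define LE where "LE i e l = {a \<in> LA i. \<bar>a e - a0 l\<bar> \<le> \<delta>}" for i e and l :: nat
    define TE where "TE j f g = {t \<in> TB j. \<bar>t f - knot k t g\<bar> \<le> \<epsilon>}" for j f and g :: nat
    define X where "X = (1 + 2 * K) ^ kmax * (2 * (C1 * \<epsilon>)) ^ k0"
    define Y where "Y = (1 + 2 * 1) ^ kmax * (2 * \<eta>) ^ (k0 - 1)"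
    have XY: "0 \<le> X" "0 \<le> Y" "0 \<le> C1 * \<epsilon>" unfolding X_def Y_def C1_def using K \<epsilon> \<Delta> \<eta> by auto
    \<comment> \<open>That e and f are unmatched and that g differs from f is what
      \<open>emeasure_pinned_tied_le\<close> requires for the additional factor.\<close>
    define \<R>1 where "\<R>1 = {LE i e l \<times> (TB j \<inter> locations k) | i j e l. i \<in> II \<and> j \<in> JJ \<and> e \<in> {1..k} \<and> l \<in> {1..k0} \<and>
          inj_on i {1..k0} \<and> inj_on j {1..<k0} \<and> e \<notin> i ` {1..k0}}"
    define \<R>2 where "\<R>2 = {LA i \<times> (TE j f g \<inter> locations k) | i j f g. i \<in> II \<and> j \<in> JJ \<and> f \<in> {1..<k} \<and> g \<in> {0..k} \<and>
          inj_on i {1..k0} \<and> inj_on j {1..<k0} \<and> f \<notin> j ` {1..<k0} \<and> g \<noteq> f}"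
    have sub1: "\<R>1 \<subseteq> (\<lambda>(i, j, e, l). LE i e l \<times> (TB j \<inter> locations k)) ` P1"
      unfolding \<R>1_def P1_def by blast
    have sub2: "\<R>2 \<subseteq> (\<lambda>(i, j, f, g). LA i \<times> (TE j f g \<inter> locations k)) ` P2"
      unfolding \<R>2_def P2_def by blast
    have card1: "finite \<R>1" "card \<R>1 \<le> card P1"
      using finite_subset[OF sub1] card_mono[OF _ sub1] fin(1) card_image_le[OF fin(1)] by (blast intro: order_trans)+
    have card2: "finite \<R>2" "card \<R>2 \<le> card P2"
      using finite_subset[OF sub2] card_mono[OF _ sub2] fin(2) card_image_le[OF fin(2)] by (blast intro: order_trans)+
    have R1: "R \<in> sets (prior_k k K \<pi>a \<pi>t) \<and> emeasure (prior_k k K \<pi>a \<pi>t) R \<le> ennreal (C\<^sup>2 * (X * (2 * \<delta>) * Y))"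
      if "R \<in> \<R>1" for R
    proof -
      from that obtain i j e l where R: "R = LE i e l \<times> (TB j \<inter> locations k)" "i \<in> II" "j \<in> JJ" "e \<in> {1..k}"
            "inj_on i {1..k0}" "inj_on j {1..<k0}" "e \<notin> i ` {1..k0}"
        unfolding \<R>1_def by blast
      have i: "i ` {1..k0} \<subseteq> {1..k}" "card (i ` {1..k0}) = k0"
        using R(2) card_image[OF R(5)] unfolding II_def by auto
      have j: "j ` {1..<k0} \<subseteq> {1..<k}" "card (j ` {1..<k0}) = k0 - 1"
        using R(3) card_image[OF R(6)] unfolding JJ_def by auto
      have ei: "e \<in> {1..k} - i ` {1..k0}" using R by blast
      have "card {1..k} \<le> kmax" using k by simp
      note tied = emeasure_pinned_tied_le[OF finite_atLeastAtMost i(1) ei XY(3) less_imp_le[OF K] \<delta>(2) this borel_measurable_const refl,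
          of "a0 \<circ> inv_into {1..k0} i" "a0 l"]
      have LE: "LE i e l \<in> sets (\<Pi>\<^sub>M j\<in>{1..k}. lborel)"
        unfolding LE_def LA_def by (rule tied)
      have LE': "emeasure (\<Pi>\<^sub>M j\<in>{1..k}. lborel) (LE i e l) \<le> ennreal (X * (2 * \<delta>))"
        unfolding LE_def LA_def X_def using tied(2) unfolding i(2) .
      have LE'': "LE i e l \<subseteq> levels k K" unfolding LE_def LA_def pinned_def levels_def by blast
      have TB: "TB j \<in> sets (\<Pi>\<^sub>M j\<in>{1..<k}. lborel)"
        unfolding TB_def using j by (intro sets_pinned) auto
      have TB': "emeasure (\<Pi>\<^sub>M j\<in>{1..<k}. lborel) (TB j) \<le> ennreal Y"
        unfolding TB_def Y_def j(2)[symmetric] using j(1) \<eta> k by (intro emeasure_pinned_le) auto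
      have "0 \<le> X * (2 * \<delta>)" using XY \<delta> by simp
      from prior_k_rectangle_bound[OF pd C LE LE'' LE' TB TB' this XY(2)]
      show ?thesis unfolding R(1) by blast
    qed
    have R2: "R \<in> sets (prior_k k K \<pi>a \<pi>t) \<and> emeasure (prior_k k K \<pi>a \<pi>t) R \<le> ennreal (C\<^sup>2 * (X * (Y * (2 * \<delta>))))"
      if "R \<in> \<R>2" for R
    proof -
      from that obtain i j f g where R: "R = LA i \<times> (TE j f g \<inter> locations k)" "i \<in> II" "j \<in> JJ" "f \<in> {1..<k}" "g \<in> {0..k}"
            "inj_on i {1..k0}" "inj_on j {1..<k0}" "f \<notin> j ` {1..<k0}" "g \<noteq> f"
        unfolding \<R>2_def by blast
      have i: "i ` {1..k0} \<subseteq> {1..k}" "card (i ` {1..k0}) = k0"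
        using R(2) card_image[OF R(6)] unfolding II_def by auto
      have j: "j ` {1..<k0} \<subseteq> {1..<k}" "card (j ` {1..<k0}) = k0 - 1"
        using R(3) card_image[OF R(7)] unfolding JJ_def by auto
      have fj: "f \<in> {1..<k} - j ` {1..<k0}" using R by blast
      have "k \<le> kmax" using k by simp
      then have "card {1..<k} \<le> kmax" by simp
      moreover have "(\<lambda>t. knot k t g) \<in> borel_measurable (\<Pi>\<^sub>M j\<in>{1..<k}. lborel)"
        using R(5) by (intro measurable_knot) simp
      moreover have "knot k (t(f := y)) g = knot k t g" for t y
        using R(9) by (simp add: knot_def)
      ultimately have tied:
        "{t \<in> pinned {1..<k} 1 (j ` {1..<k0}) (t0 \<circ> inv_into {1..<k0} j) \<eta>. \<bar>t f - knot k t g\<bar> \<le> \<epsilon>} \<in> sets (\<Pi>\<^sub>M j\<in>{1..<k}. lborel)"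
        "emeasure (\<Pi>\<^sub>M j\<in>{1..<k}. lborel) {t \<in> pinned {1..<k} 1 (j ` {1..<k0}) (t0 \<circ> inv_into {1..<k0} j) \<eta>. \<bar>t f - knot k t g\<bar> \<le> \<epsilon>}
          \<le> ennreal ((1 + 2 * 1) ^ kmax * (2 * \<eta>) ^ card (j ` {1..<k0}) * (2 * \<epsilon>))"
        using emeasure_pinned_tied_le[OF finite_atLeastLessThan j(1) fj \<eta>(4) zero_le_one less_imp_le[OF \<epsilon>(1)]]
        by blast+
      have TE: "TE j f g \<in> sets (\<Pi>\<^sub>M j\<in>{1..<k}. lborel)"
        unfolding TE_def TB_def by (rule tied)
      have "emeasure (\<Pi>\<^sub>M j\<in>{1..<k}. lborel) (TE j f g) \<le> ennreal (Y * (2 * \<epsilon>))"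
        unfolding TE_def TB_def Y_def using tied(2) unfolding j(2) .
      also have "ennreal (Y * (2 * \<epsilon>)) \<le> ennreal (Y * (2 * \<delta>))"
        using XY \<delta> by (intro ennreal_leI mult_left_mono) auto
      finally have TE': "emeasure (\<Pi>\<^sub>M j\<in>{1..<k}. lborel) (TE j f g) \<le> ennreal (Y * (2 * \<delta>))" .
      have LA: "LA i \<in> sets (\<Pi>\<^sub>M j\<in>{1..k}. lborel)"
        unfolding LA_def using i by (intro sets_pinned) auto
      have LA'': "LA i \<subseteq> levels k K" unfolding LA_def pinned_def levels_def by blast
      have LA': "emeasure (\<Pi>\<^sub>M j\<in>{1..k}. lborel) (LA i) \<le> ennreal X"
      proof -
        have "card {1..k} \<le> kmax" using k by simp
        from emeasure_pinned_le[OF finite_atLeastAtMost i(1) XY(3) less_imp_le[OF K] this]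
        show ?thesis unfolding LA_def X_def i(2) .
      qed
      have "0 \<le> Y * (2 * \<delta>)" using XY \<delta> by simp
      from prior_k_rectangle_bound[OF pd C LA LA'' LA' TE TE' XY(1) this]
      show ?thesis unfolding R(1) by blast
    qed
    have "emeasure (prior_k k K \<pi>a \<pi>t)
        {(a, t). a \<in> levels k K \<and> t \<in> locations k \<and> sqdist (k0, a0, t0) (k, a, t) \<le> \<epsilon>\<^sup>2}
      \<le> ennreal ((card P1 + card P2) * (C\<^sup>2 * (X * Y * (2 * \<delta>))))"
    proof (rule emeasure_covered_le)
      show "finite (\<R>1 \<union> \<R>2)" using card1 card2 by simp
      show "card (\<R>1 \<union> \<R>2) \<le> card P1 + card P2"
        using card_Un_le[of \<R>1 \<R>2] card1 card2 by linarith
      show "0 \<le> C\<^sup>2 * (X * Y * (2 * \<delta>))" using XY \<delta> by simp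
      show "\<R>1 \<union> \<R>2 \<subseteq> sets (prior_k k K \<pi>a \<pi>t)" using R1 R2 by blast
      have "X * (2 * \<delta>) * Y = X * Y * (2 * \<delta>)" "X * (Y * (2 * \<delta>)) = X * Y * (2 * \<delta>)" by (simp_all add: mult_ac)
      then show "emeasure (prior_k k K \<pi>a \<pi>t) R \<le> ennreal (C\<^sup>2 * (X * Y * (2 * \<delta>)))" if "R \<in> \<R>1 \<union> \<R>2" for R
        using R1[of R] R2[of R] that by (metis Un_iff)
      show "{(a, t). a \<in> levels k K \<and> t \<in> locations k \<and> sqdist (k0, a0, t0) (k, a, t) \<le> \<epsilon>\<^sup>2} \<subseteq> \<Union>(\<R>1 \<union> \<R>2)"
      proof (rule subsetI, clarify)
        fix a t assume at: "a \<in> levels k K" "t \<in> locations k" and sq: "sqdist (k0, a0, t0) (k, a, t) \<le> \<epsilon>\<^sup>2"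
        have \<theta>: "(k, a, t) \<in> Theta kmax K" using at k by (simp add: Theta_def)
        obtain i j where i: "inj_on i {1..k0}" "i \<in> {1..k0} \<rightarrow> {1..k}"
            "\<forall>l\<in>{1..k0}. \<bar>a (i l) - a0 l\<bar> \<le> C1 * \<epsilon>"
          and j: "inj_on j {1..<k0}" "j \<in> {1..<k0} \<rightarrow> {1..<k}"
            "\<forall>l\<in>{1..<k0}. \<bar>t (j l) - t0 l\<bar> \<le> \<eta>"
          and extra: "(\<exists>e\<in>{1..k} - i ` {1..k0}. \<exists>l\<in>{1..k0}. \<bar>a e - a0 l\<bar> \<le> \<delta>) \<or>
             (\<exists>f\<in>{1..<k} - j ` {1..<k0}. \<exists>g\<in>{0..k} - {f}. \<bar>t f - knot k t g\<bar> \<le> \<epsilon>)"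
          unfolding C1_def \<delta>_def
          by (rule close_parameter_structure[OF \<theta>0 K \<Delta> J sep jump \<theta> sq \<epsilon>(1) \<eta>(1-3) k(2)])
        let ?i = "restrict i {1..k0}" and ?j = "restrict j {1..<k0}"
        have A: "a \<in> LA ?i" unfolding LA_def
          using at i by (intro pinned_by_injection) (auto simp: levels_def)
        have B: "t \<in> TB ?j" unfolding TB_def
          using locations_bounded[OF at(2)] k j by (intro pinned_by_injection) auto
        have im: "?i ` {1..k0} = i ` {1..k0}" "?j ` {1..<k0} = j ` {1..<k0}" by auto
        have inj: "inj_on ?i {1..k0}" "inj_on ?j {1..<k0}" using i j by (auto simp: inj_on_restrict_eq)
        have mem: "?i \<in> II" "?j \<in> JJ" using i(2) j(2) by (auto simp: II_def JJ_def)
        from extra show "(a, t) \<in> \<Union>(\<R>1 \<union> \<R>2)"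
        proof (elim disjE bexE)
          fix e l assume e: "e \<in> {1..k} - i ` {1..k0}" and l: "l \<in> {1..k0}" and le: "\<bar>a e - a0 l\<bar> \<le> \<delta>"
          have "(a, t) \<in> LE ?i e l \<times> (TB ?j \<inter> locations k)" using A B at le by (simp add: LE_def)
          moreover have "LE ?i e l \<times> (TB ?j \<inter> locations k) \<in> \<R>1"
            unfolding \<R>1_def using e l mem inj im(1) by blast
          ultimately show ?thesis by blast
        next
          fix f g assume f: "f \<in> {1..<k} - j ` {1..<k0}" and g: "g \<in> {0..k} - {f}" and le: "\<bar>t f - knot k t g\<bar> \<le> \<epsilon>"
          have "(a, t) \<in> LA ?i \<times> (TE ?j f g \<inter> locations k)" using A B at le by (simp add: TE_def)
          moreover have "LA ?i \<times> (TE ?j f g \<inter> locations k) \<in> \<R>2"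
            unfolding \<R>2_def using f g mem inj im(2) by blast
          ultimately show ?thesis by blast
        qed
      qed
    qed
    also have "(card P1 + card P2) * (C\<^sup>2 * (X * Y * (2 * \<delta>))) = M * (\<epsilon> ^ (3 * k0 - 2) * sqrt \<epsilon>)"
    proof -
      have "3 * k0 - 2 = k0 + 2 * (k0 - 1)" using k0 by simp
      then have "\<epsilon> ^ (3 * k0 - 2) = \<epsilon> ^ k0 * (\<epsilon>\<^sup>2) ^ (k0 - 1)" by (simp add: power_add power_mult)
      moreover have "(2 * \<eta>) ^ (k0 - 1) = (10 / J\<^sup>2) ^ (k0 - 1) * (\<epsilon>\<^sup>2) ^ (k0 - 1)"
        unfolding power_mult_distrib[symmetric] \<eta>_def by simp
      moreover have "(2 * (C1 * \<epsilon>)) ^ k0 = (2 * C1) ^ k0 * \<epsilon> ^ k0"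
        by (simp add: power_mult_distrib)
      ultimately show ?thesis unfolding M_def X_def Y_def \<delta>_def real_sqrt_mult by (simp add: mult_ac)
    qed
    finally show ?case .
  qed
  then show ?thesis using \<open>M \<ge> 0\<close> by blast
qed

section \<open>Prior mass of neighbourhoods of the truth\<close>

definition nbhd :: "nat \<Rightarrow> (nat \<Rightarrow> real) \<Rightarrow> (nat \<Rightarrow> real) \<Rightarrow> real \<Rightarrow> real \<Rightarrow> ((nat \<Rightarrow> real) \<times> (nat \<Rightarrow> real)) set" where
  "nbhd k0 a0 t0 K r = {a \<in> levels k0 K. \<forall>j\<in>{1..k0}. \<bar>a j - a0 j\<bar> \<le> r} \<times>
     {t \<in> locations k0. \<forall>j\<in>{1..<k0}. \<bar>t j - t0 j\<bar> \<le> r\<^sup>2}"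

text \<open>A true level may lie on the boundary of [-K,K], so only the half of the window that
  points towards 0 is counted; it stays in range because r <= K.\<close>

lemma emeasure_levels_near:
  assumes a0: "a0 \<in> levels k0 K" and r: "0 < r" "r \<le> K"
  shows "{a \<in> levels k0 K. \<forall>j\<in>{1..k0}. \<bar>a j - a0 j\<bar> \<le> r} \<in> sets (level_measure k0 K)"
    and "ennreal (r ^ k0) \<le> emeasure (level_measure k0 K) {a \<in> levels k0 K. \<forall>j\<in>{1..k0}. \<bar>a j - a0 j\<bar> \<le> r}"
proof -
  interpret product_sigma_finite "\<lambda>_::nat. lborel :: real measure" ..
  let ?A = "{a \<in> levels k0 K. \<forall>j\<in>{1..k0}. \<bar>a j - a0 j\<bar> \<le> r}"
  let ?B = "\<lambda>j. {-K..K} \<inter> {a0 j - r..a0 j + r}"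
  have A: "?A = pinned {1..k0} K {1..k0} a0 r" by (simp add: pinned_def levels_def)
  have As: "?A \<in> sets (\<Pi>\<^sub>M j\<in>{1..k0}. lborel)" unfolding A by (rule sets_pinned) auto
  have Al: "?A \<subseteq> levels k0 K" by blast
  show "?A \<in> sets (level_measure k0 K)" by (rule emeasure_level_measure(1)[OF As Al])
  have "?A = Pi\<^sub>E {1..k0} ?B"
    unfolding A pinned_eq_PiE[OF order_refl] by (intro PiE_cong) simp
  then have "emeasure (level_measure k0 K) ?A = (\<Prod>j\<in>{1..k0}. emeasure lborel (?B j))"
    unfolding emeasure_level_measure(2)[OF As Al] by (simp only:) (intro emeasure_PiM, auto)
  moreover have "(\<Prod>j\<in>{1..k0}. ennreal r) \<le> (\<Prod>j\<in>{1..k0}. emeasure lborel (?B j))"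
  proof (rule prod_mono_ennreal)
    fix j assume "j \<in> {1..k0}"
    then have aj: "-K \<le> a0 j" "a0 j \<le> K" using a0 unfolding levels_def by auto
    show "ennreal r \<le> emeasure lborel (?B j)"
    proof (cases "0 \<le> a0 j")
      case True
      then have "emeasure lborel {a0 j - r..a0 j} \<le> emeasure lborel (?B j)"
        using aj r by (intro emeasure_mono) auto
      then show ?thesis using r by simp
    next
      case False
      then have "emeasure lborel {a0 j..a0 j + r} \<le> emeasure lborel (?B j)"
        using aj r by (intro emeasure_mono) auto
      then show ?thesis using r by simp
    qed
  qed
  ultimately show "ennreal (r ^ k0) \<le> emeasure (level_measure k0 K) ?A"
    using r by (simp add: ennreal_power)
qed

text \<open>Moving every inner knot by at most s < \<Delta> / 2 preserves the order, so the set is a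
  full cube.\<close>

lemma emeasure_locations_near:
  assumes t0: "t0 \<in> locations k0" "1 \<le> k0" and \<Delta>: "2 * s < \<Delta>" and s: "0 \<le> s"
    and sep: "\<And>l. l \<in> {1..k0} \<Longrightarrow> \<Delta> \<le> knot k0 t0 l - knot k0 t0 (l - 1)"
  shows "{t \<in> locations k0. \<forall>j\<in>{1..<k0}. \<bar>t j - t0 j\<bar> \<le> s} \<in> sets (location_measure k0)"
    and "emeasure (location_measure k0) {t \<in> locations k0. \<forall>j\<in>{1..<k0}. \<bar>t j - t0 j\<bar> \<le> s} = ennreal ((2 * s) ^ (k0 - 1))"
proof -
  interpret product_sigma_finite "\<lambda>_::nat. lborel :: real measure" ..
  let ?A = "{t \<in> locations k0. \<forall>j\<in>{1..<k0}. \<bar>t j - t0 j\<bar> \<le> s}"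
  let ?B = "\<lambda>j. {t0 j - s..t0 j + s}"
  have A: "?A = Pi\<^sub>E {1..<k0} ?B"
  proof (intro set_eqI iffI)
    fix t assume "t \<in> ?A"
    then have "t \<in> extensional {1..<k0}" "\<forall>j\<in>{1..<k0}. t j \<in> ?B j"
      by (auto simp: locations_def abs_le_iff algebra_simps)
    then show "t \<in> Pi\<^sub>E {1..<k0} ?B" by (simp only: PiE_iff simp_thms)
  next
    fix t assume t: "t \<in> Pi\<^sub>E {1..<k0} ?B"
    have near: "\<bar>t j - t0 j\<bar> \<le> s" if "j \<in> {1..<k0}" for j
      using PiE_mem[OF t that] by (simp add: abs_le_iff)
    have near': "\<bar>knot k0 t j - knot k0 t0 j\<bar> \<le> s" if "j \<le> k0" for j
      using near[of j] that s by (auto simp: knot_def)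
    have "knot k0 t (j - 1) < knot k0 t j" if "j \<in> {1..k0}" for j
    proof -
      have "j - 1 \<le> k0" "j \<le> k0" using that by auto
      then show ?thesis using near'[of j] near'[of "j - 1"] sep[OF that] \<Delta> by linarith
    qed
    then show "t \<in> ?A" using near t by (auto simp: locations_def PiE_iff)
  qed
  have As: "?A \<in> sets (\<Pi>\<^sub>M j\<in>{1..<k0}. lborel)" unfolding A by (intro sets_PiM_I_finite) auto
  have Al: "?A \<subseteq> locations k0" by blast
  show "?A \<in> sets (location_measure k0)" by (rule emeasure_location_measure(1)[OF As Al])
  have "emeasure (location_measure k0) ?A = (\<Prod>j\<in>{1..<k0}. emeasure lborel (?B j))"
    unfolding emeasure_location_measure(2)[OF As Al] unfolding A by (intro emeasure_PiM) auto
  also have "\<dots> = (\<Prod>j\<in>{1..<k0}. ennreal (2 * s))" using s by simp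
  also have "\<dots> = ennreal ((2 * s) ^ (k0 - 1))" using s by (simp only: prod_constant card_atLeastLessThan) (intro ennreal_power, simp)
  finally show "emeasure (location_measure k0) ?A = ennreal ((2 * s) ^ (k0 - 1))" .
qed

text \<open>The count of exponents is that of \<open>prior_k_close_le\<close> without the additional
  coordinate: r^k0 from the levels and (2 r^2)^(k0 - 1) from the change-points.\<close>

lemma prior_k_nbhd_ge:
  fixes K \<Delta> :: real
  assumes \<theta>0: "(k0, a0, t0) \<in> Theta kmax K" and K: "0 < K" and \<Delta>: "0 < \<Delta>"
    and sep: "\<And>l. l \<in> {1..k0} \<Longrightarrow> \<Delta> \<le> knot k0 t0 l - knot k0 t0 (l - 1)"
    and pd: "prior_densities k0 K \<pi>a \<pi>t" and ba: "bounded_away k0 K \<pi>a \<pi>t"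
  shows "\<exists>c>0. \<forall>\<^sub>F r in at_right 0. nbhd k0 a0 t0 K r \<in> sets (prior_k k0 K \<pi>a \<pi>t) \<and>
    ennreal (c * r ^ (3 * k0 - 2)) \<le> emeasure (prior_k k0 K \<pi>a \<pi>t) (nbhd k0 a0 t0 K r)"
proof -
  have k0: "1 \<le> k0" and t0: "t0 \<in> locations k0" and a0: "a0 \<in> levels k0 K" using \<theta>0 by (auto simp: Theta_def)
  obtain c where c: "0 < c" "\<And>a t. a \<in> levels k0 K \<Longrightarrow> t \<in> locations k0 \<Longrightarrow> c \<le> \<pi>a a t \<and> c \<le> \<pi>t t"
    using ba unfolding bounded_away_def by blast
  have "((\<lambda>r. 2 * r\<^sup>2) \<longlongrightarrow> 2 * 0\<^sup>2) (at_right (0::real))"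
    by (intro tendsto_intros)
  then have ev1: "\<forall>\<^sub>F r in at_right 0. 2 * r\<^sup>2 < \<Delta>"
    using \<Delta> by (intro order_tendstoD(2)[where y=0]) auto
  have ev2: "\<forall>\<^sub>F r in at_right 0. r \<in> {0<..<K}" using K by (rule eventually_at_right_real)
  have "\<forall>\<^sub>F r in at_right 0. nbhd k0 a0 t0 K r \<in> sets (prior_k k0 K \<pi>a \<pi>t) \<and>
    ennreal (c\<^sup>2 * 2 ^ (k0 - 1) * r ^ (3 * k0 - 2)) \<le> emeasure (prior_k k0 K \<pi>a \<pi>t) (nbhd k0 a0 t0 K r)"
    using ev1 ev2
  proof eventually_elim
    case (elim r)
    then have r: "0 < r" "r \<le> K" "2 * r\<^sup>2 < \<Delta>" by auto
    note A = emeasure_levels_near[OF a0 r(1,2)]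
    have B: "{t \<in> locations k0. \<forall>j\<in>{1..<k0}. \<bar>t j - t0 j\<bar> \<le> r\<^sup>2} \<in> sets (location_measure k0)"
      "emeasure (location_measure k0) {t \<in> locations k0. \<forall>j\<in>{1..<k0}. \<bar>t j - t0 j\<bar> \<le> r\<^sup>2} = ennreal ((2 * r\<^sup>2) ^ (k0 - 1))"
      by (rule emeasure_locations_near[OF t0 k0 r(3) zero_le_power2 sep], assumption)+
    have "ennreal (c\<^sup>2) * (ennreal (r ^ k0) * ennreal ((2 * r\<^sup>2) ^ (k0 - 1)))
       \<le> ennreal (c\<^sup>2) * (emeasure (level_measure k0 K) {a \<in> levels k0 K. \<forall>j\<in>{1..k0}. \<bar>a j - a0 j\<bar> \<le> r} *
          emeasure (location_measure k0) {t \<in> locations k0. \<forall>j\<in>{1..<k0}. \<bar>t j - t0 j\<bar> \<le> r\<^sup>2})"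
      unfolding B(2) by (intro mult_left_mono mult_right_mono A(2)) auto
    also have "\<dots> \<le> emeasure (prior_k k0 K \<pi>a \<pi>t) (nbhd k0 a0 t0 K r)"
      unfolding nbhd_def by (rule emeasure_prior_k_rectangle_ge[OF pd A(1) B(1) less_imp_le[OF c(1)] c(2)])
    also have "ennreal (c\<^sup>2) * (ennreal (r ^ k0) * ennreal ((2 * r\<^sup>2) ^ (k0 - 1))) = ennreal (c\<^sup>2 * 2 ^ (k0 - 1) * r ^ (3 * k0 - 2))"
    proof -
      have "3 * k0 - 2 = k0 + 2 * (k0 - 1)" using k0 by simp
      then have "r ^ (3 * k0 - 2) = r ^ k0 * (r\<^sup>2) ^ (k0 - 1)" by (simp add: power_add power_mult)
      then have "c\<^sup>2 * 2 ^ (k0 - 1) * r ^ (3 * k0 - 2) = c\<^sup>2 * (r ^ k0 * (2 * r\<^sup>2) ^ (k0 - 1))"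
        by (simp add: power_mult_distrib mult_ac)
      then show ?thesis using r(1) by (subst ennreal_mult[symmetric], simp, simp)+ (simp only:)
    qed
    finally show ?case
      using A(1) B(1) unfolding nbhd_def by (auto simp: prior_k_def)
  qed
  moreover have "0 < c\<^sup>2 * 2 ^ (k0 - 1)" using c by simp
  ultimately show ?thesis by blast
qed

lemma measure_unif_Icc_le:
  assumes "a \<le> b"
  shows "measure unif {a..b} \<le> b - a"
proof -
  have "measure unif {a..b} = measure lborel ({0..<1} \<inter> {a..b})" by (simp add: measure_uniform_measure)
  also have "\<dots> \<le> measure lborel {a..b}" by (intro measure_mono_fmeasurable) (auto simp: fmeasurable_def emeasure_lborel_Icc_eq)
  finally show ?thesis using assms by simp
qed

text \<open>Off the windows of radius r^2 around the true change-points both functions are on the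
  segment of the same index, so the gap is at most r. On the k0 - 1 windows, of mass at most 2 r^2
  each, it is at most 2 K. This balance is the reason for the two scales in
  \<open>nbhd\<close>.\<close>

lemma sqdist_nbhd_le:
  assumes \<theta>0: "(k0, a0, t0) \<in> Theta kmax K" and K: "0 < K" and at: "(a, t) \<in> nbhd k0 a0 t0 K r"
  shows "sqdist (k0, a0, t0) (k0, a, t) \<le> (1 + 8 * K\<^sup>2 * k0) * r\<^sup>2"
proof -
  interpret U: prob_space unif by (rule prob_space_unif)
  have k0: "1 \<le> k0" "k0 \<le> kmax" and t0: "t0 \<in> locations k0" using \<theta>0 by (auto simp: Theta_def)
  have near_a: "\<And>j. j \<in> {1..k0} \<Longrightarrow> \<bar>a j - a0 j\<bar> \<le> r" and near_t: "\<And>j. j \<in> {1..<k0} \<Longrightarrow> \<bar>t j - t0 j\<bar> \<le> r\<^sup>2"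
    and t: "t \<in> locations k0" and a: "a \<in> levels k0 K"
    using at unfolding nbhd_def by blast+
  have \<theta>: "(k0, a, t) \<in> Theta kmax K" using t a k0 by (simp add: Theta_def)
  let ?v = "gap (k0, a0, t0) (k0, a, t)"
  let ?I = "\<lambda>j. {t0 j - r\<^sup>2..t0 j + r\<^sup>2}"
  have gap: "\<bar>?v x\<bar> \<le> 2 * K" for x using abs_gap_le[OF \<theta>0 \<theta>] K by simp
  have le: "(?v x)\<^sup>2 \<le> r\<^sup>2 + (\<Sum>j\<in>{1..<k0}. 4 * K\<^sup>2 * indicator (?I j) x)" for x
  proof (cases "\<exists>j\<in>{1..<k0}. x \<in> ?I j")
    case True
    then obtain j where j: "j \<in> {1..<k0}" "x \<in> ?I j" by blast
    have "(?v x)\<^sup>2 \<le> 4 * K\<^sup>2 * indicator (?I j) x"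
      using power_mono[OF gap abs_ge_zero, of x 2] j by (simp add: power_mult_distrib)
    also have "\<dots> \<le> (\<Sum>j\<in>{1..<k0}. 4 * K\<^sup>2 * indicator (?I j) x)"
      using j(1) by (intro member_le_sum) auto
    finally show ?thesis by (simp add: add_increasing)
  next
    case False
    have "(?v x)\<^sup>2 \<le> r\<^sup>2"
    proof (cases "0 \<le> x \<and> x < 1")
      case x: True
      then obtain l where l: "l \<in> {1..k0}" "knot k0 t0 (l - 1) \<le> x" "x < knot k0 t0 l"
        using segment_exists[OF k0(1)] by blast
      have "knot k0 t (l - 1) \<le> x"
      proof (cases "l = 1")
        case True
        then show ?thesis using x by simp
      next
        case l1: False
        then have m: "l - 1 \<in> {1..<k0}" using l(1) by auto
        then have "knot k0 t (l - 1) = t (l - 1)" "knot k0 t0 (l - 1) = t0 (l - 1)" by (auto simp: knot_def)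
        moreover have "x \<notin> ?I (l - 1)" using False m by blast
        ultimately show ?thesis using near_t[OF m] l(2) by (simp add: abs_le_iff)
      qed
      moreover have "x < knot k0 t l"
      proof (cases "l = k0")
        case True
        then show ?thesis using x k0 by simp
      next
        case lk: False
        then have m: "l \<in> {1..<k0}" using l(1) by auto
        then have "knot k0 t l = t l" "knot k0 t0 l = t0 l" by (auto simp: knot_def)
        moreover have "x \<notin> ?I l" using False m by blast
        ultimately show ?thesis using near_t[OF m] l(3) by (simp add: abs_le_iff)
      qed
      ultimately have "?v x = a l - a0 l"
        unfolding gap_def step_fun_segment[OF t0 l] by (subst step_fun_segment[OF t l(1)]) auto
      then show ?thesis using power_mono[OF near_a[OF l(1)] abs_ge_zero, of 2] by simp
    next
      case False
      then have "?v x = 0" unfolding gap_def using t t0 k0 by (simp add: step_fun_outside not_le not_less)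
      then show ?thesis by simp
    qed
    then show ?thesis by (simp add: sum_nonneg add_increasing2)
  qed
  have int_ind: "integrable unif (indicator (?I j) :: real \<Rightarrow> real)" for j
    by (rule U.integrable_const_bound[of _ 1]) (auto simp: indicator_def)
  have "sqdist (k0, a0, t0) (k0, a, t) \<le> (LINT x|unif. r\<^sup>2 + (\<Sum>j\<in>{1..<k0}. 4 * K\<^sup>2 * indicator (?I j) x))"
    unfolding sqdist_def
    by (intro integral_mono le integrable_gap_square[OF gap] Bochner_Integration.integrable_add
        Bochner_Integration.integrable_sum integrable_mult_right int_ind) simp
  also have "\<dots> = r\<^sup>2 + (\<Sum>j\<in>{1..<k0}. 4 * K\<^sup>2 * measure unif (?I j))"
  proof -
    have ind: "integrable unif (\<lambda>x. 4 * K\<^sup>2 * indicator (?I j) x)" for j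
      by (intro integrable_mult_right int_ind)
    have "(LINT x|unif. (\<Sum>j\<in>{1..<k0}. 4 * K\<^sup>2 * indicator (?I j) x)) = (\<Sum>j\<in>{1..<k0}. (LINT x|unif. 4 * K\<^sup>2 * indicator (?I j) x))"
      by (rule Bochner_Integration.integral_sum) (rule ind)
    also have "\<dots> = (\<Sum>j\<in>{1..<k0}. 4 * K\<^sup>2 * measure unif (?I j))"
      by (simp only: integral_mult_right_zero Bochner_Integration.integral_indicator space_uniform_measure space_lborel space_borel Int_UNIV_right)
    finally show ?thesis
      using Bochner_Integration.integrable_sum[of "{1..<k0}" unif "\<lambda>j x. 4 * K\<^sup>2 * indicator (?I j) x", OF ind]
      by (subst Bochner_Integration.integral_add) (simp_all add: U.prob_space[simplified] del: One_nat_def)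
  qed
  also have "\<dots> \<le> r\<^sup>2 + (\<Sum>j\<in>{1..<k0}. 4 * K\<^sup>2 * (2 * r\<^sup>2))"
    using measure_unif_Icc_le[of "t0 j - r\<^sup>2" "t0 j + r\<^sup>2" for j]
    by (intro add_left_mono sum_mono mult_left_mono) (auto simp: algebra_simps)
  also have "\<dots> = r\<^sup>2 + real (k0 - 1) * (8 * K\<^sup>2 * r\<^sup>2)" by simp
  also have "\<dots> \<le> r\<^sup>2 + real k0 * (8 * K\<^sup>2 * r\<^sup>2)" by (intro add_left_mono mult_right_mono) auto
  also have "\<dots> = (1 + 8 * K\<^sup>2 * k0) * r\<^sup>2" by (simp add: algebra_simps)
  finally show ?thesis .
qed

section \<open>Measurability in the parameter\<close>

text \<open>\<open>Theta_sets\<close> is defined by sections, so measurability can be tested for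
  each k separately.\<close>

lemma measurable_prior_iff:
  "g \<in> borel_measurable (prior kmax K p \<pi>a \<pi>t) \<longleftrightarrow>
   (\<forall>k\<in>{1..kmax}. (\<lambda>(a, t). g (k, a, t)) \<in> borel_measurable (level_measure k K \<Otimes>\<^sub>M location_measure k))"
  for g :: "param \<Rightarrow> real"
proof -
  have sec: "Pair k -` (g -` S \<inter> Theta kmax K) =
     (\<lambda>(a, t). g (k, a, t)) -` S \<inter> space (level_measure k K \<Otimes>\<^sub>M location_measure k)"
    if "k \<in> {1..kmax}" for k S
    unfolding sections_Theta[OF that, symmetric] by auto
  have "g -` S \<inter> Theta kmax K \<in> Theta_sets kmax K \<longleftrightarrow>
    (\<forall>k\<in>{1..kmax}. (\<lambda>(a, t). g (k, a, t)) -` S \<inter> space (level_measure k K \<Otimes>\<^sub>M location_measure k)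
       \<in> sets (level_measure k K \<Otimes>\<^sub>M location_measure k))" for S
    unfolding Theta_sets_def using sec[of _ S] by simp
  then show ?thesis
    unfolding measurable_def space_prior sets_prior by auto
qed

lemma measurable_level_coordinate:
  assumes "j \<in> {1..k}"
  shows "(\<lambda>(a, t). a j) \<in> borel_measurable (level_measure k K \<Otimes>\<^sub>M location_measure k)"
proof -
  have "(\<lambda>a. a j) \<in> borel_measurable (level_measure k K)"
    unfolding level_measure_def using measurable_component_singleton[OF assms, of "\<lambda>_. lborel"]
    by (intro measurable_restrict_space1) simp
  from measurable_compose[OF measurable_fst this] show ?thesis by (simp add: case_prod_beta')
qed

lemma measurable_location_knot:
  assumes "j \<le> k"
  shows "(\<lambda>(a, t). knot k t j) \<in> borel_measurable (level_measure k K \<Otimes>\<^sub>M location_measure k)"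
proof -
  have "(\<lambda>t. knot k t j) \<in> borel_measurable (location_measure k)"
    unfolding location_measure_def by (intro measurable_restrict_space1 measurable_knot assms)
  from measurable_compose[OF measurable_snd this] show ?thesis by (simp add: case_prod_beta')
qed

text \<open>The number of summands in \<open>step_fun\<close> depends on the parameter. The
  functions A and L extend the coordinates by 0 to the parameters with another k, so that one fixed
  double sum over k and j represents \<open>step_fun\<close> on \<open>Theta\<close>.\<close>

lemma step_fun_jointly_measurable:
  "(\<lambda>(\<theta>, x). step_fun \<theta> x) \<in> borel_measurable (prior kmax K p \<pi>a \<pi>t \<Otimes>\<^sub>M borel)"
proof -
  let ?Q = "prior kmax K p \<pi>a \<pi>t"
  define A where "A k j \<theta> = (if fst \<theta> = k then fst (snd \<theta>) j else 0)" for k j :: nat and \<theta> :: param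
  define L where "L k j \<theta> = (if fst \<theta> = k then knot k (snd (snd \<theta>)) j else 0)" for k j :: nat and \<theta> :: param
  have A: "A k j \<in> borel_measurable ?Q" if "j \<in> {1..k}" for k j
    unfolding measurable_prior_iff
  proof
    fix k' show "(\<lambda>(a, t). A k j (k', a, t)) \<in> borel_measurable (level_measure k' K \<Otimes>\<^sub>M location_measure k')"
      using measurable_level_coordinate[OF that] by (cases "k' = k") (simp_all add: A_def)
  qed
  have L: "L k j \<in> borel_measurable ?Q" if "j \<le> k" for k j
    unfolding measurable_prior_iff
  proof
    fix k' show "(\<lambda>(a, t). L k j (k', a, t)) \<in> borel_measurable (level_measure k' K \<Otimes>\<^sub>M location_measure k')"
      using measurable_location_knot[OF that] by (cases "k' = k") (simp_all add: L_def)
  qed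
  define G where "G k j z = A k j (fst z) * (if L k (j - 1) (fst z) \<le> snd z \<and> snd z < L k j (fst z) then 1 else 0)" for k j z
  have G: "G k j \<in> borel_measurable (?Q \<Otimes>\<^sub>M borel)" if "j \<in> {1..k}" for k j
  proof -
    have "j \<le> k" "j - 1 \<le> k" using that by auto
    note [measurable] = A[OF that] L[OF this(1)] L[OF this(2)]
    show ?thesis unfolding G_def by measurable
  qed
  have eq: "step_fun \<theta> x = (\<Sum>k=1..kmax. \<Sum>j=1..k. G k j (\<theta>, x))" if "\<theta> \<in> Theta kmax K" for \<theta> x
  proof -
    obtain k a t where "\<theta> = (k, a, t)" by (rule prod_cases3)
    with that have \<theta>: "\<theta> = (k, a, t)" "k \<in> {1..kmax}" by (simp_all add: Theta_def)
    have "(\<Sum>k'=1..kmax. \<Sum>j=1..k'. G k' j (\<theta>, x)) = (\<Sum>k'=1..kmax. if k' = k then (\<Sum>j=1..k. G k j (\<theta>, x)) else 0)"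
      by (rule sum.cong) (auto simp: G_def A_def \<theta>(1))
    also have "\<dots> = (\<Sum>j=1..k. G k j (\<theta>, x))" using \<theta>(2) by simp
    also have "\<dots> = step_fun \<theta> x"
      unfolding step_fun_def \<theta>(1) split by (intro sum.cong refl) (simp add: G_def A_def L_def indicator_def)
    finally show ?thesis by simp
  qed
  have "(\<lambda>z. \<Sum>k=1..kmax. \<Sum>j=1..k. G k j z) \<in> borel_measurable (?Q \<Otimes>\<^sub>M borel)"
    by (intro borel_measurable_sum G)
  then show ?thesis
    by (subst measurable_cong[where g="\<lambda>z. \<Sum>k=1..kmax. \<Sum>j=1..k. G k j z"])
       (auto simp: space_pair_measure space_prior eq)
qed

lemma measurable_step_fun_compose [measurable (raw)]:
  assumes "f \<in> M \<rightarrow>\<^sub>M prior kmax K p \<pi>a \<pi>t" "g \<in> borel_measurable M"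
  shows "(\<lambda>w. step_fun (f w) (g w)) \<in> borel_measurable M"
  using measurable_compose[OF measurable_Pair[OF assms] step_fun_jointly_measurable] by simp

lemma sample_component_measurable:
  assumes "i \<in> {1..n}" "g \<in> M \<rightarrow>\<^sub>M (\<Pi>\<^sub>M i\<in>{1..n}. borel \<Otimes>\<^sub>M borel)"
  shows "(\<lambda>w. g w i) \<in> M \<rightarrow>\<^sub>M borel \<Otimes>\<^sub>M borel"
  using measurable_compose[OF assms(2) measurable_component_singleton[OF assms(1)]] .

lemma measurable_log_ratio_compose:
  assumes [measurable]: "f \<in> M \<rightarrow>\<^sub>M prior kmax K p \<pi>a \<pi>t" and g: "g \<in> M \<rightarrow>\<^sub>M (\<Pi>\<^sub>M i\<in>{1..n}. borel \<Otimes>\<^sub>M borel)"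
  shows "(\<lambda>w. log_ratio \<theta>0 n (f w) (g w)) \<in> borel_measurable M"
  unfolding log_ratio_def
proof (rule borel_measurable_sum)
  fix i assume "i \<in> {1..n}"
  note [measurable] = sample_component_measurable[OF this g]
  show "(\<lambda>w. gap \<theta>0 (f w) (fst (g w i)) * noise \<theta>0 (g w i) - (gap \<theta>0 (f w) (fst (g w i)))\<^sup>2 / 2) \<in> borel_measurable M"
    unfolding gap_def by measurable
qed

lemma measurable_likelihood_compose:
  assumes [measurable]: "f \<in> M \<rightarrow>\<^sub>M prior kmax K p \<pi>a \<pi>t" and g: "g \<in> M \<rightarrow>\<^sub>M (\<Pi>\<^sub>M i\<in>{1..n}. borel \<Otimes>\<^sub>M borel)"
  shows "(\<lambda>w. \<Prod>i=1..n. obs_density (f w) (g w i)) \<in> borel_measurable M"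
proof (rule borel_measurable_prod)
  fix i assume "i \<in> {1..n}"
  note [measurable] = sample_component_measurable[OF this g]
  show "(\<lambda>w. obs_density (f w) (g w i)) \<in> borel_measurable M"
    unfolding obs_density_def case_prod_beta by measurable
qed

lemma measurable_sqdist [measurable]: "sqdist \<theta>0 \<in> borel_measurable (prior kmax K p \<pi>a \<pi>t)"
proof -
  interpret U: prob_space unif by (rule prob_space_unif)
  have "(\<lambda>(\<theta>, x). (gap \<theta>0 \<theta> x)\<^sup>2) \<in> borel_measurable (prior kmax K p \<pi>a \<pi>t \<Otimes>\<^sub>M unif)"
    unfolding gap_def by measurable
  then show ?thesis unfolding sqdist_def by (rule U.borel_measurable_lebesgue_integral)
qed

lemma sets_prior_Collect:
  assumes "Measurable.pred (prior kmax K p \<pi>a \<pi>t) P"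
  shows "{\<theta> \<in> Theta kmax K. P \<theta>} \<in> sets (prior kmax K p \<pi>a \<pi>t)"
  using assms unfolding pred_def space_prior by simp

lemma measurable_number_of_segments [measurable]:
  "fst \<in> prior kmax K p \<pi>a \<pi>t \<rightarrow>\<^sub>M count_space UNIV"
proof -
  have "(\<lambda>\<theta>. real (fst \<theta>)) \<in> borel_measurable (prior kmax K p \<pi>a \<pi>t)"
    unfolding measurable_prior_iff by (simp add: case_prod_beta)
  then have "{\<theta> \<in> space (prior kmax K p \<pi>a \<pi>t). real (fst \<theta>) = real k} \<in> sets (prior kmax K p \<pi>a \<pi>t)" for k
    by measurable
  then show ?thesis by (intro measurable_count_space_eq2_countable[THEN iffD2]) (auto simp: vimage_def Int_def conj_commute)
qed

lemma measurable_posterior: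
  assumes Q: "prob_space (prior kmax K p \<pi>a \<pi>t)" and A: "A \<in> sets (prior kmax K p \<pi>a \<pi>t)"
  shows "(\<lambda>z. posterior (prior kmax K p \<pi>a \<pi>t) n z A) \<in> borel_measurable (sample_law \<theta>0 n)"
proof -
  interpret Q: prob_space "prior kmax K p \<pi>a \<pi>t" by (rule Q)
  note [measurable] = A
  have L: "(\<lambda>w. \<Prod>i=1..n. obs_density (snd w) (fst w i)) \<in> borel_measurable (sample_law \<theta>0 n \<Otimes>\<^sub>M prior kmax K p \<pi>a \<pi>t)"
    by (rule measurable_likelihood_compose) measurable
  have L': "(\<lambda>w. indicator A (snd w) *\<^sub>R (\<Prod>i=1..n. obs_density (snd w) (fst w i))) \<in> borel_measurable (sample_law \<theta>0 n \<Otimes>\<^sub>M prior kmax K p \<pi>a \<pi>t)"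
    by (rule borel_measurable_scaleR[OF _ L]) measurable
  show ?thesis
    unfolding posterior_def set_lebesgue_integral_def
    using L L' by (intro borel_measurable_divide Q.borel_measurable_lebesgue_integral) (simp_all only: case_prod_beta')
qed

section \<open>Posterior probabilities\<close>

lemma (in prob_space) prob_ge_le_nn_integral:
  assumes [measurable]: "f \<in> borel_measurable M" and le: "(\<integral>\<^sup>+ x. f x \<partial>M) \<le> ennreal b" and "0 \<le> b" "0 < c"
  shows "prob {x \<in> space M. ennreal c \<le> f x} \<le> b / c"
proof -
  have one: "1 \<le> ennreal (1 / c) * f x" if "ennreal c \<le> f x" for x
  proof -
    have "1 = ennreal (1 / c) * ennreal c" using \<open>0 < c\<close> by (simp add: ennreal_mult[symmetric])
    also have "\<dots> \<le> ennreal (1 / c) * f x" using that by (rule mult_left_mono) simp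
    finally show ?thesis .
  qed
  have "emeasure M {x \<in> space M. ennreal c \<le> f x} \<le> emeasure M {x \<in> space M. 1 \<le> ennreal (1 / c) * f x}"
    using one by (intro emeasure_mono) auto
  also have "\<dots> \<le> ennreal (1 / c) * (\<integral>\<^sup>+ x. f x * indicator (space M) x \<partial>M)"
    by (rule nn_integral_Markov_inequality[OF _ sets.top]) measurable
  also have "(\<integral>\<^sup>+ x. f x * indicator (space M) x \<partial>M) = (\<integral>\<^sup>+ x. f x \<partial>M)"
    by (intro nn_integral_cong) simp
  also have "ennreal (1 / c) * \<dots> \<le> ennreal (1 / c) * ennreal b"
    using le by (rule mult_left_mono) simp
  also have "\<dots> = ennreal (b / c)" using assms by (simp add: ennreal_mult[symmetric])
  finally show ?thesis using assms by (simp add: emeasure_eq_measure)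
qed

text \<open>Boundedness makes the likelihood integrable under the prior, so that the integrals in
  \<open>posterior\<close> are not default values.\<close>

lemma obs_density_bounds: "0 \<le> obs_density \<theta> z" "obs_density \<theta> z \<le> 1"
proof -
  obtain x y where z: "z = (x, y)" by (cases z)
  have "1 \<le> sqrt (2 * pi)" using pi_ge_two by (intro real_le_rsqrt) simp
  then have "1 / sqrt (2 * pi) * exp (- (y - step_fun \<theta> x)\<^sup>2 / 2) \<le> 1 * 1"
    by (intro mult_mono) auto
  then show "0 \<le> obs_density \<theta> z" "obs_density \<theta> z \<le> 1"
    unfolding z by (auto simp: obs_density_def std_normal_density_def indicator_def)
qed

text \<open>If a design point falls outside [0,1), the likelihood is 0 for every parameter and the
  posterior is 0 / 0 = 0. Such samples form a null set.\<close>

lemma AE_sample_design: "AE z in sample_law \<theta> n. \<forall>i\<in>{1..n}. 0 \<le> fst (z i) \<and> fst (z i) < 1"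
proof -
  have "0 \<le> fst z \<and> fst z < 1" if "0 < obs_density \<theta> z" for z
  proof (rule ccontr)
    assume "\<not> (0 \<le> fst z \<and> fst z < 1)"
    then have "obs_density \<theta> z = 0" by (cases z) (auto simp: obs_density_def)
    then show False using that by simp
  qed
  then have "AE z in obs_law \<theta>. 0 \<le> fst z \<and> fst z < 1"
    unfolding obs_law_eq_density by (subst AE_density) simp_all
  then have "AE z in sample_law \<theta> n. 0 \<le> fst (z i) \<and> fst (z i) < 1" if "i \<in> {1..n}" for i
    unfolding sample_law_def by (intro AE_PiM_component prob_space_obs_law that)
  then show ?thesis by (intro AE_finite_allI) auto
qed

context
  fixes kmax :: nat and K :: real and p :: "nat \<Rightarrow> real"
    and \<pi>a :: "nat \<Rightarrow> (nat \<Rightarrow> real) \<Rightarrow> (nat \<Rightarrow> real) \<Rightarrow> real" and \<pi>t :: "nat \<Rightarrow> (nat \<Rightarrow> real) \<Rightarrow> real"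
    and k0 :: nat and a0 t0 :: "nat \<Rightarrow> real"
  assumes \<theta>0: "(k0, a0, t0) \<in> Theta kmax K" and K: "0 < K"
    and prob_prior: "prob_space (prior kmax K p \<pi>a \<pi>t)"
begin

interpretation Q: prob_space "prior kmax K p \<pi>a \<pi>t" by (rule prob_prior)

private abbreviation (input) "Q \<equiv> prior kmax K p \<pi>a \<pi>t"
private abbreviation (input) "\<theta>0 \<equiv> (k0, a0, t0)"
private abbreviation (input) "S \<equiv> sample_law \<theta>0"
private abbreviation (input) "\<Lambda> \<equiv> log_ratio \<theta>0"

interpretation S: prob_space "S n" for n by (rule prob_space_sample_law)

private lemma gap_le: "\<theta> \<in> Theta kmax K \<Longrightarrow> \<bar>gap \<theta>0 \<theta> x\<bar> \<le> 2 * K"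
  using abs_gap_le[OF \<theta>0] K by simp

lemma log_ratio_jointly_measurable [measurable]:
  "(\<lambda>w. \<Lambda> n (snd w) (fst w)) \<in> borel_measurable (S n \<Otimes>\<^sub>M Q)"
  by (rule measurable_log_ratio_compose) measurable

lemma log_ratio_measurable_prior [measurable]:
  assumes "z \<in> space (S n)"
  shows "(\<lambda>\<theta>. \<Lambda> n \<theta> z) \<in> borel_measurable Q"
  using measurable_compose[OF measurable_Pair1'[OF assms] log_ratio_jointly_measurable] by simp

private lemma tonelli:
  assumes [measurable]: "(\<lambda>w. g (snd w) (fst w)) \<in> borel_measurable (S n \<Otimes>\<^sub>M Q)"
  shows "(\<lambda>z. \<integral>\<^sup>+ \<theta>. g \<theta> z \<partial>Q) \<in> borel_measurable (S n)"
    and "(\<integral>\<^sup>+ z. \<integral>\<^sup>+ \<theta>. g \<theta> z \<partial>Q \<partial>S n) = (\<integral>\<^sup>+ \<theta>. \<integral>\<^sup>+ z. g \<theta> z \<partial>S n \<partial>Q)"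
proof -
  interpret SQ: pair_sigma_finite "S n" Q ..
  have m: "(\<lambda>(z, \<theta>). g \<theta> z) \<in> borel_measurable (S n \<Otimes>\<^sub>M Q)" using assms by (simp add: case_prod_beta')
  show "(\<lambda>z. \<integral>\<^sup>+ \<theta>. g \<theta> z \<partial>Q) \<in> borel_measurable (S n)"
    using Q.borel_measurable_nn_integral[OF m] .
  show "(\<integral>\<^sup>+ z. \<integral>\<^sup>+ \<theta>. g \<theta> z \<partial>Q \<partial>S n) = (\<integral>\<^sup>+ \<theta>. \<integral>\<^sup>+ z. g \<theta> z \<partial>S n \<partial>Q)"
    by (rule SQ.Fubini'[OF m, symmetric])
qed

text \<open>The integrated likelihood relative to that of the truth, a factor that cancels in the
  posterior. With values in \<open>ennreal\<close>, Tonelli's theorem applies without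
  integrability.\<close>

definition evidence :: "nat \<Rightarrow> param set \<Rightarrow> (nat \<Rightarrow> real \<times> real) \<Rightarrow> ennreal" where
  "evidence n B z = (\<integral>\<^sup>+ \<theta>. ennreal (exp (\<Lambda> n \<theta> z)) * indicator B \<theta> \<partial>Q)"

lemma measurable_evidence [measurable]:
  assumes [measurable]: "B \<in> sets Q"
  shows "evidence n B \<in> borel_measurable (S n)"
  unfolding evidence_def by (rule tonelli) measurable

text \<open>Markov's inequality for the integrated inverse likelihood ratio, and \<open>L + d\<^sup>2 / L \<ge> 2 d\<close>.\<close>

lemma prob_evidence_small:
  assumes B [measurable]: "B \<in> sets Q" and h: "\<And>\<theta>. \<theta> \<in> B \<Longrightarrow> n * sqdist \<theta>0 \<theta> \<le> h" and "0 < d"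
    and pos: "0 < measure Q B"
  shows "measure (S n) {z \<in> space (S n). evidence n B z < ennreal (d * measure Q B)} \<le> exp (exp (4 * K\<^sup>2) * h) * d"
proof -
  define q where "q = measure Q B"
  define C where "C = exp (exp (4 * K\<^sup>2) * h)"
  define I where "I z = (\<integral>\<^sup>+ \<theta>. ennreal (exp (- \<Lambda> n \<theta> z)) * indicator B \<theta> \<partial>Q)" for z
  have q: "0 < q" "emeasure Q B = ennreal q" using pos by (auto simp: q_def Q.emeasure_eq_measure)
  have BT: "B \<subseteq> Theta kmax K" using sets.sets_into_space[OF B] by (simp add: space_prior)
  have jm: "(\<lambda>w. ennreal (exp (- \<Lambda> n (snd w) (fst w))) * indicator B (snd w)) \<in> borel_measurable (S n \<Otimes>\<^sub>M Q)"
    by measurable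
  have [measurable]: "I \<in> borel_measurable (S n)"
    unfolding I_def by (rule tonelli(1)[OF jm])
  have "(\<integral>\<^sup>+ z. I z \<partial>S n) = (\<integral>\<^sup>+ \<theta>. \<integral>\<^sup>+ z. ennreal (exp (- \<Lambda> n \<theta> z)) * indicator B \<theta> \<partial>S n \<partial>Q)"
    unfolding I_def by (rule tonelli(2)[OF jm])
  also have "\<dots> \<le> (\<integral>\<^sup>+ \<theta>. ennreal C * indicator B \<theta> \<partial>Q)"
  proof (intro nn_integral_mono)
    fix \<theta>
    show "(\<integral>\<^sup>+ z. ennreal (exp (- \<Lambda> n \<theta> z)) * indicator B \<theta> \<partial>S n) \<le> ennreal C * indicator B \<theta>"
    proof (cases "\<theta> \<in> B")
      case True
      have "(\<integral>\<^sup>+ z. ennreal (exp (- \<Lambda> n \<theta> z)) \<partial>S n) \<le> ennreal (exp (n * (exp ((2 * K)\<^sup>2) * sqdist \<theta>0 \<theta>)))"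
        by (rule nn_integral_inverse_likelihood_le) (use gap_le True BT in blast)
      also have "\<dots> \<le> ennreal C"
      proof (intro ennreal_leI)
        have "exp ((2 * K)\<^sup>2) * (n * sqdist \<theta>0 \<theta>) \<le> exp ((2 * K)\<^sup>2) * h"
          using h[OF True] by (intro mult_left_mono) auto
        then show "exp (n * (exp ((2 * K)\<^sup>2) * sqdist \<theta>0 \<theta>)) \<le> C"
          by (simp add: C_def power_mult_distrib mult_ac)
      qed
      finally show ?thesis using True by simp
    qed simp
  qed
  also have "\<dots> = ennreal (C * q)"
    using q by (subst nn_integral_cmult_indicator) (auto simp: ennreal_mult C_def)
  finally have EI: "(\<integral>\<^sup>+ z. I z \<partial>S n) \<le> ennreal (C * q)" .
  have amgm: "ennreal (2 * d * q) \<le> evidence n B z + ennreal (d\<^sup>2) * I z" if "z \<in> space (S n)" for z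
  proof -
    note [measurable] = log_ratio_measurable_prior[OF that]
    have "ennreal (2 * d * q) = (\<integral>\<^sup>+ \<theta>. ennreal (2 * d) * indicator B \<theta> \<partial>Q)"
      using q \<open>0 < d\<close> by (subst nn_integral_cmult_indicator) (auto simp: ennreal_mult)
    also have "\<dots> \<le> (\<integral>\<^sup>+ \<theta>. ennreal (exp (\<Lambda> n \<theta> z)) * indicator B \<theta> + ennreal (d\<^sup>2) * (ennreal (exp (- \<Lambda> n \<theta> z)) * indicator B \<theta>) \<partial>Q)"
    proof (intro nn_integral_mono)
      fix \<theta>
      let ?L = "exp (\<Lambda> n \<theta> z)"
      have "0 \<le> (?L - d)\<^sup>2 / ?L" by simp
      also have "(?L - d)\<^sup>2 / ?L = ?L + d\<^sup>2 * exp (- \<Lambda> n \<theta> z) - 2 * d"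
        by (simp add: exp_minus power2_eq_square field_simps)
      finally have "ennreal (2 * d) \<le> ennreal ?L + ennreal (d\<^sup>2) * ennreal (exp (- \<Lambda> n \<theta> z))"
        by (simp add: ennreal_mult[symmetric] ennreal_plus[symmetric] ennreal_leI del: ennreal_plus)
      then show "ennreal (2 * d) * indicator B \<theta> \<le> ennreal ?L * indicator B \<theta> + ennreal (d\<^sup>2) * (ennreal (exp (- \<Lambda> n \<theta> z)) * indicator B \<theta>)"
        by (simp add: indicator_def)
    qed
    also have "\<dots> = evidence n B z + ennreal (d\<^sup>2) * I z"
      unfolding evidence_def I_def by (subst nn_integral_add, measurable) (subst nn_integral_cmult, auto)
    finally show ?thesis .
  qed
  \<comment> \<open>By \<open>amgm\<close>, evidence below d q forces d^2 I above d q, that is, I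
    above q / d. Markov's inequality then yields (C q) / (q / d) = C d.\<close>
  have "{z \<in> space (S n). evidence n B z < ennreal (d * q)} \<subseteq> {z \<in> space (S n). ennreal (q / d) \<le> I z}"
  proof clarify
    fix z assume z: "z \<in> space (S n)" "evidence n B z < ennreal (d * q)"
    show "ennreal (q / d) \<le> I z"
    proof (rule ccontr)
      assume "\<not> ennreal (q / d) \<le> I z"
      then have "ennreal (d\<^sup>2) * I z \<le> ennreal (d\<^sup>2) * ennreal (q / d)" by (intro mult_left_mono) auto
      also have "\<dots> = ennreal (d * q)"
        using q \<open>0 < d\<close> by (simp add: ennreal_mult[symmetric] power2_eq_square)
      finally have le: "ennreal (d\<^sup>2) * I z \<le> ennreal (d * q)" .
      obtain x where x: "0 \<le> x" "evidence n B z = ennreal x" "x < d * q"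
        using z(2) by (cases "evidence n B z" rule: ennreal_cases) (auto simp: ennreal_less_iff)
      have "evidence n B z + ennreal (d\<^sup>2) * I z \<le> ennreal x + ennreal (d * q)"
        unfolding x(2) by (rule add_left_mono[OF le])
      also have "\<dots> = ennreal (x + d * q)" using x q \<open>0 < d\<close> by (simp add: ennreal_plus[symmetric] del: ennreal_plus)
      also have "\<dots> < ennreal (2 * d * q)" using x q \<open>0 < d\<close> by (intro ennreal_lessI) auto
      finally show False using amgm[OF z(1)] by simp
    qed
  qed
  then have "measure (S n) {z \<in> space (S n). evidence n B z < ennreal (d * q)} \<le> measure (S n) {z \<in> space (S n). ennreal (q / d) \<le> I z}"
    by (rule S.finite_measure_mono) measurable
  also have "\<dots> \<le> (C * q) / (q / d)"
    using EI q \<open>0 < d\<close> by (intro S.prob_ge_le_nn_integral) (auto simp: C_def)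
  also have "\<dots> = C * d" using q by simp
  finally show ?thesis by (simp add: q_def C_def)
qed

lemma prob_evidence_large:
  fixes u \<epsilon> \<rho> \<kappa> :: real
  assumes A [measurable]: "A \<in> sets Q" and near: "measure Q {\<theta> \<in> A. sqdist \<theta>0 \<theta> \<le> \<epsilon>\<^sup>2} \<le> \<rho>"
    and "0 \<le> u" "0 < \<kappa>"
  shows "measure (S n) {z \<in> space (S n). regular \<theta>0 n u z \<and> ennreal \<kappa> \<le> evidence n A z}
    \<le> (\<rho> + exp (kmax * k0 * u / 4) * exp (- real n * \<epsilon>\<^sup>2 / (8 + 4 * K\<^sup>2))) / \<kappa>"
proof -
  define N where "N = {\<theta> \<in> A. sqdist \<theta>0 \<theta> \<le> \<epsilon>\<^sup>2}"
  define c where "c = exp (kmax * k0 * u / 4)"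
  define b where "b = exp (- real n * \<epsilon>\<^sup>2 / (8 + 4 * K\<^sup>2))"
  have AT: "A \<subseteq> Theta kmax K" using sets.sets_into_space[OF A] by (simp add: space_prior)
  have "N = A \<inter> {\<theta> \<in> space Q. sqdist \<theta>0 \<theta> \<le> \<epsilon>\<^sup>2}" using AT by (auto simp: N_def space_prior)
  also have "\<dots> \<in> sets Q" by measurable
  finally have N [measurable]: "N \<in> sets Q" .
  \<comment> \<open>On the regular event \<open>log_ratio\<close> is at most kmax * k0 * u / 2,
    hence L <= c * sqrt L and g dominates the integrand. As g itself does not mention that event,
    its expectation can be computed over the whole sample space.\<close>
  define g where "g \<theta> z = ennreal (exp (\<Lambda> n \<theta> z)) * indicator N \<theta> + ennreal c * (ennreal (exp (\<Lambda> n \<theta> z / 2)) * indicator (A - N) \<theta>)" for \<theta> z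
  have jm: "(\<lambda>w. g (snd w) (fst w)) \<in> borel_measurable (S n \<Otimes>\<^sub>M Q)"
    unfolding g_def by measurable
  have Eg: "(\<integral>\<^sup>+ z. \<integral>\<^sup>+ \<theta>. g \<theta> z \<partial>Q \<partial>S n) \<le> ennreal (\<rho> + c * b)"
  proof -
    have "(\<integral>\<^sup>+ z. \<integral>\<^sup>+ \<theta>. g \<theta> z \<partial>Q \<partial>S n) = (\<integral>\<^sup>+ \<theta>. \<integral>\<^sup>+ z. g \<theta> z \<partial>S n \<partial>Q)"
      by (rule tonelli(2)[OF jm])
    also have "\<dots> \<le> (\<integral>\<^sup>+ \<theta>. indicator N \<theta> + ennreal (c * b) \<partial>Q)"
    proof (intro nn_integral_mono)
      fix \<theta> assume "\<theta> \<in> space Q"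
      have "(\<integral>\<^sup>+ z. g \<theta> z \<partial>S n) = (\<integral>\<^sup>+ z. ennreal (exp (\<Lambda> n \<theta> z)) \<partial>S n) * indicator N \<theta> +
          ennreal c * ((\<integral>\<^sup>+ z. ennreal (exp (\<Lambda> n \<theta> z / 2)) \<partial>S n) * indicator (A - N) \<theta>)"
        unfolding g_def by (subst nn_integral_add, measurable) (simp add: nn_integral_cmult nn_integral_multc)
      also have "\<dots> \<le> indicator N \<theta> + ennreal c * ennreal b"
      proof (intro add_mono mult_left_mono)
        show "(\<integral>\<^sup>+ z. ennreal (exp (\<Lambda> n \<theta> z)) \<partial>S n) * indicator N \<theta> \<le> indicator N \<theta>"
          by (simp add: nn_integral_likelihood)
        show "(\<integral>\<^sup>+ z. ennreal (exp (\<Lambda> n \<theta> z / 2)) \<partial>S n) * indicator (A - N) \<theta> \<le> ennreal b"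
        proof (cases "\<theta> \<in> A - N")
          case True
          then have \<theta>: "\<theta> \<in> Theta kmax K" "\<epsilon>\<^sup>2 \<le> sqdist \<theta>0 \<theta>" using AT by (auto simp: N_def)
          have "(\<integral>\<^sup>+ z. ennreal (exp (\<Lambda> n \<theta> z / 2)) \<partial>S n) \<le> ennreal (exp (- real n * sqdist \<theta>0 \<theta> / (8 + (2 * K)\<^sup>2)))"
            by (rule nn_integral_sqrt_likelihood_le) (rule gap_le[OF \<theta>(1)])
          also have "\<dots> \<le> ennreal b"
          proof (intro ennreal_leI)
            have "n * \<epsilon>\<^sup>2 / (8 + 4 * K\<^sup>2) \<le> n * sqdist \<theta>0 \<theta> / (8 + 4 * K\<^sup>2)"
              using \<theta>(2) by (intro divide_right_mono mult_left_mono) auto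
            then show "exp (- real n * sqdist \<theta>0 \<theta> / (8 + (2 * K)\<^sup>2)) \<le> b"
              by (simp add: b_def power_mult_distrib)
          qed
          finally show ?thesis using True by simp
        qed simp
      qed simp
      also have "\<dots> = indicator N \<theta> + ennreal (c * b)" by (simp add: ennreal_mult c_def b_def)
      finally show "(\<integral>\<^sup>+ z. g \<theta> z \<partial>S n) \<le> indicator N \<theta> + ennreal (c * b)" .
    qed
    also have "\<dots> = emeasure Q N + ennreal (c * b)"
      by (subst nn_integral_add) (auto simp: Q.emeasure_space_1)
    also have "\<dots> \<le> ennreal \<rho> + ennreal (c * b)"
      using near by (intro add_mono) (auto simp: N_def Q.emeasure_eq_measure ennreal_leI)
    also have "\<dots> = ennreal (\<rho> + c * b)"
      using order_trans[OF measure_nonneg near] by (intro ennreal_plus[symmetric]) (auto simp: c_def b_def)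
    finally show ?thesis .
  qed
  have le: "evidence n A z \<le> (\<integral>\<^sup>+ \<theta>. g \<theta> z \<partial>Q)" if "regular \<theta>0 n u z" for z
    unfolding evidence_def
  proof (intro nn_integral_mono)
    fix \<theta> assume "\<theta> \<in> space Q"
    then obtain k a t where \<theta>: "\<theta> = (k, a, t)" "k \<in> {1..kmax}" "t \<in> locations k"
      by (cases \<theta>) (simp add: space_prior Theta_def)
    have "\<Lambda> n \<theta> z \<le> real k * real k0 * (u / 2)"
      using \<theta> \<theta>0 by (intro log_ratio_le_of_regular[OF that \<open>0 \<le> u\<close> \<theta>(1) refl]) (auto simp: Theta_def)
    also have "\<dots> \<le> real kmax * real k0 * (u / 2)"
      using \<theta>(2) \<open>0 \<le> u\<close> by (intro mult_right_mono) auto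
    finally have "exp (\<Lambda> n \<theta> z) \<le> c * exp (\<Lambda> n \<theta> z / 2)"
      unfolding c_def by (simp add: exp_add[symmetric])
    then have "ennreal (exp (\<Lambda> n \<theta> z)) \<le> ennreal c * ennreal (exp (\<Lambda> n \<theta> z / 2))"
      by (simp add: ennreal_mult[symmetric] c_def ennreal_leI)
    then show "ennreal (exp (\<Lambda> n \<theta> z)) * indicator A \<theta> \<le> g \<theta> z"
      unfolding g_def by (auto simp: indicator_def N_def)
  qed
  have m: "(\<lambda>z. \<integral>\<^sup>+ \<theta>. g \<theta> z \<partial>Q) \<in> borel_measurable (S n)" by (rule tonelli(1)[OF jm])
  have "measure (S n) {z \<in> space (S n). regular \<theta>0 n u z \<and> ennreal \<kappa> \<le> evidence n A z}
    \<le> measure (S n) {z \<in> space (S n). ennreal \<kappa> \<le> (\<integral>\<^sup>+ \<theta>. g \<theta> z \<partial>Q)}"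
  proof (rule S.finite_measure_mono)
    show "{z \<in> space (S n). ennreal \<kappa> \<le> (\<integral>\<^sup>+ \<theta>. g \<theta> z \<partial>Q)} \<in> sets (S n)"
      using m by measurable
  qed (use le in \<open>auto intro: order_trans\<close>)
  also have "\<dots> \<le> (\<rho> + c * b) / \<kappa>"
    using Eg m \<open>0 < \<kappa>\<close> order_trans[OF measure_nonneg near]
    by (intro S.prob_ge_le_nn_integral) (auto simp: c_def b_def)
  finally show ?thesis by (simp add: c_def b_def)
qed

text \<open>One minus the posterior is the evidence of the complement over the total evidence: for a
  design in [0,1) the likelihood of the truth is positive and cancels.\<close>

lemma posterior_close_to_one:
  assumes z: "z \<in> space (S n)" "\<And>i. i \<in> {1..n} \<Longrightarrow> 0 \<le> fst (z i) \<and> fst (z i) < 1"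
    and A [measurable]: "A \<in> sets Q" and B: "B \<subseteq> space Q"
    and den: "ennreal \<kappa> \<le> evidence n B z" and num: "evidence n (space Q - A) z \<le> ennreal (e * \<kappa>)" and "0 < \<kappa>" "0 \<le> e"
  shows "\<bar>posterior Q n z A - 1\<bar> \<le> e"
proof -
  define P where "P \<theta> = (\<Prod>i=1..n. obs_density \<theta> (z i))" for \<theta>
  have P_bounds: "0 \<le> P \<theta>" "P \<theta> \<le> 1" for \<theta>
    unfolding P_def by (intro prod_nonneg prod_le_1 ballI conjI obs_density_bounds)+
  have [measurable]: "P \<in> borel_measurable Q"
    unfolding P_def using z(1) unfolding space_sample_law
    by (intro measurable_likelihood_compose[OF measurable_ident[unfolded id_def]] measurable_const)
  have int: "integrable Q P"
    by (rule Q.integrable_const_bound[of _ 1]) (use P_bounds in auto)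
  have p0: "0 < P \<theta>0" unfolding P_def
    using z(2) by (intro prod_pos) (auto simp: obs_density_def case_prod_beta normal_density_pos indicator_def)
  note [measurable] = log_ratio_measurable_prior[OF z(1)]
  have ev: "ennreal (LINT \<theta>:D|Q. P \<theta>) = ennreal (P \<theta>0) * evidence n D z" if [measurable]: "D \<in> sets Q" for D
  proof -
    have "ennreal (LINT \<theta>:D|Q. P \<theta>) = (\<integral>\<^sup>+ \<theta>. ennreal (indicator D \<theta> *\<^sub>R P \<theta>) \<partial>Q)"
      unfolding set_lebesgue_integral_def using int P_bounds
      by (intro nn_integral_eq_integral[symmetric] integrable_mult_indicator) auto
    also have "\<dots> = (\<integral>\<^sup>+ \<theta>. ennreal (P \<theta>0) * (ennreal (exp (\<Lambda> n \<theta> z)) * indicator D \<theta>) \<partial>Q)"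
    proof (intro nn_integral_cong)
      fix \<theta>
      have "P \<theta> = P \<theta>0 * exp (\<Lambda> n \<theta> z)" unfolding P_def by (rule prod_obs_density_ratio)
      then show "ennreal (indicator D \<theta> *\<^sub>R P \<theta>) = ennreal (P \<theta>0) * (ennreal (exp (\<Lambda> n \<theta> z)) * indicator D \<theta>)"
        using p0 by (simp add: ennreal_mult indicator_def)
    qed
    also have "\<dots> = ennreal (P \<theta>0) * evidence n D z"
      unfolding evidence_def by (rule nn_integral_cmult) measurable
    finally show ?thesis .
  qed
  let ?T = "LINT \<theta>|Q. P \<theta>" and ?R = "LINT \<theta>:space Q - A|Q. P \<theta>"
  have T: "?T = (LINT \<theta>:space Q|Q. P \<theta>)"
    unfolding set_lebesgue_integral_def by (intro Bochner_Integration.integral_cong) auto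
  have "ennreal (P \<theta>0 * \<kappa>) \<le> ennreal (P \<theta>0) * evidence n B z"
    using den p0 \<open>0 < \<kappa>\<close> by (simp add: ennreal_mult mult_left_mono)
  also have "\<dots> \<le> ennreal (P \<theta>0) * evidence n (space Q) z"
    unfolding evidence_def using B by (intro mult_left_mono nn_integral_mono) (auto simp: indicator_def)
  also have "\<dots> = ennreal ?T" unfolding T by (rule ev[symmetric]) simp
  finally have T_ge: "P \<theta>0 * \<kappa> \<le> ?T"
    using p0 \<open>0 < \<kappa>\<close> by (subst (asm) ennreal_le_iff) (auto intro: Bochner_Integration.integral_nonneg P_bounds)
  have "ennreal ?R = ennreal (P \<theta>0) * evidence n (space Q - A) z" by (rule ev) measurable
  also have "\<dots> \<le> ennreal (P \<theta>0) * ennreal (e * \<kappa>)" using num by (rule mult_left_mono) simp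
  also have "\<dots> = ennreal (P \<theta>0 * (e * \<kappa>))" using p0 \<open>0 \<le> e\<close> \<open>0 < \<kappa>\<close> by (simp add: ennreal_mult)
  finally have R_le: "?R \<le> e * (P \<theta>0 * \<kappa>)"
    using p0 \<open>0 \<le> e\<close> \<open>0 < \<kappa>\<close> by (subst (asm) ennreal_le_iff) (auto simp: mult_ac)
  have R_nn: "0 \<le> ?R" unfolding set_lebesgue_integral_def using P_bounds by (intro Bochner_Integration.integral_nonneg) auto
  have split: "?T = (LINT \<theta>:A|Q. P \<theta>) + ?R"
  proof -
    have "(LINT \<theta>:A \<union> (space Q - A)|Q. P \<theta>) = (LINT \<theta>:A|Q. P \<theta>) + ?R"
      using int by (intro set_integral_Un)
        (auto simp: set_integrable_def simp del: real_scaleR_def intro!: integrable_mult_indicator)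
    moreover have "A \<union> (space Q - A) = space Q" using sets.sets_into_space[OF A] by auto
    ultimately show ?thesis unfolding T by simp
  qed
  have Tpos: "0 < ?T" using T_ge p0 \<open>0 < \<kappa>\<close> by (meson less_le_trans mult_pos_pos)
  have "posterior Q n z A - 1 = - (?R / ?T)"
    unfolding posterior_def P_def[symmetric] using split Tpos by (simp add: field_simps)
  then have "\<bar>posterior Q n z A - 1\<bar> = ?R / ?T" using R_nn Tpos by simp
  also have "\<dots> \<le> e"
  proof -
    have "?R \<le> e * ?T" using R_le mult_left_mono[OF T_ge \<open>0 \<le> e\<close>] by linarith
    then show ?thesis using Tpos by (simp add: divide_le_eq)
  qed
  finally show ?thesis .
qed

text \<open>Three bad events: irregular noise, small evidence of B, and large evidence off A for a
  regular sample. Outside them \<open>posterior_close_to_one\<close> applies almost surely with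
  \<open>\<kappa>\<close> equal to d times the prior mass of B.\<close>

lemma prob_posterior_far:
  fixes u \<epsilon> \<rho> d e h :: real
  assumes A [measurable]: "A \<in> sets Q" and B [measurable]: "B \<in> sets Q"
    and h: "\<And>\<theta>. \<theta> \<in> B \<Longrightarrow> n * sqdist \<theta>0 \<theta> \<le> h" and q: "0 < measure Q B"
    and near: "measure Q {\<theta> \<in> space Q - A. sqdist \<theta>0 \<theta> \<le> \<epsilon>\<^sup>2} \<le> \<rho>"
    and "0 \<le> u" "0 < d" "0 < e"
  shows "measure (S n) {z \<in> space (S n). e < \<bar>posterior Q n z A - 1\<bar>} \<le>
    2 * (real n)\<^sup>2 * exp (- u / 2) + exp (exp (4 * K\<^sup>2) * h) * d +
    (\<rho> + exp (kmax * k0 * u / 4) * exp (- real n * \<epsilon>\<^sup>2 / (8 + 4 * K\<^sup>2))) / (e * (d * measure Q B))"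
proof -
  define \<kappa> where "\<kappa> = d * measure Q B"
  have \<kappa>: "0 < \<kappa>" using q \<open>0 < d\<close> by (simp add: \<kappa>_def)
  let ?E1 = "{z \<in> space (S n). \<not> regular \<theta>0 n u z}"
  let ?E2 = "{z \<in> space (S n). evidence n B z < ennreal \<kappa>}"
  let ?E3 = "{z \<in> space (S n). regular \<theta>0 n u z \<and> ennreal (e * \<kappa>) \<le> evidence n (space Q - A) z}"
  have reg: "Measurable.pred (S n) (regular \<theta>0 n u)"
    by (subst measurable_cong_sets[OF sets_sample_law refl]) (rule measurable_regular)
  note [measurable] = reg
  have E: "?E1 \<in> sets (S n)" "?E2 \<in> sets (S n)" "?E3 \<in> sets (S n)" by measurable
  have far: "z \<in> ?E1 \<union> ?E2 \<union> ?E3"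
    if d: "\<forall>i\<in>{1..n}. 0 \<le> fst (z i) \<and> fst (z i) < 1"
      and z: "z \<in> space (S n)" "e < \<bar>posterior Q n z A - 1\<bar>" for z
  proof (rule ccontr)
    assume "z \<notin> ?E1 \<union> ?E2 \<union> ?E3"
    then have "ennreal \<kappa> \<le> evidence n B z" "evidence n (space Q - A) z \<le> ennreal (e * \<kappa>)"
      using z(1) by auto
    then have "\<bar>posterior Q n z A - 1\<bar> \<le> e"
      using z d \<kappa> \<open>0 < e\<close> sets.sets_into_space[OF B]
      by (intro posterior_close_to_one[where B=B and \<kappa>=\<kappa>]) auto
    then show False using z by simp
  qed
  have "AE z in S n. z \<in> {z \<in> space (S n). e < \<bar>posterior Q n z A - 1\<bar>} \<longrightarrow> z \<in> ?E1 \<union> ?E2 \<union> ?E3"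
    by (rule AE_mp[OF AE_sample_design[where n=n and \<theta>=\<theta>0]], rule AE_I2) (use far in blast)
  then have "measure (S n) {z \<in> space (S n). e < \<bar>posterior Q n z A - 1\<bar>} \<le> measure (S n) (?E1 \<union> ?E2 \<union> ?E3)"
    using E by (intro S.finite_measure_mono_AE) auto
  also have "\<dots> \<le> measure (S n) ?E1 + measure (S n) ?E2 + measure (S n) ?E3"
    using measure_Un_le[of "?E1 \<union> ?E2" "S n" ?E3] measure_Un_le[of ?E1 "S n" ?E2] E by auto
  also have "\<dots> \<le> 2 * (real n)\<^sup>2 * exp (- u / 2) + exp (exp (4 * K\<^sup>2) * h) * d +
    (\<rho> + exp (kmax * k0 * u / 4) * exp (- real n * \<epsilon>\<^sup>2 / (8 + 4 * K\<^sup>2))) / (e * \<kappa>)"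
    unfolding \<kappa>_def using q \<open>0 < d\<close> \<open>0 < e\<close>
    by (intro add_mono prob_not_regular prob_evidence_small prob_evidence_large near B h assms(6,7)) auto
  finally show ?thesis by (simp add: \<kappa>_def)
qed

end

section \<open>The prior mass bounds for the mixture over k\<close>

lemma measure_prior_close_le:
  fixes K \<Delta> J :: real
  assumes \<theta>0: "(k0, a0, t0) \<in> Theta kmax K" and K: "0 < K" and \<Delta>: "0 < \<Delta>" and J: "0 < J"
    and sep: "\<And>l. l \<in> {1..k0} \<Longrightarrow> \<Delta> \<le> knot k0 t0 l - knot k0 t0 (l - 1)"
    and jump: "\<And>l. l \<in> {2..k0} \<Longrightarrow> J \<le> \<bar>a0 l - a0 (l - 1)\<bar>"
    and pd: "\<And>k. k \<in> {1..kmax} \<Longrightarrow> prior_densities k K (\<pi>a k) (\<pi>t k)"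
    and ba: "\<And>k. k \<in> {1..kmax} \<Longrightarrow> bounded_away k K (\<pi>a k) (\<pi>t k)"
    and p: "\<And>k. k \<in> {1..kmax} \<Longrightarrow> 0 \<le> p k" "(\<Sum>k=1..kmax. p k) = 1"
  shows "\<exists>M. \<forall>\<^sub>F \<epsilon> in at_right 0. measure (prior kmax K p \<pi>a \<pi>t)
      {\<theta> \<in> Theta kmax K. fst \<theta> \<noteq> k0 \<and> sqdist (k0, a0, t0) \<theta> \<le> \<epsilon>\<^sup>2} \<le> M * (\<epsilon> ^ (3 * k0 - 2) * sqrt \<epsilon>)"
proof -
  let ?Q = "prior kmax K p \<pi>a \<pi>t"
  let ?C = "\<lambda>k \<epsilon>. {(a, t). a \<in> levels k K \<and> t \<in> locations k \<and> sqdist (k0, a0, t0) (k, a, t) \<le> \<epsilon>\<^sup>2}"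
  let ?f = "\<lambda>\<epsilon>. \<epsilon> ^ (3 * k0 - 2) * sqrt \<epsilon>"
  interpret Q: prob_space ?Q by (rule prob_space_prior) (use pd p in auto)
  have "\<forall>k\<in>{1..kmax} - {k0}. \<exists>M. 0 \<le> M \<and> (\<forall>\<^sub>F \<epsilon> in at_right 0. emeasure (prior_k k K (\<pi>a k) (\<pi>t k)) (?C k \<epsilon>) \<le> ennreal (M * ?f \<epsilon>))"
  proof
    fix k assume "k \<in> {1..kmax} - {k0}"
    then have k: "k \<in> {1..kmax}" "k \<noteq> k0" by auto
    show "\<exists>M. 0 \<le> M \<and> (\<forall>\<^sub>F \<epsilon> in at_right 0. emeasure (prior_k k K (\<pi>a k) (\<pi>t k)) (?C k \<epsilon>) \<le> ennreal (M * ?f \<epsilon>))"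
      by (rule prior_k_close_le[OF \<theta>0 K \<Delta> J sep jump k pd[OF k(1)] ba[OF k(1)]])
  qed
  from bchoice[OF this] obtain M where M: "\<forall>k\<in>{1..kmax} - {k0}. 0 \<le> M k \<and>
      (\<forall>\<^sub>F \<epsilon> in at_right 0. emeasure (prior_k k K (\<pi>a k) (\<pi>t k)) (?C k \<epsilon>) \<le> ennreal (M k * ?f \<epsilon>))" ..
  then have "\<forall>\<^sub>F \<epsilon> in at_right 0. \<forall>k\<in>{1..kmax} - {k0}. emeasure (prior_k k K (\<pi>a k) (\<pi>t k)) (?C k \<epsilon>) \<le> ennreal (M k * ?f \<epsilon>)"
    by (intro eventually_ball_finite) auto
  moreover have "\<forall>\<^sub>F \<epsilon>::real in at_right 0. 0 < \<epsilon>" by (rule eventually_at_right_less)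
  ultimately have "\<forall>\<^sub>F \<epsilon> in at_right 0. measure ?Q {\<theta> \<in> Theta kmax K. fst \<theta> \<noteq> k0 \<and> sqdist (k0, a0, t0) \<theta> \<le> \<epsilon>\<^sup>2}
      \<le> (\<Sum>k\<in>{1..kmax} - {k0}. p k * M k) * ?f \<epsilon>"
  proof eventually_elim
    case (elim \<epsilon>)
    let ?N = "{\<theta> \<in> Theta kmax K. fst \<theta> \<noteq> k0 \<and> sqdist (k0, a0, t0) \<theta> \<le> \<epsilon>\<^sup>2}"
    have f: "0 \<le> ?f \<epsilon>" using elim(2) by simp
    have "?N \<in> sets ?Q" by (rule sets_prior_Collect) measurable
    then have "?N \<in> Theta_sets kmax K" by (simp add: sets_prior)
    then have "emeasure ?Q ?N = (\<Sum>k=1..kmax. ennreal (p k) * emeasure (prior_k k K (\<pi>a k) (\<pi>t k)) (Pair k -` ?N))"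
      by (rule emeasure_prior)
    also have "\<dots> = (\<Sum>k\<in>{1..kmax} - {k0}. ennreal (p k) * emeasure (prior_k k K (\<pi>a k) (\<pi>t k)) (Pair k -` ?N))"
      by (intro sum.mono_neutral_right) auto
    also have "\<dots> \<le> (\<Sum>k\<in>{1..kmax} - {k0}. ennreal (p k * M k * ?f \<epsilon>))"
    proof (intro sum_mono)
      fix k assume k: "k \<in> {1..kmax} - {k0}"
      have "Pair k -` ?N = ?C k \<epsilon>" using k by (auto simp: Theta_def)
      then have "ennreal (p k) * emeasure (prior_k k K (\<pi>a k) (\<pi>t k)) (Pair k -` ?N) \<le> ennreal (p k) * ennreal (M k * ?f \<epsilon>)"
        using elim(1) k by (intro mult_left_mono) auto
      also have "\<dots> = ennreal (p k * M k * ?f \<epsilon>)"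
        using p(1)[of k] M k f by (simp add: ennreal_mult[symmetric] mult.assoc)
      finally show "ennreal (p k) * emeasure (prior_k k K (\<pi>a k) (\<pi>t k)) (Pair k -` ?N) \<le> ennreal (p k * M k * ?f \<epsilon>)" .
    qed
    also have "\<dots> = ennreal ((\<Sum>k\<in>{1..kmax} - {k0}. p k * M k) * ?f \<epsilon>)"
      unfolding sum_distrib_right using p(1) M f by (intro sum_ennreal) auto
    finally show ?case
      unfolding Q.emeasure_eq_measure using p(1) M f
      by (subst (asm) ennreal_le_iff) (auto intro!: mult_nonneg_nonneg sum_nonneg)
  qed
  then show ?thesis by blast
qed

lemma measure_prior_nbhd_ge:
  fixes K \<Delta> :: real
  assumes \<theta>0: "(k0, a0, t0) \<in> Theta kmax K" and K: "0 < K" and \<Delta>: "0 < \<Delta>"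
    and sep: "\<And>l. l \<in> {1..k0} \<Longrightarrow> \<Delta> \<le> knot k0 t0 l - knot k0 t0 (l - 1)"
    and pd: "\<And>k. k \<in> {1..kmax} \<Longrightarrow> prior_densities k K (\<pi>a k) (\<pi>t k)"
    and ba: "bounded_away k0 K (\<pi>a k0) (\<pi>t k0)"
    and p: "\<And>k. k \<in> {1..kmax} \<Longrightarrow> 0 < p k" "(\<Sum>k=1..kmax. p k) = 1"
  shows "\<exists>c>0. \<forall>\<^sub>F r in at_right 0. Pair k0 ` nbhd k0 a0 t0 K r \<in> sets (prior kmax K p \<pi>a \<pi>t) \<and>
      c * r ^ (3 * k0 - 2) \<le> measure (prior kmax K p \<pi>a \<pi>t) (Pair k0 ` nbhd k0 a0 t0 K r)"
proof -
  let ?Q = "prior kmax K p \<pi>a \<pi>t"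
  interpret Q: prob_space ?Q by (rule prob_space_prior) (use pd p less_imp_le in auto)
  have k0: "k0 \<in> {1..kmax}" using \<theta>0 by (simp add: Theta_def)
  obtain c where c: "0 < c" and ev: "\<forall>\<^sub>F r in at_right 0. nbhd k0 a0 t0 K r \<in> sets (prior_k k0 K (\<pi>a k0) (\<pi>t k0)) \<and>
      ennreal (c * r ^ (3 * k0 - 2)) \<le> emeasure (prior_k k0 K (\<pi>a k0) (\<pi>t k0)) (nbhd k0 a0 t0 K r)"
    using prior_k_nbhd_ge[OF \<theta>0 K \<Delta> sep pd[OF k0] ba] by blast
  have "\<forall>\<^sub>F r::real in at_right 0. 0 < r" by (rule eventually_at_right_less)
  with ev have "\<forall>\<^sub>F r in at_right 0. Pair k0 ` nbhd k0 a0 t0 K r \<in> sets ?Q \<and>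
      p k0 * c * r ^ (3 * k0 - 2) \<le> measure ?Q (Pair k0 ` nbhd k0 a0 t0 K r)"
  proof eventually_elim
    case (elim r)
    let ?B = "Pair k0 ` nbhd k0 a0 t0 K r"
    have sec: "Pair k -` ?B = (if k = k0 then nbhd k0 a0 t0 K r else {})" for k by auto
    have "?B \<subseteq> Theta kmax K" using k0 by (auto simp: Theta_def nbhd_def)
    then have B: "?B \<in> Theta_sets kmax K"
      using elim(1) by (auto simp: Theta_sets_def sec prior_k_def)
    have "ennreal (p k0 * c * r ^ (3 * k0 - 2)) = ennreal (p k0) * ennreal (c * r ^ (3 * k0 - 2))"
      using p(1)[OF k0] c elim(2) by (simp add: ennreal_mult mult.assoc)
    also have "\<dots> \<le> ennreal (p k0) * emeasure (prior_k k0 K (\<pi>a k0) (\<pi>t k0)) (nbhd k0 a0 t0 K r)"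
      using elim(1) by (intro mult_left_mono) auto
    also have "\<dots> = ennreal (p k0) * emeasure (prior_k k0 K (\<pi>a k0) (\<pi>t k0)) (Pair k0 -` ?B)"
      by (simp add: sec)
    also have "\<dots> \<le> (\<Sum>k=1..kmax. ennreal (p k) * emeasure (prior_k k K (\<pi>a k) (\<pi>t k)) (Pair k -` ?B))"
      using k0 by (intro member_le_sum) auto
    also have "\<dots> = emeasure ?Q ?B" by (rule emeasure_prior[OF B, symmetric])
    finally show ?case using B by (simp add: Q.emeasure_eq_measure sets_prior)
  qed
  moreover have "0 < p k0 * c" using p(1)[OF k0] c by simp
  ultimately show ?thesis by blast
qed

section \<open>Choice of the rates and conclusion\<close>

lemma positive_lower_bound:
  fixes f :: "'b \<Rightarrow> real"
  assumes "finite I" "\<And>i. i \<in> I \<Longrightarrow> 0 < f i"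
  obtains \<delta> where "0 < \<delta>" "\<And>i. i \<in> I \<Longrightarrow> \<delta> \<le> f i"
proof
  \<comment> \<open>The inserted 1 takes care of an empty index set, which occurs for the jumps when
    k0 = 1.\<close>
  show "0 < Min (insert 1 (f ` I))" using assms by (subst Min_gr_iff) auto
  show "Min (insert 1 (f ` I)) \<le> f i" if "i \<in> I" for i using assms(1) that by (intro Min_le) auto
qed

text \<open>The comparison of prior masses: for r = n^(-1/2) the quotient \<epsilon> / r is sqrt (G
  ln n), and sqrt \<epsilon> supplies the decay n^(-1/4).\<close>

lemma log_power_limit:
  assumes "0 < G"
  shows "(\<lambda>n. sqrt (G * ln (real n)) ^ m * sqrt (sqrt (G * ln (real n) / real n))) \<longlonglongrightarrow> 0"
  using assms by real_asymp

theorem theorem2: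
  fixes kmax k0 :: nat and K :: real
    and a0 t0 :: "nat \<Rightarrow> real"
    and p :: "nat \<Rightarrow> real"
    and \<pi>a :: "nat \<Rightarrow> (nat \<Rightarrow> real) \<Rightarrow> (nat \<Rightarrow> real) \<Rightarrow> real"
    and \<pi>t :: "nat \<Rightarrow> (nat \<Rightarrow> real) \<Rightarrow> real"
  assumes "1 \<le> kmax" and "0 < K"
    and "(k0, a0, t0) \<in> Theta kmax K"
    and "\<forall>j\<in>{2..k0}. a0 j \<noteq> a0 (j - 1)"
    and "\<forall>k\<in>{1..kmax}. 0 < p k" and "(\<Sum>k=1..kmax. p k) = 1"
    and "\<forall>k\<in>{1..kmax}. prior_densities k K (\<pi>a k) (\<pi>t k)"
    and "\<forall>k\<in>{1..kmax}. bounded_away k K (\<pi>a k) (\<pi>t k)"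
  shows "tendsto_in_prob (sample_law (k0, a0, t0))
    (\<lambda>n z. posterior (prior kmax K p \<pi>a \<pi>t) n z {\<theta> \<in> Theta kmax K. fst \<theta> = k0}) 1"
proof -
  let ?Q = "prior kmax K p \<pi>a \<pi>t" and ?S = "sample_law (k0, a0, t0)"
  let ?A = "{\<theta> \<in> Theta kmax K. fst \<theta> = k0}"
  have K: "0 < K" and \<theta>0: "(k0, a0, t0) \<in> Theta kmax K" by fact+
  have p: "\<And>k. k \<in> {1..kmax} \<Longrightarrow> 0 < p k" "\<And>k. k \<in> {1..kmax} \<Longrightarrow> 0 \<le> p k" "(\<Sum>k=1..kmax. p k) = 1"
    using assms(5,6) by (auto intro: less_imp_le)
  have pd: "\<And>k. k \<in> {1..kmax} \<Longrightarrow> prior_densities k K (\<pi>a k) (\<pi>t k)" using assms(7) by blast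
  have ba: "\<And>k. k \<in> {1..kmax} \<Longrightarrow> bounded_away k K (\<pi>a k) (\<pi>t k)" using assms(8) by blast
  have prob: "prob_space ?Q" using prob_space_prior[OF pd p(2,3)] .
  have k0: "k0 \<in> {1..kmax}" and t0: "t0 \<in> locations k0" using \<theta>0 by (simp_all add: Theta_def)
  have A: "?A \<in> sets ?Q" by (rule sets_prior_Collect) measurable
  obtain \<Delta> where \<Delta>: "0 < \<Delta>" "\<And>l. l \<in> {1..k0} \<Longrightarrow> \<Delta> \<le> knot k0 t0 l - knot k0 t0 (l - 1)"
  proof (rule positive_lower_bound[of "{1..k0}" "\<lambda>l. knot k0 t0 l - knot k0 t0 (l - 1)"])
    show "0 < knot k0 t0 l - knot k0 t0 (l - 1)" if "l \<in> {1..k0}" for l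
      using t0 that unfolding locations_def by simp
  qed auto
  obtain J where J: "0 < J" "\<And>l. l \<in> {2..k0} \<Longrightarrow> J \<le> \<bar>a0 l - a0 (l - 1)\<bar>"
  proof (rule positive_lower_bound[of "{2..k0}" "\<lambda>l. \<bar>a0 l - a0 (l - 1)\<bar>"])
    show "0 < \<bar>a0 l - a0 (l - 1)\<bar>" if "l \<in> {2..k0}" for l
      using assms(4) that by simp
  qed auto
  define m where "m = 3 * k0 - 2"
  obtain M where M: "\<forall>\<^sub>F \<epsilon> in at_right 0. measure ?Q
      {\<theta> \<in> Theta kmax K. fst \<theta> \<noteq> k0 \<and> sqdist (k0, a0, t0) \<theta> \<le> \<epsilon>\<^sup>2} \<le> M * (\<epsilon> ^ m * sqrt \<epsilon>)"
    using measure_prior_close_le[OF \<theta>0 K \<Delta>(1) J(1) \<Delta>(2) J(2) pd ba p(2,3)] unfolding m_def by blast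
  obtain c where c: "0 < c" and cev: "\<forall>\<^sub>F r in at_right 0. Pair k0 ` nbhd k0 a0 t0 K r \<in> sets ?Q \<and>
      c * r ^ m \<le> measure ?Q (Pair k0 ` nbhd k0 a0 t0 K r)"
    using measure_prior_nbhd_ge[OF \<theta>0 K \<Delta> pd ba[OF k0] p(1,3)] unfolding m_def by blast
  define D where "D = 8 + 4 * K\<^sup>2"
  \<comment> \<open>For u = 6 ln n, the factor exp (kmax k0 u / 4) of the uniform bound is
    n^b.\<close>
  define b where "b = 3 / 2 * real (kmax * k0)"
  \<comment> \<open>This makes exp (- n \<epsilon>^2 / D) equal to n^(- (b + m / 2 + 1)): b offsets
    the uniform bound, m / 2 the division by r^m, and 1 leaves a term 1 / n.\<close>
  define G where "G = D * (b + m / 2 + 1)"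
  define h where "h = 1 + 8 * K\<^sup>2 * k0"
  have D: "0 < D" unfolding D_def by (simp add: add_pos_nonneg)
  have G: "0 < G" unfolding G_def b_def using D by (intro mult_pos_pos add_nonneg_pos) auto
  define r where "r n = 1 / sqrt (real n)" for n :: nat
  define \<epsilon> where "\<epsilon> n = sqrt (G * ln (real n) / real n)" for n :: nat
  \<comment> \<open>The factor 6 turns the bound 2 n^2 exp (- u / 2) for irregular noise into 2 /
    n.\<close>
  define u where "u n = 6 * ln (real n)" for n :: nat
  have r_lim: "filterlim r (at_right 0) sequentially" unfolding r_def by real_asymp
  have \<epsilon>_lim: "filterlim \<epsilon> (at_right 0) sequentially" unfolding \<epsilon>_def using G by real_asymp
  \<comment> \<open>The numerator of the last term in \<open>prob_posterior_far\<close>, divided by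
    the order r^m of the prior mass of \<open>nbhd\<close>. The constants c, d and e are kept
    apart.\<close>
  define R where "R n = (M * (\<epsilon> n ^ m * sqrt (\<epsilon> n)) + exp (kmax * k0 * u n / 4) * exp (- real n * (\<epsilon> n)\<^sup>2 / (8 + 4 * K\<^sup>2))) / r n ^ m" for n
  have R_lim: "R \<longlonglongrightarrow> 0"
  proof -
    have "R n = M * (sqrt (G * ln (real n)) ^ m * sqrt (sqrt (G * ln (real n) / real n))) + 1 / real n" if n: "n \<ge> 1" for n
    proof -
      have r: "0 < r n" using n by (simp add: r_def)
      have "\<epsilon> n = sqrt (G * ln (real n)) * r n" by (simp add: \<epsilon>_def r_def real_sqrt_divide)
      then have 1: "\<epsilon> n ^ m = sqrt (G * ln (real n)) ^ m * r n ^ m" by (simp add: power_mult_distrib)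
      have "real n * (\<epsilon> n)\<^sup>2 = G * ln (real n)" using n G by (simp add: \<epsilon>_def)
      then have "- real n * (\<epsilon> n)\<^sup>2 / (8 + 4 * K\<^sup>2) = - (b + m / 2 + 1) * ln (real n)"
        using D unfolding G_def D_def[symmetric] by simp (simp add: algebra_simps)
      moreover have "real (kmax * k0) * u n / 4 = b * ln (real n)" by (simp add: u_def b_def)
      ultimately have "exp (kmax * k0 * u n / 4) * exp (- real n * (\<epsilon> n)\<^sup>2 / (8 + 4 * K\<^sup>2)) = exp (- (m / 2 + 1) * ln (real n))"
        by (simp only: exp_add[symmetric]) (simp add: algebra_simps)
      also have "\<dots> = exp (m * - (ln (real n) / 2)) * exp (- ln (real n))"
        by (simp add: exp_add[symmetric] algebra_simps)
      also have "\<dots> = r n ^ m * (1 / real n)"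
      proof -
        have "exp (- (ln (real n) / 2)) = r n"
          using n by (simp add: r_def exp_minus inverse_eq_divide ln_sqrt[symmetric])
        then show ?thesis using n unfolding exp_of_nat_mult by (simp add: exp_minus inverse_eq_divide)
      qed
      finally have 2: "exp (kmax * k0 * u n / 4) * exp (- real n * (\<epsilon> n)\<^sup>2 / (8 + 4 * K\<^sup>2)) = r n ^ m * (1 / real n)" .
      show ?thesis unfolding R_def 1 2 using r by (simp add: \<epsilon>_def add_divide_distrib)
    qed
    then have "\<forall>\<^sub>F n in sequentially. M * (sqrt (G * ln (real n)) ^ m * sqrt (sqrt (G * ln (real n) / real n))) + 1 / real n = R n"
      by (intro eventually_sequentiallyI[of 1]) (simp del: One_nat_def)
    moreover have "(\<lambda>n. M * (sqrt (G * ln (real n)) ^ m * sqrt (sqrt (G * ln (real n) / real n))) + 1 / real n) \<longlonglongrightarrow> M * 0 + 0"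
      by (intro tendsto_intros log_power_limit[OF G] lim_1_over_n)
    ultimately show ?thesis by (simp add: Lim_transform_eventually)
  qed
  define C where "C = exp (exp (4 * K\<^sup>2) * h)"
  have C: "0 < C" by (simp add: C_def)
  have bound: "\<forall>\<^sub>F n in sequentially. measure (?S n) {z \<in> space (?S n). e < \<bar>posterior ?Q n z ?A - 1\<bar>}
      \<le> 2 / real n + C * d + R n / (e * (d * c))" if "0 < d" "0 < e" for d e
  proof -
    have "\<forall>\<^sub>F n in sequentially. measure ?Q {\<theta> \<in> Theta kmax K. fst \<theta> \<noteq> k0 \<and> sqdist (k0, a0, t0) \<theta> \<le> (\<epsilon> n)\<^sup>2} \<le> M * (\<epsilon> n ^ m * sqrt (\<epsilon> n))"
      by (rule eventually_compose_filterlim[OF M \<epsilon>_lim])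
    moreover have "\<forall>\<^sub>F n in sequentially. Pair k0 ` nbhd k0 a0 t0 K (r n) \<in> sets ?Q \<and>
        c * r n ^ m \<le> measure ?Q (Pair k0 ` nbhd k0 a0 t0 K (r n))"
      by (rule eventually_compose_filterlim[OF cev r_lim])
    moreover have "\<forall>\<^sub>F n in sequentially. n \<ge> (1::nat)" by (rule eventually_ge_at_top)
    ultimately show ?thesis
    proof eventually_elim
      case (elim n)
      let ?B = "Pair k0 ` nbhd k0 a0 t0 K (r n)"
      let ?X = "M * (\<epsilon> n ^ m * sqrt (\<epsilon> n)) + exp (kmax * k0 * u n / 4) * exp (- real n * (\<epsilon> n)\<^sup>2 / (8 + 4 * K\<^sup>2))"
      have r: "0 < r n" "real n * (r n)\<^sup>2 = 1" using elim(3) by (simp_all add: r_def power_divide)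
      have cr: "0 < c * r n ^ m" using c r by simp
      have q: "0 < measure ?Q ?B" using cr elim(2) by linarith
      have near_eq: "{\<theta> \<in> space ?Q - ?A. sqdist (k0, a0, t0) \<theta> \<le> (\<epsilon> n)\<^sup>2} = {\<theta> \<in> Theta kmax K. fst \<theta> \<noteq> k0 \<and> sqdist (k0, a0, t0) \<theta> \<le> (\<epsilon> n)\<^sup>2}"
        by (auto simp: space_prior)
      have near: "measure ?Q {\<theta> \<in> space ?Q - ?A. sqdist (k0, a0, t0) \<theta> \<le> (\<epsilon> n)\<^sup>2} \<le> M * (\<epsilon> n ^ m * sqrt (\<epsilon> n))"
        unfolding near_eq by (rule elim(1))
      \<comment> \<open>Since n r^2 = 1, the bound h does not depend on n.\<close>
      have hB: "real n * sqdist (k0, a0, t0) \<theta> \<le> h" if "\<theta> \<in> ?B" for \<theta>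
      proof -
        from that obtain x where x: "x \<in> nbhd k0 a0 t0 K (r n)" "\<theta> = (k0, x)" by blast
        obtain a t where "x = (a, t)" by (cases x)
        with x have at: "(a, t) \<in> nbhd k0 a0 t0 K (r n)" "\<theta> = (k0, a, t)" by simp_all
        have "real n * sqdist (k0, a0, t0) \<theta> \<le> real n * (h * (r n)\<^sup>2)"
          unfolding h_def at(2) by (intro mult_left_mono sqdist_nbhd_le[OF \<theta>0 K at(1)]) simp
        also have "\<dots> = h" using r(2) by (simp add: mult.left_commute)
        finally show ?thesis .
      qed
      have u: "0 \<le> u n" using elim(3) by (simp add: u_def)
      have X: "0 \<le> ?X" using order_trans[OF measure_nonneg near] by simp
      have "measure (?S n) {z \<in> space (?S n). e < \<bar>posterior ?Q n z ?A - 1\<bar>} \<le>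
          2 * (real n)\<^sup>2 * exp (- u n / 2) + exp (exp (4 * K\<^sup>2) * h) * d + ?X / (e * (d * measure ?Q ?B))"
        using prob_posterior_far[OF \<theta>0 K prob A _ hB q near u \<open>0 < d\<close> \<open>0 < e\<close>] elim(2) by blast
      also have "2 * (real n)\<^sup>2 * exp (- u n / 2) = 2 / real n"
      proof -
        have "exp (- u n / 2) = exp (- (3 * ln (real n)))" by (simp add: u_def)
        also have "\<dots> = 1 / real n ^ 3" using elim(3) exp_of_nat_mult[of 3 "ln (real n)"] by (simp add: exp_minus inverse_eq_divide)
        finally show ?thesis using elim(3) by (simp add: power2_eq_square power3_eq_cube)
      qed
      also have "?X / (e * (d * measure ?Q ?B)) \<le> ?X / (e * (d * (c * r n ^ m)))"
        using X c r(1) cr elim(2) \<open>0 < d\<close> \<open>0 < e\<close> by (intro divide_left_mono mult_left_mono mult_pos_pos q) auto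
      also have "?X / (e * (d * (c * r n ^ m))) = R n / (e * (d * c))"
        unfolding R_def by simp
      finally show ?case by (simp add: C_def mult.commute)
    qed
  qed
  have lim: "(\<lambda>n. measure (?S n) {z \<in> space (?S n). e < \<bar>posterior ?Q n z ?A - 1\<bar>}) \<longlonglongrightarrow> 0" if e: "0 < e" for e
  proof (rule tendstoI)
    fix \<delta> :: real assume \<delta>: "0 < \<delta>"
    \<comment> \<open>d is fixed before n tends to infinity: C d takes half of \<delta>, and the
      other terms, in which 1 / d is a constant, vanish.\<close>
    define d where "d = \<delta> / (2 * C)"
    have d: "0 < d" "C * d = \<delta> / 2" using \<delta> C by (simp_all add: d_def)
    have "(\<lambda>n. 2 / real n + R n / (e * (d * c))) \<longlonglongrightarrow> 0 + 0 / (e * (d * c))"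
      by (intro tendsto_intros R_lim lim_const_over_n) (use e d c in auto)
    then have "\<forall>\<^sub>F n in sequentially. 2 / real n + R n / (e * (d * c)) < \<delta> / 2"
      using \<delta> by (intro order_tendstoD(2)[where y=0]) auto
    with bound[OF d(1) e] show "\<forall>\<^sub>F n in sequentially.
        dist (measure (?S n) {z \<in> space (?S n). e < \<bar>posterior ?Q n z ?A - 1\<bar>}) 0 < \<delta>"
    proof eventually_elim
      case (elim n)
      then show ?case
        unfolding dist_real_def diff_zero abs_of_nonneg[OF measure_nonneg] using d(2) by linarith
    qed
  qed
  show ?thesis
    unfolding tendsto_in_prob_def using measurable_posterior[OF prob A] lim by blast
qed

end
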